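(* Let $\xi'=\sum_{i\ge 0}\sum_{j=1}^{L'_i}\delta_{T'_i+T'_{ij}}$ be a renewal cluster point process with stationary version $\xi=\sum_{i\in\mathbb{Z}}\sum_{j=1}^{L_i}\delta_{T_i+T_{ij}}$. If $\mathbb{E}R'_1<\infty$, where $R'_1=\sup_{j\le L'_1}|T'_{1j}|$, then $$\theta_t\xi'=\sum_{i\ge 0}\sum_{j=1}^{L'_i}\delta_{T'_i-t+T'_{ij}}\ \xrightarrow{d}\ \xi=\sum_{i\in\mathbb{Z}}\sum_{j=1}^{L_i}\delta_{T_i+T_{ij}}\qquad\text{as } t\to\infty,$$ where convergence in distribution is with respect to the vague topology on $M_p(\mathbb{R})$.
   Context: Notation: $\mathbb{R}_+=[0,\infty)$. $M_p(\mathbb{R})$ is the space of point measures on $\mathbb{R}$ finite on all bounded sets; $m_n\to m$ vaguely if $\int f\,dm_n\to\int f\,dm$ for all continuous bounded $f:\mathbb{R}\to\mathbb{R}$ with bounded support; $\theta_t m(A)=m(A+t)$. A nonnegative random variable is nonarithmetic if its law is not concentrated on $h\mathbb{Z}$ for any $h>0$. Renewal cluster point process $\xi'$: let $(X'_i)_{i\ge1}$ be nonnegative random variables with a nonarithmetic distribution and finite mean $\mu>0$, and let $\xi'_i$, $i\ge 1$, be point processes on $\mathbb{R}$ such that the pairs $W'_i=(\xi'_i,X'_i)$, $i\ge1$, are i.i.d. ($\xi'_i$ and $X'_i$ may be dependent). Let $W'_0=(\xi'_0,X'_0)$ be a random element of $M_p(\mathbb{R})\times\mathbb{R}_+$ independent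 of $(W'_i)_{i\ge1}$ (its law may differ from that of $W'_1$). Each $\xi'_i=\sum_{j=1}^{L'_i}\delta_{T'_{ij}}$, where $L'_i$ is an $\mathbb{N}_0$-valued random variable, assumed almost surely finite for every $i\ge0$, and $T'_{i1},T'_{i2},\ldots$ are real random variables; $W'_i$ is identified with $(L'_i,(T'_{ij})_j,X'_i)$, a random element of $\mathbb{M}=\mathbb{N}_0\times\mathbb{R}^{\mathbb{N}}\times\mathbb{R}_+$. Put $T'_i=\sum_{j=0}^iX'_j$, $i\ge0$, and $\xi'(B)=\sum_{i\ge0}\xi'_i(B-T'_i)=\sum_{i\ge0}\sum_{j=1}^{L'_i}\delta_{T'_i+T'_{ij}}(B)$ for Borel $B\subseteq\mathbb{R}$; it is assumed throughout that almost surely $\xi'(B)<\infty$ for all bounded Borel $B$. Let $R'_i=\sup_{j\le L'_i}|T'_{ij}|\in[0,\infty)$, $i\ge0$, with $R'_i=0$ if $L'_i=0$. Stationary version $\xi$: let $\widetilde W_i$, $i\in\mathbb{Z}\setminus\{0\}$, be i.i.d. copies of $W'_1=(L'_1,(T'_{1j})_j,X'_1)$ with third coordinates $\widetilde X_i$. Let $W^*$ be independent of these, with $\mathbb{E}f(W^* )=\frac1\mu\mathbb{E}[X'_1f(W'_1)]$ for all bounded measurable $f$, and let $X^*$ be its third coordinate. Let $U$ be uniform on $[0,1]$ independent of everything else. Put $T_0=UX^*$, $T_{-1}=-(1-U)X^*$, and for $i\ge1$, $T_i=T_0+\sum_{j=1}^i\widetilde X_j$, $T_{-(i+1)}=T_{-1}-\sum_{j=-i}^{-1}\widetilde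 X_j$. Put $W_0=W^*$, $W_i=\widetilde W_i$ for $i\neq0$, and write $L_i$, $(T_{ij})_j$ for the first two coordinates of $W_i$. Then $\xi=\sum_{i\in\mathbb{Z}}\sum_{j=1}^{L_i}\delta_{T_i+T_{ij}}$, provided that it is almost surely finite on bounded sets; in this case it is called the stationary renewal cluster point process (stationary version of $\xi'$). *)

theory Defs
  imports "HOL-Probability.Probability"
begin

section \<open>Point measures on the real line and the vague topology\<close>

text \<open>
  The sum of the Dirac measures at the points \<open>x i\<close>, \<open>i \<in> I\<close>, is the image of the counting
  measure on \<open>I\<close> under \<open>x\<close>; see \<open>emeasure_dirac_sum\<close> below.
\<close>

definition dirac_sum :: "'i set \<Rightarrow> ('i \<Rightarrow> real) \<Rightarrow> real measure" where
  "dirac_sum I x = distr (count_space I) borel x"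

lemma emeasure_dirac_sum:
  assumes "B \<in> sets borel"
  shows "emeasure (dirac_sum I x) B = (\<integral>\<^sup>+ i. indicator B (x i) \<partial>count_space I)"
proof -
  have "emeasure (dirac_sum I x) B = (\<integral>\<^sup>+ y. indicator B y \<partial>dirac_sum I x)"
    using assms by (simp add: dirac_sum_def)
  also have "\<dots> = (\<integral>\<^sup>+ i. indicator B (x i) \<partial>count_space I)"
    unfolding dirac_sum_def using assms by (intro nn_integral_distr) auto
  finally show ?thesis .
qed

definition locally_finite :: "real measure \<Rightarrow> bool" where
  "locally_finite m \<longleftrightarrow> (\<forall>B \<in> sets borel. bounded B \<longrightarrow> emeasure m B < \<infinity>)"

definition Mp :: "real measure set" where
  "Mp = {m. (\<exists>(I :: nat set) x. m = dirac_sum I x) \<and> locally_finite m}"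

definition test_functions :: "(real \<Rightarrow> real) set" where
  "test_functions = {f. continuous_on UNIV f \<and> bounded (range f) \<and> bounded {x. f x \<noteq> 0}}"

text \<open>The coarsest topology on \<open>Mp\<close> making all maps \<open>m \<mapsto> \<integral> f dm\<close> continuous.\<close>

definition vague :: "real measure topology" where
  "vague = topology_generated_by
     {{m \<in> Mp. (\<integral>x. f x \<partial>m) \<in> V} | f V. f \<in> test_functions \<and> open V}"

lemma topspace_vague: "topspace vague = Mp"
proof -
  have "(\<lambda>x. 0) \<in> test_functions"
    by (auto simp: test_functions_def)
  then have "Mp \<in> {{m \<in> Mp. (\<integral>x. f x \<partial>m) \<in> V} | f V. f \<in> test_functions \<and> open V}"
    by (auto intro!: exI[of _ "\<lambda>x. 0"] exI[of _ UNIV])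
  then show ?thesis
    unfolding vague_def topology_generated_by_topspace by auto
qed

definition theta_shift :: "real \<Rightarrow> real measure \<Rightarrow> real measure" where
  "theta_shift t m = distr m borel (\<lambda>x. x - t)"

lemma emeasure_theta_shift:
  assumes "sets m = sets borel" "A \<in> sets borel"
  shows "emeasure (theta_shift t m) A = emeasure m ((\<lambda>x. x + t) ` A)"
proof -
  have "(\<lambda>x. x - t) \<in> m \<rightarrow>\<^sub>M borel"
    unfolding measurable_cong_sets[OF assms(1) refl] by simp
  moreover have "(\<lambda>x. x - t) -` A \<inter> space m = (\<lambda>x. x + t) ` A"
    using sets_eq_imp_space_eq[OF assms(1)] by (auto simp: image_iff intro!: bexI[of _ "_ - t"])
  ultimately show ?thesis
    using assms(2) by (simp add: theta_shift_def emeasure_distr)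
qed

text \<open>
  Random point measures are only almost surely in \<open>Mp\<close>; on the exceptional null set they are
  replaced by the zero measure, so that they become \<open>Mp\<close>-valued everywhere.
\<close>

definition Mp_version :: "real measure \<Rightarrow> real measure" where
  "Mp_version m = (if m \<in> Mp then m else null_measure borel)"

section \<open>Convergence in distribution in a topological space\<close>

definition borel_of_topology :: "'x topology \<Rightarrow> 'x measure" where
  "borel_of_topology T = sigma (topspace T) {V. openin T V}"

text \<open>
  The measurability requirements say that all \<open>X t\<close> and \<open>Y\<close> are random elements of \<open>T\<close>; without
  them the expectations of \<open>F (X t)\<close> and \<open>F Y\<close> could be meaningless. The limit \<open>Y\<close> may live on a
  different probability space.
\<close>

definition converges_in_distribution ::
  "'x topology \<Rightarrow> 'a measure \<Rightarrow> ('t \<Rightarrow> 'a \<Rightarrow> 'x) \<Rightarrow> 'b measure \<Rightarrow> ('b \<Rightarrow> 'x) \<Rightarrow> 't filter \<Rightarrow> bool"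
where
  "converges_in_distribution T M X N Y G \<longleftrightarrow>
     (\<forall>t. X t \<in> M \<rightarrow>\<^sub>M borel_of_topology T) \<and>
     Y \<in> N \<rightarrow>\<^sub>M borel_of_topology T \<and>
     (\<forall>F :: 'x \<Rightarrow> real. continuous_map T euclideanreal F \<and> bounded (F ` topspace T) \<longrightarrow>
        ((\<lambda>t. \<integral>\<omega>. F (X t \<omega>) \<partial>M) \<longlongrightarrow> (\<integral>\<omega>. F (Y \<omega>) \<partial>N)) G)"

section \<open>Marks\<close>

text \<open>
  A mark is a triple \<open>(L, T, X)\<close>. Sequences are indexed from 0, so the points of the cluster are
  \<open>T 0, \<dots>, T (L - 1)\<close>, that is, \<open>T j\<close> is the point with number \<open>j + 1\<close>.
\<close>

type_synonym mark = "nat \<times> (nat \<Rightarrow> real) \<times> real"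

definition mark_space :: "mark measure" where
  "mark_space = count_space UNIV \<Otimes>\<^sub>M (PiM UNIV (\<lambda>_. borel) \<Otimes>\<^sub>M restrict_space borel {0..})"

definition cluster_size :: "mark \<Rightarrow> nat" where
  "cluster_size w = fst w"

definition cluster_pt :: "mark \<Rightarrow> nat \<Rightarrow> real" where
  "cluster_pt w = fst (snd w)"

definition gap :: "mark \<Rightarrow> real" where
  "gap w = snd (snd w)"

definition radius :: "mark \<Rightarrow> real" where
  "radius w = (if cluster_size w = 0 then 0 else (SUP j \<in> {..<cluster_size w}. \<bar>cluster_pt w j\<bar>))"

definition cluster_process :: "('i \<Rightarrow> real) \<Rightarrow> ('i \<Rightarrow> mark) \<Rightarrow> real measure" where
  "cluster_process \<tau> w =
     dirac_sum {(i, j). j < cluster_size (w i)} (\<lambda>(i, j). \<tau> i + cluster_pt (w i) j)"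

section \<open>Renewal cluster point processes\<close>

definition nonarithmetic :: "'a measure \<Rightarrow> ('a \<Rightarrow> real) \<Rightarrow> bool" where
  "nonarithmetic M X \<longleftrightarrow> (\<forall>h>0. \<not> (AE \<omega> in M. \<exists>k::int. X \<omega> = h * of_int k))"

definition renewal_time :: "(nat \<Rightarrow> mark) \<Rightarrow> nat \<Rightarrow> real" where
  "renewal_time w i = (\<Sum>j=0..i. gap (w j))"

definition renewal_cluster :: "(nat \<Rightarrow> 'a \<Rightarrow> mark) \<Rightarrow> 'a \<Rightarrow> real measure" where
  "renewal_cluster W \<omega> = cluster_process (renewal_time (\<lambda>i. W i \<omega>)) (\<lambda>i. W i \<omega>)"

locale renewal_cluster_process = prob_space M for M :: "'a measure" +
  fixes W :: "nat \<Rightarrow> 'a \<Rightarrow> mark"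
  assumes indep_marks: "indep_vars (\<lambda>_. mark_space) W UNIV"
    and ident_marks: "\<And>i. i \<ge> 1 \<Longrightarrow> distr M mark_space (W i) = distr M mark_space (W 1)"
    and nonarithmetic_gap: "nonarithmetic M (\<lambda>\<omega>. gap (W 1 \<omega>))"
    and integrable_gap: "integrable M (\<lambda>\<omega>. gap (W 1 \<omega>))"
    and mean_gap_pos: "expectation (\<lambda>\<omega>. gap (W 1 \<omega>)) > 0"
    and AE_locally_finite: "AE \<omega> in M. locally_finite (renewal_cluster W \<omega>)"

section \<open>The stationary version\<close>

text \<open>
  The two-sided renewal times for marks \<open>w\<close> and \<open>u \<in> [0, 1]\<close>. With \<open>i = - (k + 1)\<close>, the sum for
  negative indices runs over \<open>j = - k, \<dots>, - 1\<close>.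
\<close>

definition stationary_time :: "(int \<Rightarrow> mark) \<Rightarrow> real \<Rightarrow> int \<Rightarrow> real" where
  "stationary_time w u i =
     (if i \<ge> 0 then u * gap (w 0) + (\<Sum>j=1..i. gap (w j))
      else - (1 - u) * gap (w 0) - (\<Sum>j=i+1..-1. gap (w j)))"

definition stationary_cluster :: "(int \<Rightarrow> 'b \<Rightarrow> mark) \<Rightarrow> ('b \<Rightarrow> real) \<Rightarrow> 'b \<Rightarrow> real measure" where
  "stationary_cluster W U \<omega> =
     cluster_process (stationary_time (\<lambda>i. W i \<omega>) (U \<omega>)) (\<lambda>i. W i \<omega>)"

text \<open>
  \<open>M\<close> and \<open>W'\<close> are the data of the renewal cluster point process; the stationary version, with
  marks \<open>W\<close>, where \<open>W 0\<close> is the length-biased mark, is defined on the probability space \<open>N\<close>.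
\<close>

locale stationary_version = prob_space N
  for M :: "'a measure" and W' :: "nat \<Rightarrow> 'a \<Rightarrow> mark" and N :: "'b measure" +
  fixes W :: "int \<Rightarrow> 'b \<Rightarrow> mark" and U :: "'b \<Rightarrow> real"
  assumes indep_marks: "indep_vars (\<lambda>_. mark_space) W UNIV"
    and ident_marks: "\<And>i. i \<noteq> 0 \<Longrightarrow> distr N mark_space (W i) = distr M mark_space (W' 1)"
    and length_biased: "\<And>f :: mark \<Rightarrow> real.
      f \<in> borel_measurable mark_space \<Longrightarrow> bounded (f ` space mark_space) \<Longrightarrow>
      expectation (\<lambda>\<omega>. f (W 0 \<omega>)) =
        1 / (\<integral>\<omega>. gap (W' 1 \<omega>) \<partial>M) * (\<integral>\<omega>. gap (W' 1 \<omega>) * f (W' 1 \<omega>) \<partial>M)"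
    and uniform: "distr N borel U = uniform_measure lborel {0..1}"
    and indep_uniform:
      "indep_set {U -` A \<inter> space N | A. A \<in> sets borel}
         {(\<lambda>\<omega> i. W i \<omega>) -` B \<inter> space N | B. B \<in> sets (PiM UNIV (\<lambda>_. mark_space))}"
    and AE_locally_finite: "AE \<omega> in N. locally_finite (stationary_cluster W U \<omega>)"

end

theory Submission
  imports Defs
begin

text \<open>
  Let \<open>H\<close> be a bounded measurable functional of a measure that only depends on the restriction of
  the measure to a bounded window \<open>[-r, r]\<close>, let \<open>\<zeta>\<close> be the cluster process of an i.i.d. sequence of
  marks distributed like \<open>W' 1\<close>, with renewal times started at 0, and let \<open>Z t\<close> be the mean of
  \<open>H (theta_shift t \<zeta>)\<close>. Removing the first mark, with gap \<open>X\<close> and radius \<open>R\<close>, from the sequence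
  shows that \<open>Z t - E Z (t - X)\<close> is the mean of an effect of the first cluster which is bounded and
  vanishes for \<open>t > X + r + R\<close>. As \<open>E X\<close> and \<open>E R\<close> are finite, this effect is integrable over
  \<open>t \<ge> 0\<close>, which is where the assumption on the radius is used. Hence the primitive \<open>I\<close> of \<open>Z\<close> is a
  Lipschitz function for which \<open>E (I t - I (t - X))\<close> has a limit \<open>c\<close> as \<open>t\<close> tends to infinity.

  The analytic core is \<open>renewal_theorem\<close>: under these conditions \<open>I (t + e) - I t\<close> tends to
  \<open>e * c / E X\<close>. An increment \<open>G t = I (t + e) - I t\<close> is bounded, Lipschitz and asymptotically
  harmonic, that is, \<open>G t - E G (t - X)\<close> tends to 0. The variance argument for the Choquet-Deny theorem, carried out up
  to errors that vanish at infinity, gives \<open>E (G (t - X) - G t)\<^sup>2 \<longlonglongrightarrow> 0\<close>. So the points of the support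
  of \<open>X\<close> are asymptotic periods of \<open>G\<close>. The asymptotic periods form a closed subgroup of the real
  line, which is everything because \<open>X\<close> is nonarithmetic. Thus \<open>G\<close> is asymptotically constant on
  bounded sets, \<open>I\<close> is asymptotically linear, and \<open>c\<close> determines the slope.

  The constant is identified by computing in two ways the mean of the integral of
  \<open>H (theta_shift t \<zeta>)\<close> over the cycle of \<open>\<zeta>\<close> with number \<open>n\<close>. Removing the first mark shows again
  that it tends to \<open>c\<close> (\<open>cycle_mean_tendsto\<close>). On the other hand, a point chosen uniformly in a
  length-biased cycle is the origin of the stationary version, so this mean is \<open>E X\<close> times the mean
  of \<open>H\<close> for the stationary process without the clusters of index below \<open>- n\<close>
  (\<open>truncated_stationary_mean\<close>). By local finiteness these clusters leave the window as \<open>n\<close> grows, so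
  \<open>c = E X * E H(\<xi>)\<close> for the stationary version \<open>\<xi>\<close>. The delay and the exceptional first mark of \<open>\<xi>'\<close>
  do not influence the limit. This gives \<open>averaged_convergence\<close>: the average of
  \<open>E H (theta_shift s \<xi>')\<close> over \<open>s \<in> [t, t + e]\<close> tends to \<open>E H(\<xi>)\<close>, even for discontinuous \<open>H\<close>.

  If \<open>H\<close> is a Lipschitz function of finitely many integrals of Lipschitz functions with compact
  support, the average can be removed, because shifting by \<open>s\<close> changes \<open>H\<close> by at most a constant
  times \<open>s\<close> times the number of points in a window, and these numbers are tight by
  \<open>averaged_convergence\<close> for the functional \<open>capped_count\<close>. Finally the vague topology is generated
  by countably many such integrals, by the Weierstrass approximation theorem. Therefore a vaguely
  continuous bounded functional \<open>F\<close> is the limit of an increasing sequence of Lipschitz functionals,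
  its lower envelopes, so that the lower limit of \<open>E F (theta_shift t \<xi>')\<close> is at least \<open>E F(\<xi>)\<close>. The
  same bound for \<open>- F\<close> finishes the proof.
\<close>

section \<open>A renewal theorem for Lipschitz functions\<close>

text \<open>
  A subgroup with arbitrarily small positive elements is dense; otherwise its smallest positive
  element generates it.
\<close>

lemma closed_subgroup_real:
  fixes P :: "real set"
  assumes "closed P" "0 \<in> P" and diff: "\<And>x y. x \<in> P \<Longrightarrow> y \<in> P \<Longrightarrow> x - y \<in> P"
  shows "P = UNIV \<or> (\<exists>h>0. \<forall>x\<in>P. \<exists>k::int. x = h * of_int k)"
proof -
  have uminus: "- x \<in> P" if "x \<in> P" for x
    using diff[OF assms(2) that] by simp
  have plus: "x + y \<in> P" if "x \<in> P" "y \<in> P" for x y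
    using diff[OF that(1) uminus[OF that(2)]] by simp
  have mult_nat: "of_nat n * x \<in> P" if "x \<in> P" for n :: nat and x
    by (induction n) (auto simp: assms(2) algebra_simps that intro!: plus)
  have mult: "of_int k * x \<in> P" if "x \<in> P" for k :: int and x
  proof (cases "k \<ge> 0")
    case True
    then show ?thesis using mult_nat[OF that, of "nat k"] by simp
  next
    case False
    then show ?thesis using uminus[OF mult_nat[OF that, of "nat (- k)"]] by simp
  qed
  show ?thesis
  proof (cases "\<exists>d>0. \<forall>x\<in>P. x > 0 \<longrightarrow> x \<ge> d")
    case False
    have "x \<in> closure P" for x :: real
    proof (rule closure_approachable[THEN iffD2], intro allI impI)
      fix e :: real assume "e > 0"
      with False obtain p where p: "p \<in> P" "p > 0" "p < e" by force
      define k where "k = \<lfloor>x / p\<rfloor>"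
      have "of_int k \<le> x / p" "x / p < of_int k + 1" unfolding k_def by linarith+
      then have "of_int k * p \<le> x" "x < of_int k * p + p"
        using p by (auto simp: field_simps)
      then have "dist (of_int k * p) x < e" using p by (auto simp: dist_real_def)
      then show "\<exists>y\<in>P. dist y x < e" using mult[OF p(1)] by blast
    qed
    then show ?thesis using assms(1) by auto
  next
    case True
    then obtain d where d: "d > 0" "\<And>x. x \<in> P \<Longrightarrow> x > 0 \<Longrightarrow> x \<ge> d" by auto
    show ?thesis
    proof (cases "\<exists>x\<in>P. x > 0")
      case False
      then have "x = 0" if "x \<in> P" for x
        using that uminus[OF that] by (metis linorder_neqE_linordered_idom neg_0_less_iff_less)
      then show ?thesis by (intro disjI2 exI[of _ 1]) (auto intro: exI[of _ 0])
    next
      case True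
      define S where "S = P \<inter> {d..}"
      have S: "closed S" "S \<noteq> {}" "bdd_below S"
        unfolding S_def using assms(1) True d(2) by (auto intro!: closed_Int)
      define h where "h = Inf S"
      have hS: "h \<in> S" unfolding h_def using S by (intro closed_contains_Inf) auto
      then have h: "h \<in> P" "h > 0" using d(1) by (auto simp: S_def)
      have "\<exists>k::int. x = h * of_int k" if x: "x \<in> P" for x
      proof -
        define k where "k = \<lfloor>x / h\<rfloor>"
        have "of_int k \<le> x / h" "x / h < of_int k + 1" unfolding k_def by linarith+
        then have "of_int k * h \<le> x" "x < of_int k * h + h"
          using h by (auto simp: field_simps)
        then have k: "0 \<le> x - of_int k * h" "x - of_int k * h < h" by auto
        have xk: "x - of_int k * h \<in> P" using diff[OF x mult[OF h(1)]] .
        have "x - of_int k * h = 0"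
        proof (rule ccontr)
          assume "x - of_int k * h \<noteq> 0"
          then have "x - of_int k * h \<in> S" using k xk d(2) unfolding S_def by auto
          then have "h \<le> x - of_int k * h" unfolding h_def by (rule cInf_lower[OF _ S(3)])
          with k show False by simp
        qed
        then show ?thesis by (auto simp: algebra_simps)
      qed
      then show ?thesis using h by blast
    qed
  qed
qed

lemma lipschitz_borel_measurable:
  fixes f :: "real \<Rightarrow> real"
  assumes lip: "\<And>x y. \<bar>f x - f y\<bar> \<le> L * \<bar>x - y\<bar>"
  shows "f \<in> borel_measurable borel"
proof (rule borel_measurable_continuous_onI)
  have "L \<ge> 0" using lip[of 1 0] by simp
  then have "L-lipschitz_on UNIV f" by (intro lipschitz_onI) (auto simp: dist_real_def lip)
  then show "continuous_on UNIV f" by (rule lipschitz_on_continuous_on)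
qed

lemma (in prob_space) abs_expectation_le:
  fixes f :: "'a \<Rightarrow> real"
  assumes [measurable]: "f \<in> borel_measurable M" and b: "\<And>x. \<bar>f x\<bar> \<le> C"
  shows "\<bar>expectation f\<bar> \<le> C"
proof -
  have "C \<ge> 0" using b[of undefined] by linarith
  have "\<bar>expectation f\<bar> \<le> expectation (\<lambda>y. \<bar>f y\<bar>)" by (rule integral_abs_bound)
  also have "\<dots> \<le> expectation (\<lambda>y. C)"
    by (intro integral_mono integrable_const_bound[of _ C]) (use b \<open>C \<ge> 0\<close> in auto)
  finally show ?thesis by (simp add: prob_space)
qed

locale renewal_law = prob_space F for F :: "real measure" +
  assumes sets_F [measurable_cong, simp]: "sets F = sets borel"
    and nonneg: "AE x in F. x \<ge> 0"
    and nonarith: "nonarithmetic F (\<lambda>x. x)"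
    and integrable_id: "integrable F (\<lambda>x. x)"
    and mean_pos: "expectation (\<lambda>x. x) > 0"
begin

abbreviation mean :: real where "mean \<equiv> expectation (\<lambda>x. x)"

lemma space_F [simp]: "space F = UNIV"
  using sets_eq_imp_space_eq[OF sets_F] by simp

lemma prob_UNIV [simp]: "prob UNIV = 1"
  using prob_space by simp

text \<open>
  \<open>avg f t\<close> is the convolution of \<open>f\<close> with the step law, that is, the mean of \<open>f\<close> after one backward
  step from \<open>t\<close>.
\<close>

definition avg :: "(real \<Rightarrow> real) \<Rightarrow> real \<Rightarrow> real" where
  "avg f t = expectation (\<lambda>y. f (t - y))"

lemma avg_measurable [measurable]:
  fixes f :: "real \<Rightarrow> real"
  assumes [measurable]: "f \<in> borel_measurable borel"
  shows "avg f \<in> borel_measurable borel"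
  unfolding avg_def by measurable

lemma integrable_bounded:
  fixes f :: "real \<Rightarrow> real"
  assumes [measurable]: "f \<in> borel_measurable borel" and "\<And>x. \<bar>f x\<bar> \<le> C"
  shows "integrable F f"
  using assms by (intro integrable_const_bound[of _ C]) auto

lemma integrable_translate:
  fixes f :: "real \<Rightarrow> real"
  assumes [measurable]: "f \<in> borel_measurable borel" and b: "\<And>x. \<bar>f x\<bar> \<le> C"
  shows "integrable F (\<lambda>y. f (t - y))"
  by (rule integrable_bounded[of _ C]) (use b in auto)

lemma avg_bound:
  fixes f :: "real \<Rightarrow> real"
  assumes [measurable]: "f \<in> borel_measurable borel" and b: "\<And>x. \<bar>f x\<bar> \<le> C"
  shows "\<bar>avg f t\<bar> \<le> C"
  unfolding avg_def by (rule abs_expectation_le) (auto simp: b)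

lemma expectation_tendsto_0:
  fixes f :: "real \<Rightarrow> real \<Rightarrow> real"
  assumes [measurable]: "\<And>t. f t \<in> borel_measurable borel" and b: "\<And>t x. \<bar>f t x\<bar> \<le> C"
    and lim: "\<And>y. ((\<lambda>t. f t y) \<longlongrightarrow> 0) at_top"
  shows "((\<lambda>t::real. expectation (f t)) \<longlongrightarrow> 0) at_top"
proof -
  have "((\<lambda>t. expectation (f t)) \<longlongrightarrow> expectation (\<lambda>y. 0)) at_top"
    by (rule integral_dominated_convergence_at_top[where w = "\<lambda>_. C"])
      (auto intro!: always_eventually lim b)
  then show ?thesis by simp
qed

lemma tendsto_translate:
  fixes f :: "real \<Rightarrow> real"
  assumes "(f \<longlongrightarrow> c) at_top"
  shows "((\<lambda>t. f (t - y)) \<longlongrightarrow> c) at_top"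
  by (rule filterlim_compose[OF assms])
    (simp add: filterlim_at_top_mono filterlim_tendsto_add_at_top[of "\<lambda>_. - y" "- y" _ "\<lambda>x. x", simplified]
      filterlim_ident)

lemma avg_tendsto_0:
  fixes f :: "real \<Rightarrow> real"
  assumes [measurable]: "f \<in> borel_measurable borel" and b: "\<And>x. \<bar>f x\<bar> \<le> C"
    and lim: "(f \<longlongrightarrow> 0) at_top"
  shows "(avg f \<longlongrightarrow> 0) at_top"
  unfolding avg_def
  by (rule expectation_tendsto_0[of _ C]) (auto simp: b intro!: tendsto_translate lim)

lemma avg_mono:
  fixes f g :: "real \<Rightarrow> real"
  assumes [measurable]: "f \<in> borel_measurable borel" "g \<in> borel_measurable borel"
    and b: "\<And>x. \<bar>f x\<bar> \<le> C" "\<And>x. \<bar>g x\<bar> \<le> D" and le: "\<And>x. f x \<le> g x"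
  shows "avg f t \<le> avg g t"
  unfolding avg_def
  by (rule integral_mono) (auto intro: integrable_translate[of _ C] integrable_translate[of _ D] b le)

lemma avg_add:
  fixes f g :: "real \<Rightarrow> real"
  assumes [measurable]: "f \<in> borel_measurable borel" "g \<in> borel_measurable borel"
    and b: "\<And>x. \<bar>f x\<bar> \<le> C" "\<And>x. \<bar>g x\<bar> \<le> D"
  shows "avg (\<lambda>x. f x + g x) t = avg f t + avg g t"
    and "avg (\<lambda>x. f x - g x) t = avg f t - avg g t"
  unfolding avg_def
  using integrable_translate[OF assms(1) b(1)] integrable_translate[OF assms(2) b(2)]
  by (rule Bochner_Integration.integral_add Bochner_Integration.integral_diff)+

lemma square_avg_le:
  fixes f :: "real \<Rightarrow> real"
  assumes [measurable]: "f \<in> borel_measurable borel" and b: "\<And>x. \<bar>f x\<bar> \<le> C"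
  shows "(avg f t)\<^sup>2 \<le> avg (\<lambda>x. (f x)\<^sup>2) t"
proof -
  have sq: "\<bar>(f x)\<^sup>2\<bar> \<le> C\<^sup>2" for x using power_mono[OF b[of x] abs_ge_zero, of 2] by simp
  note i = integrable_translate[OF assms(1) b, of t]
    integrable_translate[of "\<lambda>x. (f x)\<^sup>2" "C\<^sup>2" t, OF _ sq, simplified]
  have "0 \<le> expectation (\<lambda>y. (f (t - y) - avg f t)\<^sup>2)" by simp
  also have "\<dots> = expectation (\<lambda>y. (f (t - y))\<^sup>2 - 2 * avg f t * f (t - y) + (avg f t)\<^sup>2)"
    by (intro Bochner_Integration.integral_cong) (auto simp: power2_eq_square algebra_simps)
  also have "\<dots> = expectation (\<lambda>y. (f (t - y))\<^sup>2) - 2 * avg f t * expectation (\<lambda>y. f (t - y)) + (avg f t)\<^sup>2"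
    using i by simp
  finally show ?thesis by (simp add: avg_def power2_eq_square)
qed

text \<open>
  Write \<open>Q t\<close> for the expectation in the conclusion. For an exactly harmonic \<open>G\<close> it is a variance,
  \<open>Q = avg G\<^sup>2 - G\<^sup>2\<close>. Moreover, each difference \<open>q = G (\<cdot> - y) - G\<close> is harmonic, so \<open>q\<^sup>2 \<le> avg q\<^sup>2\<close>,
  and integrating over \<open>y\<close> yields \<open>Q \<le> avg Q\<close>. Adding the iterates of the first identity, one finds
  \<open>m * Q \<le> avg (\<dots> avg G\<^sup>2) - G\<^sup>2 \<le> B\<^sup>2\<close> for every \<open>m\<close>, hence \<open>Q = 0\<close>. Here all relations hold up to
  bounded errors tending to 0, and averaging preserves such errors.
\<close>

lemma translation_variance_tendsto_0:
  fixes G :: "real \<Rightarrow> real"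
  assumes [measurable]: "G \<in> borel_measurable borel"
    and bound: "\<And>x. \<bar>G x\<bar> \<le> B"
    and harmonic: "((\<lambda>t. G t - avg G t) \<longlongrightarrow> 0) at_top"
  shows "((\<lambda>t. expectation (\<lambda>y. (G (t - y) - G t)\<^sup>2)) \<longlongrightarrow> 0) at_top"
proof -
  define Q where "Q = (\<lambda>t. expectation (\<lambda>y. (G (t - y) - G t)\<^sup>2))"
  define r where "r = (\<lambda>t. G t - avg G t)"
  have B0: "B \<ge> 0" using bound[of 0] by linarith
  have sqle: "\<bar>(x::real)\<^sup>2\<bar> \<le> C\<^sup>2" if "\<bar>x\<bar> \<le> C" for x C
    using power_mono[OF that abs_ge_zero, of 2] by simp
  have bsq: "\<bar>(G x)\<^sup>2\<bar> \<le> B\<^sup>2" for x by (rule sqle[OF bound])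
  have bdiff: "\<bar>G x - G y\<bar> \<le> 2 * B" for x y using bound[of x] bound[of y] by linarith
  have bdiffsq: "\<bar>(G x - G y)\<^sup>2\<bar> \<le> (2 * B)\<^sup>2" for x y by (rule sqle[OF bdiff])
  have [measurable]: "r \<in> borel_measurable borel" unfolding r_def by measurable
  have rlim: "(r \<longlongrightarrow> 0) at_top" using harmonic by (simp add: r_def)
  have br: "\<bar>r x\<bar> \<le> 2 * B" for x
    using bound[of x] avg_bound[of G B x] bound unfolding r_def by fastforce
  have Qm [measurable]: "Q \<in> borel_measurable borel" unfolding Q_def by measurable
  have bQ: "\<bar>Q t\<bar> \<le> (2 * B)\<^sup>2" for t
    unfolding Q_def by (rule abs_expectation_le) (auto simp only: bdiffsq, measurable)

  define e1 where "e1 = (\<lambda>t. 2 * G t * r t)"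
  have Q1: "Q t = avg (\<lambda>x. (G x)\<^sup>2) t - (G t)\<^sup>2 + e1 t" for t
  proof -
    note i = integrable_translate[of G B t, OF _ bound]
      integrable_translate[of "\<lambda>x. (G x)\<^sup>2" "B\<^sup>2" t, OF _ bsq, simplified]
    have "Q t = expectation (\<lambda>y. (G (t - y))\<^sup>2 - 2 * G t * G (t - y) + (G t)\<^sup>2)"
      unfolding Q_def by (intro Bochner_Integration.integral_cong) (auto simp: power2_eq_square algebra_simps)
    also have "\<dots> = avg (\<lambda>x. (G x)\<^sup>2) t - 2 * G t * avg G t + (G t)\<^sup>2"
      using i by (simp add: avg_def)
    finally show ?thesis by (simp add: e1_def r_def power2_eq_square algebra_simps)
  qed
  have e1m [measurable]: "e1 \<in> borel_measurable borel" unfolding e1_def by measurable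
  have e1b: "\<bar>e1 t\<bar> \<le> 4 * B * B" for t
  proof -
    have "\<bar>G t\<bar> * \<bar>r t\<bar> \<le> B * (2 * B)"
      by (intro mult_mono bound br) (auto simp: B0)
    then show ?thesis by (simp add: e1_def abs_mult)
  qed
  have e1lim: "(e1 \<longlongrightarrow> 0) at_top"
  proof (rule Lim_null_comparison)
    show "\<forall>\<^sub>F t in at_top. norm (e1 t) \<le> 2 * B * \<bar>r t\<bar>"
      using bound by (intro always_eventually) (auto simp: e1_def abs_mult intro!: mult_right_mono)
    show "((\<lambda>t. 2 * B * \<bar>r t\<bar>) \<longlongrightarrow> 0) at_top"
      using tendsto_mult_left[OF tendsto_rabs_zero[OF rlim], of "2 * B"] by simp
  qed

  define e2 where "e2 = (\<lambda>t. 8 * B * expectation (\<lambda>y. \<bar>r (t - y) - r t\<bar>))"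
  have b4: "\<bar>\<bar>r x - r y\<bar>\<bar> \<le> 4 * B" for x y
    using br[of x] br[of y] by linarith
  have e2m [measurable]: "e2 \<in> borel_measurable borel" unfolding e2_def by measurable
  have e2b: "\<bar>e2 t\<bar> \<le> 8 * B * (4 * B)" for t
    unfolding e2_def abs_mult using B0
    by (intro mult_mono abs_expectation_le) (auto simp only: b4, auto)
  have e2lim: "(e2 \<longlongrightarrow> 0) at_top"
  proof -
    have "((\<lambda>t. expectation (\<lambda>y. \<bar>r (t - y) - r t\<bar>)) \<longlongrightarrow> 0) at_top"
    proof (rule expectation_tendsto_0[of _ "4 * B"])
      show "((\<lambda>t. \<bar>r (t - y) - r t\<bar>) \<longlongrightarrow> 0) at_top" for y
        using tendsto_diff[OF tendsto_translate[OF rlim, of y] rlim]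
        by (intro tendsto_rabs_zero) simp
    qed (use b4 in auto)
    from tendsto_mult_left[OF this, of "8 * B"] show ?thesis by (simp add: e2_def)
  qed
  have Q2: "Q t \<le> avg Q t + e2 t" for t
  proof -
    define q where "q = (\<lambda>y t. G (t - y) - G t)"
    have [measurable]: "q y \<in> borel_measurable borel" for y unfolding q_def by measurable
    have bq: "\<bar>q y x\<bar> \<le> 2 * B" for x y unfolding q_def by (rule bdiff)
    have bqs: "\<bar>(q y x)\<^sup>2\<bar> \<le> (2 * B)\<^sup>2" for x y by (rule sqle[OF bq])
    have avgq: "q y t = avg (q y) t + (r (t - y) - r t)" for y
    proof -
      have "avg (q y) t = avg (\<lambda>x. G (x - y)) t - avg G t"
        unfolding q_def by (rule avg_add(2)[of _ _ B B]) (auto simp: bound)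
      moreover have "avg (\<lambda>x. G (x - y)) t = avg G (t - y)"
        by (simp add: avg_def algebra_simps)
      ultimately show ?thesis by (simp add: q_def r_def)
    qed
    have pt: "(q y t)\<^sup>2 \<le> avg (\<lambda>x. (q y x)\<^sup>2) t + 8 * B * \<bar>r (t - y) - r t\<bar>" for y
    proof -
      define a d where "a = avg (q y) t" and "d = r (t - y) - r t"
      have "(q y t)\<^sup>2 = a\<^sup>2 + d * (q y t + a)"
        using avgq[of y] by (simp add: a_def[symmetric] d_def[symmetric] power2_eq_square algebra_simps)
      moreover have "a\<^sup>2 \<le> avg (\<lambda>x. (q y x)\<^sup>2) t"
        unfolding a_def by (rule square_avg_le[OF _ bq]) measurable
      moreover have "d * (q y t + a) \<le> \<bar>d\<bar> * (8 * B)"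
      proof -
        have "\<bar>a\<bar> \<le> 2 * B" unfolding a_def by (rule avg_bound[OF _ bq]) measurable
        then have "\<bar>q y t + a\<bar> \<le> 8 * B" using bq[of y t] B0 by linarith
        then have "\<bar>d\<bar> * \<bar>q y t + a\<bar> \<le> \<bar>d\<bar> * (8 * B)" by (intro mult_left_mono) auto
        then show ?thesis by (simp add: abs_mult[symmetric])
      qed
      ultimately show ?thesis by (simp add: d_def mult.commute)
    qed
    have qm: "(\<lambda>(y, x). (q y (t - x))\<^sup>2) \<in> borel_measurable (F \<Otimes>\<^sub>M F)"
      unfolding q_def by measurable
    interpret FF: pair_prob_space F F ..
    have iFF: "integrable (F \<Otimes>\<^sub>M F) (\<lambda>(y, x). (q y (t - x))\<^sup>2)"
      by (rule FF.P.integrable_const_bound[of _ "(2 * B)\<^sup>2"]) (use qm bqs in auto)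
    have fub: "expectation (\<lambda>y. avg (\<lambda>x. (q y x)\<^sup>2) t) = avg Q t"
    proof -
      have "expectation (\<lambda>y. avg (\<lambda>x. (q y x)\<^sup>2) t) = expectation (\<lambda>x. expectation (\<lambda>y. (q y (t - x))\<^sup>2))"
        unfolding avg_def using FF.Fubini_integral[OF iFF] by simp
      also have "\<dots> = avg Q t" by (simp add: avg_def Q_def q_def algebra_simps)
      finally show ?thesis .
    qed
    have mm: "(\<lambda>y. avg (\<lambda>x. (q y x)\<^sup>2) t) \<in> borel_measurable borel"
      unfolding avg_def q_def by measurable
    have bavg: "\<bar>avg (\<lambda>x. (q y x)\<^sup>2) t\<bar> \<le> (2 * B)\<^sup>2" for y
      by (rule avg_bound[OF _ bqs]) measurable
    have i1: "integrable F (\<lambda>y. avg (\<lambda>x. (q y x)\<^sup>2) t)"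
      by (rule integrable_bounded[OF mm bavg])
    have i2: "integrable F (\<lambda>y. \<bar>r (t - y) - r t\<bar>)"
      by (rule integrable_bounded[OF _ b4]) measurable
    have i3: "integrable F (\<lambda>y. (q y t)\<^sup>2)"
      by (rule integrable_bounded[OF _ bqs]) (unfold q_def, measurable)
    have "Q t = expectation (\<lambda>y. (q y t)\<^sup>2)" by (simp add: Q_def q_def)
    also have "\<dots> \<le> expectation (\<lambda>y. avg (\<lambda>x. (q y x)\<^sup>2) t + 8 * B * \<bar>r (t - y) - r t\<bar>)"
      using i1 i2 i3 pt by (intro integral_mono) auto
    also have "\<dots> = avg Q t + e2 t" using i1 i2 fub by (simp add: e2_def)
    finally show ?thesis .
  qed

  \<comment> \<open>In the induction step the inequality for \<open>m\<close> is averaged, and \<open>Q \<le> avg Q\<close> and the variance identity are used once more.\<close>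
  have iterate: "\<exists>f e C. f \<in> borel_measurable borel \<and> (\<forall>t. \<bar>f t\<bar> \<le> B\<^sup>2) \<and>
      e \<in> borel_measurable borel \<and> (\<forall>t. \<bar>e t\<bar> \<le> C) \<and> (e \<longlongrightarrow> 0) at_top \<and>
      (\<forall>t. real m * Q t \<le> f t - (G t)\<^sup>2 + e t)" for m :: nat
  proof (induction m)
    case 0
    show ?case
      by (rule exI[of _ "\<lambda>t. (G t)\<^sup>2"], rule exI[of _ "\<lambda>t. 0"], rule exI[of _ 0]) (use bsq in auto)
  next
    case (Suc m)
    then obtain f e C where [measurable]: "f \<in> borel_measurable borel" "e \<in> borel_measurable borel"
      and f: "\<And>t. \<bar>f t\<bar> \<le> B\<^sup>2" and e: "\<And>t. \<bar>e t\<bar> \<le> C" "(e \<longlongrightarrow> 0) at_top"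
      and le: "\<And>t. real m * Q t \<le> f t - (G t)\<^sup>2 + e t" by blast
    define e' where "e' = (\<lambda>t. avg e t + m * e2 t + e1 t)"
    have "real (Suc m) * Q t \<le> avg f t - (G t)\<^sup>2 + e' t" for t
    proof -
      have "real m * avg Q t = avg (\<lambda>x. real m * Q x) t" by (simp add: avg_def)
      also have "\<dots> \<le> avg (\<lambda>x. (f x - (G x)\<^sup>2) + e x) t"
      proof (rule avg_mono)
        show "\<bar>real m * Q x\<bar> \<le> m * (2 * B)\<^sup>2" for x
          using bQ[of x] by (simp add: abs_mult mult_left_mono)
        show "\<bar>f x - (G x)\<^sup>2 + e x\<bar> \<le> B\<^sup>2 + B\<^sup>2 + C" for x
          using f[of x] e(1)[of x] bsq[of x] by linarith
      qed (use le in auto)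
      also have "\<dots> = avg (\<lambda>x. f x - (G x)\<^sup>2) t + avg e t"
      proof (rule avg_add(1))
        show "\<bar>f x - (G x)\<^sup>2\<bar> \<le> B\<^sup>2 + B\<^sup>2" for x using f[of x] bsq[of x] by linarith
      qed (use e in auto)
      also have "avg (\<lambda>x. f x - (G x)\<^sup>2) t = avg f t - avg (\<lambda>x. (G x)\<^sup>2) t"
        by (rule avg_add(2)[OF _ _ f bsq]) auto
      finally have 1: "real m * avg Q t \<le> avg f t - avg (\<lambda>x. (G x)\<^sup>2) t + avg e t" by simp
      have "real m * Q t \<le> real m * (avg Q t + e2 t)"
        by (intro mult_left_mono Q2) auto
      with 1 Q1[of t] show ?thesis by (simp add: e'_def algebra_simps)
    qed
    moreover have "\<bar>avg f t\<bar> \<le> B\<^sup>2" for t by (rule avg_bound[OF _ f]) measurable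
    moreover have "\<bar>e' t\<bar> \<le> C + m * (8 * B * (4 * B)) + 4 * B * B" for t
    proof -
      have "\<bar>avg e t\<bar> \<le> C" by (rule avg_bound[OF _ e(1)]) measurable
      moreover have "\<bar>m * e2 t\<bar> \<le> m * (8 * B * (4 * B))"
        using e2b[of t] by (simp add: abs_mult mult_left_mono)
      ultimately show ?thesis using e1b[of t] unfolding e'_def by linarith
    qed
    moreover have "(e' \<longlongrightarrow> 0) at_top"
    proof -
      have "((\<lambda>t. avg e t + m * e2 t + e1 t) \<longlongrightarrow> 0 + real m * 0 + 0) at_top"
        by (intro tendsto_intros avg_tendsto_0[OF _ e] e2lim e1lim) measurable
      then show ?thesis by (simp add: e'_def)
    qed
    moreover have "e' \<in> borel_measurable borel" "avg f \<in> borel_measurable borel"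
      unfolding e'_def by measurable
    ultimately show ?case by blast
  qed

  have "(Q \<longlongrightarrow> 0) at_top"
  proof (rule tendstoI)
    fix \<epsilon> :: real assume "\<epsilon> > 0"
    obtain m :: nat where m: "(B\<^sup>2 + 1) / \<epsilon> < real m" using reals_Archimedean2 by blast
    have "0 < (B\<^sup>2 + 1) / \<epsilon>" using \<open>\<epsilon> > 0\<close> by (simp add: add_nonneg_pos)
    then have m0: "real m > 0" using m by linarith
    obtain f e C where f: "\<And>t. \<bar>f t\<bar> \<le> B\<^sup>2" and e: "(e \<longlongrightarrow> 0) at_top"
      and le: "\<And>t. real m * Q t \<le> f t - (G t)\<^sup>2 + e t" using iterate[of m] by blast
    have "\<forall>\<^sub>F t in at_top. e t < 1" using order_tendstoD(2)[OF e, of 1] by simp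
    then show "\<forall>\<^sub>F t in at_top. dist (Q t) 0 < \<epsilon>"
    proof eventually_elim
      case (elim t)
      have "0 \<le> Q t" unfolding Q_def by simp
      have "real m * Q t \<le> B\<^sup>2 + 1"
        using le[of t] f[of t] elim zero_le_power2[of "G t"] by linarith
      also have "\<dots> < real m * \<epsilon>" using m \<open>\<epsilon> > 0\<close> by (simp add: field_simps)
      finally show ?case using m0 \<open>0 \<le> Q t\<close> by simp
    qed
  qed
  then show ?thesis by (simp add: Q_def)
qed

text \<open>
  The set \<open>P\<close> of asymptotic periods of \<open>G\<close> is a closed subgroup, and the step law is concentrated on
  it: if all balls around \<open>y\<close> have positive measure, convergence of \<open>G (t - \<cdot>) - G t\<close> to 0 in quadratic
  mean forces \<open>G (t - y) - G t\<close> to be small, by the Lipschitz property. A nonarithmetic law is not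
  concentrated on a proper closed subgroup.
\<close>

lemma translation_difference_tendsto_0:
  fixes G :: "real \<Rightarrow> real"
  assumes lip: "\<And>x y. \<bar>G x - G y\<bar> \<le> L * \<bar>x - y\<bar>"
    and bound: "\<And>x. \<bar>G x\<bar> \<le> B"
    and harmonic: "((\<lambda>t. G t - avg G t) \<longlongrightarrow> 0) at_top"
  shows "((\<lambda>t. G (t - x) - G t) \<longlongrightarrow> 0) at_top"
proof -
  have L0: "L \<ge> 0" using lip[of 1 0] by simp
  note [measurable] = lipschitz_borel_measurable[OF lip]
  define Q where "Q = (\<lambda>t. expectation (\<lambda>y. (G (t - y) - G t)\<^sup>2))"
  have Q: "(Q \<longlongrightarrow> 0) at_top"
    unfolding Q_def by (rule translation_variance_tendsto_0[OF _ bound harmonic]) measurable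
  define P where "P = {x. ((\<lambda>t. G (t - x) - G t) \<longlongrightarrow> 0) at_top}"
  have diff: "x - y \<in> P" if "x \<in> P" "y \<in> P" for x y
  proof -
    have "((\<lambda>t. (G (t + y - x) - G (t + y)) - (G (t + y - y) - G (t + y))) \<longlongrightarrow> 0 - 0) at_top"
      using that tendsto_translate[of "\<lambda>t. G (t - x) - G t" 0 "- y"]
        tendsto_translate[of "\<lambda>t. G (t - y) - G t" 0 "- y"]
      by (intro tendsto_diff) (auto simp: P_def)
    then show ?thesis by (simp add: P_def algebra_simps)
  qed
  \<comment> \<open>It suffices to be an asymptotic period up to errors of the order of \<open>d\<close>, for each \<open>d\<close>.\<close>
  have P_I: "x \<in> P" if "\<And>d. d > 0 \<Longrightarrow> \<forall>\<^sub>F t in at_top. \<bar>G (t - x) - G t\<bar> \<le> (L + 1) * d" for x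
  proof -
    have "((\<lambda>t. G (t - x) - G t) \<longlongrightarrow> 0) at_top"
    proof (rule tendstoI)
      fix e :: real assume "e > 0"
      then have "e / (2 * (L + 1)) > 0" using L0 by simp
      from that[OF this] show "\<forall>\<^sub>F t in at_top. dist (G (t - x) - G t) 0 < e"
      proof eventually_elim
        case (elim t)
        moreover have "(L + 1) * (e / (2 * (L + 1))) = e / 2" using L0 by (simp add: field_simps)
        ultimately show ?case using \<open>e > 0\<close> by simp
      qed
    qed
    then show ?thesis by (simp add: P_def)
  qed
  have "closed P"
  proof (rule closed_sequential_limits[THEN iffD2], intro allI impI)
    fix X l assume X: "(\<forall>n. X n \<in> P) \<and> X \<longlonglongrightarrow> l"
    show "l \<in> P"
    proof (rule P_I)
      fix d :: real assume "d > 0"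
      then obtain n where n: "\<bar>X n - l\<bar> < d"
        using X LIMSEQ_D[of X l d] by (auto simp: real_norm_def)
      have "((\<lambda>t. G (t - X n) - G t) \<longlongrightarrow> 0) at_top" using X by (auto simp: P_def)
      then have "\<forall>\<^sub>F t in at_top. \<bar>G (t - X n) - G t\<bar> < d"
        using \<open>d > 0\<close> by (auto simp: tendsto_iff)
      then show "\<forall>\<^sub>F t in at_top. \<bar>G (t - l) - G t\<bar> \<le> (L + 1) * d"
      proof eventually_elim
        case (elim t)
        have "L * \<bar>X n - l\<bar> \<le> L * d" using n L0 by (intro mult_left_mono) auto
        moreover have "\<bar>G (t - l) - G (t - X n)\<bar> \<le> L * \<bar>X n - l\<bar>"
          using lip[of "t - l" "t - X n"] by simp
        ultimately show ?case using elim by (simp add: algebra_simps)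
      qed
    qed
  qed
  have null: "\<exists>d>0. ball y d \<in> null_sets F" if "y \<notin> P" for y
  proof (rule ccontr)
    assume *: "\<not> ?thesis"
    have "y \<in> P"
    proof (rule P_I)
      fix d :: real assume d: "d > 0"
      with * have "ball y d \<notin> null_sets F" by blast
      then have "emeasure F (ball y d) \<noteq> 0" by (auto simp: null_sets_def)
      then have pos: "prob (ball y d) > 0"
        by (simp add: emeasure_eq_measure zero_less_measure_iff)
      have "\<forall>\<^sub>F t in at_top. Q t < d\<^sup>2 * prob (ball y d)"
        using pos d by (intro order_tendstoD(2)[OF Q]) auto
      then show "\<forall>\<^sub>F t in at_top. \<bar>G (t - y) - G t\<bar> \<le> (L + 1) * d"
      proof eventually_elim
        case (elim t)
        show ?case
        proof (rule ccontr)
          assume big: "\<not> \<bar>G (t - y) - G t\<bar> \<le> (L + 1) * d"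
          have "d\<^sup>2 * indicator (ball y d) x \<le> (G (t - x) - G t)\<^sup>2" for x
          proof (cases "x \<in> ball y d")
            case True
            then have "L * \<bar>y - x\<bar> \<le> L * d" using L0 by (intro mult_left_mono) (auto simp: dist_real_def)
            moreover have "\<bar>G (t - y) - G (t - x)\<bar> \<le> L * \<bar>y - x\<bar>"
              using lip[of "t - y" "t - x"] by (simp add: abs_minus_commute)
            ultimately have "d \<le> \<bar>G (t - x) - G t\<bar>"
              using big by (simp add: algebra_simps)
            then show ?thesis using d power_mono[of d "\<bar>G (t - x) - G t\<bar>" 2] True by simp
          qed simp
          moreover have "integrable F (\<lambda>x. (G (t - x) - G t)\<^sup>2)"
          proof (rule integrable_bounded)
            have "\<bar>G (t - x) - G t\<bar> \<le> 2 * B" for x using bound[of "t - x"] bound[of t] by linarith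
            then show "\<bar>(G (t - x) - G t)\<^sup>2\<bar> \<le> (2 * B)\<^sup>2" for x
              using power_mono[of "\<bar>G (t - x) - G t\<bar>" "2 * B" 2] by simp
          qed measurable
          ultimately have "expectation (\<lambda>x. d\<^sup>2 * indicator (ball y d) x) \<le> Q t"
            unfolding Q_def by (intro integral_mono) (auto intro!: integrable_mult_right simp: less_top[symmetric])
          then show False using elim by simp
        qed
      qed
    qed
    with that show False by simp
  qed
  have "AE y in F. y \<in> P"
  proof -
    obtain d where d: "\<And>y. y \<notin> P \<Longrightarrow> d y > 0 \<and> ball y (d y) \<in> null_sets F"
      using null by metis
    obtain D where D: "D \<subseteq> (\<lambda>y. ball y (d y)) ` (- P)" "countable D"
      "\<Union>D = \<Union>((\<lambda>y. ball y (d y)) ` (- P))"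
      using Lindelof[of "(\<lambda>y. ball y (d y)) ` (- P)"] by blast
    have "\<Union>D \<in> null_sets F"
      using D d by (intro null_sets_UN'[of D "\<lambda>x. x", simplified]) auto
    moreover have "{y \<in> space F. \<not> y \<in> P} \<subseteq> \<Union>D"
      unfolding D(3) using d by force
    ultimately show ?thesis by (rule AE_I')
  qed
  moreover have "0 \<in> P" by (simp add: P_def)
  moreover have "\<not> (\<forall>x\<in>P. \<exists>k::int. x = h * of_int k)" if "h > 0" for h
  proof
    assume "\<forall>x\<in>P. \<exists>k::int. x = h * of_int k"
    with \<open>AE y in F. y \<in> P\<close> have "AE y in F. \<exists>k::int. y = h * of_int k" by auto
    with nonarith \<open>h > 0\<close> show False by (simp add: nonarithmetic_def)
  qed
  ultimately have "P = UNIV"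
    using closed_subgroup_real[OF \<open>closed P\<close> _ diff] by blast
  then show ?thesis by (auto simp: P_def)
qed

text \<open>
  If \<open>I\<close> is the integral of a bounded \<open>Z\<close>, the limit \<open>c\<close> exists as soon as \<open>Z t - avg Z t\<close> is
  integrable at infinity, because \<open>E (I t - I (t - X))\<close> is a primitive of this function. Once the
  increments of \<open>I\<close> are known to be asymptotically translation invariant, \<open>I t - I (t - y)\<close> is close to
  \<open>(I (t + e) - I t) * y / e\<close>, and integrating over \<open>y\<close> gives the slope.
\<close>

theorem renewal_theorem:
  fixes I :: "real \<Rightarrow> real"
  assumes lip: "\<And>x y. \<bar>I x - I y\<bar> \<le> B * \<bar>x - y\<bar>"
    and lim: "((\<lambda>t. expectation (\<lambda>y. I t - I (t - y))) \<longlongrightarrow> c) at_top"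
    and "e > 0"
  shows "((\<lambda>t. I (t + e) - I t) \<longlongrightarrow> e * c / mean) at_top"
proof -
  have B0: "B \<ge> 0" using lip[of 1 0] by simp
  note [measurable] = lipschitz_borel_measurable[OF lip]
  have int_back: "integrable F (\<lambda>y. I t - I (t - y))" for t
  proof (rule Bochner_Integration.integrable_bound)
    show "integrable F (\<lambda>y. B * y)" using integrable_id by simp
    show "AE y in F. norm (I t - I (t - y)) \<le> norm (B * y)"
      using lip[of t "t - _"] B0 by (intro AE_I2) (auto simp: abs_mult)
  qed measurable
  define inc where "inc = (\<lambda>y t. I (t + y) - I t)"
  have inc_bound: "\<bar>inc y t\<bar> \<le> B * \<bar>y\<bar>" for y t
    using lip[of "t + y" t] by (simp add: inc_def)

  have inv: "((\<lambda>t. inc a (t - x) - inc a t) \<longlongrightarrow> 0) at_top" for a x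
  proof (rule translation_difference_tendsto_0)
    show "\<bar>inc a x - inc a y\<bar> \<le> (2 * B) * \<bar>x - y\<bar>" for x y
      using lip[of "x + a" "y + a"] lip[of x y] by (simp add: inc_def)
    show "\<bar>inc a x\<bar> \<le> B * \<bar>a\<bar>" for x by (rule inc_bound)
    \<comment> \<open>The increment is asymptotically harmonic, since its deviation from its average is an increment of a function that converges.\<close>
    have "inc a t - avg (inc a) t = expectation (\<lambda>y. I (t + a) - I (t + a - y)) - expectation (\<lambda>y. I t - I (t - y))" for t
    proof -
      have "integrable F (\<lambda>y. inc a (t - y))"
        by (rule integrable_bounded[of _ "B * \<bar>a\<bar>"]) (simp add: inc_def, rule inc_bound)
      then have "inc a t - avg (inc a) t = expectation (\<lambda>y. inc a t - inc a (t - y))"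
        by (simp add: avg_def)
      also have "\<dots> = expectation (\<lambda>y. (I (t + a) - I (t + a - y)) - (I t - I (t - y)))"
        by (intro Bochner_Integration.integral_cong) (auto simp: inc_def algebra_simps)
      finally show ?thesis using int_back by simp
    qed
    moreover have "((\<lambda>t. expectation (\<lambda>y. I (t + a) - I (t + a - y)) - expectation (\<lambda>y. I t - I (t - y))) \<longlongrightarrow> c - c) at_top"
      using tendsto_translate[OF lim, of "- a"] lim by (intro tendsto_diff) simp_all
    ultimately show "((\<lambda>t. inc a t - avg (inc a) t) \<longlongrightarrow> 0) at_top" by simp
  qed

  \<comment> \<open>Translation invariance makes \<open>inc y t\<close> asymptotically additive in \<open>y\<close>; rational multiples of \<open>e\<close> and the Lipschitz bound then make it linear.\<close>
  have additive: "((\<lambda>t. inc (real n * a) t - real n * inc a t) \<longlongrightarrow> 0) at_top" for n :: nat and a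
  proof (induction n)
    case (Suc n)
    have "((\<lambda>t. (inc (real n * a) t - real n * inc a t) + (inc a (t - (- (real n * a))) - inc a t)) \<longlongrightarrow> 0 + 0) at_top"
      by (intro tendsto_add Suc inv)
    then show ?case by (simp add: inc_def algebra_simps)
  qed (simp add: inc_def)
  have linear: "((\<lambda>t. inc y t - y / e * inc e t) \<longlongrightarrow> 0) at_top" if "y \<ge> 0" for y
  proof (rule tendstoI)
    fix \<eta> :: real assume "\<eta> > 0"
    obtain n :: nat where n: "2 * B * e / (\<eta> / 2) < real n" using reals_Archimedean2 by blast
    moreover have "0 \<le> 2 * B * e / (\<eta> / 2)" using B0 \<open>e > 0\<close> \<open>\<eta> > 0\<close> by simp
    ultimately have n0: "real n > 0" by linarith
    define a where "a = e / n"
    have a: "a > 0" "real n * a = e" "2 * B * a < \<eta> / 2"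
      using n n0 \<open>e > 0\<close> \<open>\<eta> > 0\<close> by (auto simp: a_def field_simps)
    define k where "k = nat \<lfloor>y / a\<rfloor>"
    have "0 \<le> y / a" using that a by simp
    then have "real k \<le> y / a" "y / a < real k + 1" unfolding k_def by linarith+
    then have k: "\<bar>y - real k * a\<bar> \<le> a" using a(1) by (auto simp: field_simps abs_le_iff)
    have "((\<lambda>t. (inc (real k * a) t - real k * inc a t) - real k / real n * (inc (real n * a) t - real n * inc a t)) \<longlongrightarrow> 0 - real k / real n * 0) at_top"
      by (intro tendsto_intros additive)
    then have "\<forall>\<^sub>F t in at_top. \<bar>inc (real k * a) t - real k / real n * inc e t\<bar> < \<eta> / 2"
      using \<open>\<eta> > 0\<close> n0 a(2) by (auto simp: algebra_simps dest!: tendstoD[of _ 0 at_top "\<eta> / 2"])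
    then show "\<forall>\<^sub>F t in at_top. dist (inc y t - y / e * inc e t) 0 < \<eta>"
    proof eventually_elim
      case (elim t)
      have "\<bar>inc y t - inc (real k * a) t\<bar> \<le> B * a"
      proof -
        have "\<bar>inc y t - inc (real k * a) t\<bar> \<le> B * \<bar>y - real k * a\<bar>"
          using lip[of "t + y" "t + real k * a"] by (simp add: inc_def)
        also have "\<dots> \<le> B * a" using k B0 by (intro mult_left_mono) auto
        finally show ?thesis .
      qed
      moreover have "\<bar>(real k / real n - y / e) * inc e t\<bar> \<le> B * a"
      proof -
        have "real k / real n - y / e = - (y - real k * a) / e"
          using a n0 \<open>e > 0\<close> by (simp add: a_def field_simps)
        then have "\<bar>(real k / real n - y / e) * inc e t\<bar> = \<bar>y - real k * a\<bar> / e * \<bar>inc e t\<bar>"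
          using \<open>e > 0\<close> by (simp add: abs_mult abs_minus_commute)
        also have "\<dots> \<le> a / e * (B * e)"
          using k a \<open>e > 0\<close> inc_bound[of e t] by (intro mult_mono divide_right_mono) auto
        finally show ?thesis using \<open>e > 0\<close> by (simp add: mult.commute)
      qed
      moreover have "\<bar>inc y t - y / e * inc e t\<bar> \<le> \<bar>inc y t - inc (real k * a) t\<bar>
          + \<bar>inc (real k * a) t - real k / real n * inc e t\<bar> + \<bar>(real k / real n - y / e) * inc e t\<bar>"
      proof -
        have "\<bar>p - u\<bar> \<le> \<bar>p - q\<bar> + \<bar>q - v\<bar> + \<bar>v - u\<bar>" for p q u v :: real by linarith
        then show ?thesis unfolding left_diff_distrib .
      qed
      ultimately have "\<bar>inc y t - y / e * inc e t\<bar> < \<eta>" using elim a(3) by linarith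
      then show ?case by simp
    qed
  qed

  have "((\<lambda>t. expectation (\<lambda>y. I t - I (t - y) - y / e * inc e t)) \<longlongrightarrow> expectation (\<lambda>y. 0)) at_top"
  proof (rule integral_dominated_convergence_at_top[where w = "\<lambda>y. 2 * B * \<bar>y\<bar>"])
    show "integrable F (\<lambda>y. 2 * B * \<bar>y\<bar>)" using integrable_id by simp
    show "AE y in F. ((\<lambda>t. I t - I (t - y) - y / e * inc e t) \<longlongrightarrow> 0) at_top"
      using nonneg
    proof eventually_elim
      case (elim y)
      have "((\<lambda>t. (inc y (t - y) - inc y t) + (inc y t - y / e * inc e t)) \<longlongrightarrow> 0 + 0) at_top"
        by (intro tendsto_add inv linear elim)
      moreover have "(inc y (t - y) - inc y t) + (inc y t - y / e * inc e t)
          = I t - I (t - y) - y / e * inc e t" for t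
        by (simp add: inc_def)
      ultimately show ?case by simp
    qed
    show "\<forall>\<^sub>F t in at_top. AE y in F. norm (I t - I (t - y) - y / e * inc e t) \<le> 2 * B * \<bar>y\<bar>"
    proof (intro always_eventually allI AE_I2)
      fix t y
      have "\<bar>y / e * inc e t\<bar> = \<bar>y\<bar> / e * \<bar>inc e t\<bar>"
        using \<open>e > 0\<close> by (simp add: abs_mult)
      also have "\<dots> \<le> \<bar>y\<bar> / e * (B * e)"
        using inc_bound[of e t] \<open>e > 0\<close> by (intro mult_left_mono) auto
      also have "\<dots> = B * \<bar>y\<bar>" using \<open>e > 0\<close> by simp
      finally have "\<bar>y / e * inc e t\<bar> \<le> B * \<bar>y\<bar>" .
      moreover have "\<bar>I t - I (t - y)\<bar> \<le> B * \<bar>y\<bar>" using lip[of t "t - y"] by simp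
      moreover have "\<bar>p - q\<bar> \<le> 2 * B * \<bar>y\<bar>" if "\<bar>q\<bar> \<le> B * \<bar>y\<bar>" "\<bar>p\<bar> \<le> B * \<bar>y\<bar>" for p q
        using that by linarith
      ultimately show "norm (I t - I (t - y) - y / e * inc e t) \<le> 2 * B * \<bar>y\<bar>"
        unfolding real_norm_def by blast
    qed
  qed (auto simp: inc_def)
  moreover have "expectation (\<lambda>y. I t - I (t - y) - y / e * inc e t)
      = expectation (\<lambda>y. I t - I (t - y)) - mean / e * inc e t" for t
    using int_back[of t] integrable_id by simp
  ultimately have "((\<lambda>t. expectation (\<lambda>y. I t - I (t - y)) - mean / e * inc e t) \<longlongrightarrow> 0) at_top"
    by simp
  from tendsto_mult_left[OF tendsto_diff[OF lim this], of "e / mean"]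
  show ?thesis using \<open>e > 0\<close> mean_pos by (simp add: inc_def)
qed

end

section \<open>Random measures on the line\<close>

text \<open>
  The \<open>\<sigma>\<close>-algebra generated by the evaluations, on all measures on the Borel sets, so that
  cluster processes are random elements of this space everywhere and not only almost surely.
\<close>

definition point_meas :: "real measure measure" where
  "point_meas = (SUP A \<in> sets borel. vimage_algebra {m. sets m = sets borel} (\<lambda>m. emeasure m A) borel)"

lemma space_point_meas: "space point_meas = {m. sets m = sets borel}"
  by (auto simp: point_meas_def space_Sup_eq_UN)

lemma measurable_point_measI:
  assumes "\<And>x. x \<in> space S \<Longrightarrow> sets (\<kappa> x) = sets borel"
    and "\<And>A. A \<in> sets borel \<Longrightarrow> (\<lambda>x. emeasure (\<kappa> x) A) \<in> borel_measurable S"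
  shows "\<kappa> \<in> S \<rightarrow>\<^sub>M point_meas"
  using assms by (auto intro!: measurable_Sup2 measurable_vimage_algebra2 simp: point_meas_def)

lemma measurable_emeasure_point_meas [measurable]:
  "A \<in> sets borel \<Longrightarrow> (\<lambda>m. emeasure m A) \<in> borel_measurable point_meas"
  by (auto intro!: measurable_Sup1 measurable_vimage_algebra1 simp: point_meas_def)

lemma measurable_nn_integral_point_meas [measurable]:
  assumes f: "f \<in> borel_measurable borel"
  shows "(\<lambda>m. \<integral>\<^sup>+ x. f x \<partial>m) \<in> borel_measurable point_meas"
  using f
proof induct
  case (cong f g)
  moreover have "(\<integral>\<^sup>+ x. f x \<partial>m) = (\<integral>\<^sup>+ x. g x \<partial>m)" if "m \<in> space point_meas" for m
    using that cong by (intro nn_integral_cong) auto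
  ultimately show ?case by (simp cong: measurable_cong)
next
  case (set B)
  have "(\<lambda>m. \<integral>\<^sup>+ x. indicator B x \<partial>m) \<in> borel_measurable point_meas \<longleftrightarrow>
      (\<lambda>m. emeasure m B) \<in> borel_measurable point_meas"
    by (intro measurable_cong nn_integral_indicator) (use set in \<open>auto simp: space_point_meas\<close>)
  with set show ?case by simp
next
  case (mult f c)
  have "(\<lambda>m. \<integral>\<^sup>+ x. c * f x \<partial>m) \<in> borel_measurable point_meas \<longleftrightarrow>
      (\<lambda>m. c * (\<integral>\<^sup>+ x. f x \<partial>m)) \<in> borel_measurable point_meas"
    by (intro measurable_cong nn_integral_cmult)
      (use mult in \<open>auto simp: space_point_meas cong: measurable_cong_sets\<close>)
  with mult show ?case by simp
next
  case (add f g)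
  have "(\<lambda>m. \<integral>\<^sup>+ x. g x + f x \<partial>m) \<in> borel_measurable point_meas \<longleftrightarrow>
      (\<lambda>m. (\<integral>\<^sup>+ x. g x \<partial>m) + (\<integral>\<^sup>+ x. f x \<partial>m)) \<in> borel_measurable point_meas"
    by (intro measurable_cong nn_integral_add)
      (use add in \<open>auto simp: space_point_meas cong: measurable_cong_sets\<close>)
  with add show ?case by simp
next
  case (seq F)
  have "(\<lambda>m. \<integral>\<^sup>+ x. (SUP i. F i) x \<partial>m) \<in> borel_measurable point_meas \<longleftrightarrow>
      (\<lambda>m. SUP i. \<integral>\<^sup>+ x. F i x \<partial>m) \<in> borel_measurable point_meas"
    unfolding SUP_apply
    by (intro measurable_cong nn_integral_monotone_convergence_SUP)
      (use seq in \<open>auto simp: space_point_meas cong: measurable_cong_sets\<close>)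
  with seq show ?case by (simp add: image_comp)
qed

lemma measurable_integral_point_meas [measurable]:
  fixes f :: "real \<Rightarrow> real"
  assumes [measurable]: "f \<in> borel_measurable borel"
  shows "(\<lambda>m. \<integral>x. f x \<partial>m) \<in> borel_measurable point_meas"
proof -
  define p n where "p = (\<lambda>m. \<integral>\<^sup>+ x. ennreal (f x) \<partial>m)" and "n = (\<lambda>m. \<integral>\<^sup>+ x. ennreal (- f x) \<partial>m)"
  have [measurable]: "p \<in> borel_measurable point_meas" "n \<in> borel_measurable point_meas"
    unfolding p_def n_def by measurable
  have "(\<integral>x. f x \<partial>m) = (if p m < \<infinity> \<and> n m < \<infinity> then enn2real (p m) - enn2real (n m) else 0)"
    if "m \<in> space point_meas" for m
  proof -
    have m: "f \<in> borel_measurable m"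
      using that by (simp add: space_point_meas cong: measurable_cong_sets)
    have int: "integrable m f \<longleftrightarrow> p m < \<infinity> \<and> n m < \<infinity>"
      using m by (auto simp: real_integrable_def p_def n_def less_top)
    show ?thesis
    proof (cases "integrable m f")
      case True
      then show ?thesis using int by (simp add: real_lebesgue_integral_def p_def n_def)
    next
      case False
      then show ?thesis using int by (auto simp: not_integrable_integral_eq)
    qed
  qed
  then show ?thesis by (subst measurable_cong) (assumption, measurable)
qed

section \<open>Clusters and windows\<close>

lemma sets_cluster_process [simp, measurable_cong]: "sets (cluster_process \<tau> w) = sets borel"
  by (simp add: cluster_process_def dirac_sum_def)

lemma space_mark_space_gap: "w \<in> space mark_space \<Longrightarrow> gap w \<ge> 0"
  by (auto simp: mark_space_def gap_def space_pair_measure space_restrict_space)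

lemma measurable_cluster_size [measurable]: "cluster_size \<in> mark_space \<rightarrow>\<^sub>M count_space UNIV"
  unfolding cluster_size_def mark_space_def by simp

lemma measurable_cluster_pt [measurable]: "(\<lambda>w. cluster_pt w j) \<in> borel_measurable mark_space"
  unfolding cluster_pt_def mark_space_def by measurable

lemma measurable_gap [measurable]: "gap \<in> borel_measurable mark_space"
proof -
  have "(\<lambda>w::mark. snd (snd w)) \<in> mark_space \<rightarrow>\<^sub>M restrict_space borel {0..}"
    unfolding mark_space_def by simp
  then show ?thesis unfolding gap_def by (simp add: measurable_restrict_space2_iff)
qed

definition cluster_count :: "real set \<Rightarrow> real \<Rightarrow> mark \<Rightarrow> ennreal" where
  "cluster_count A s w = (\<Sum>j<cluster_size w. indicator A (s + cluster_pt w j))"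

lemma measurable_cluster_count [measurable]:
  assumes [measurable]: "A \<in> sets borel" "s \<in> borel_measurable S" "w \<in> S \<rightarrow>\<^sub>M mark_space"
  shows "(\<lambda>x. cluster_count A (s x) (w x)) \<in> borel_measurable S"
proof -
  have "(\<lambda>x. \<Sum>j<n. indicator A (s x + cluster_pt (w x) j) :: ennreal) \<in> borel_measurable S" for n :: nat
    by measurable
  moreover have "(\<lambda>x. cluster_size (w x)) \<in> S \<rightarrow>\<^sub>M count_space UNIV" by measurable
  ultimately show ?thesis
    unfolding cluster_count_def by (rule measurable_compose_countable)
qed

lemma emeasure_cluster_process:
  assumes "A \<in> sets borel"
  shows "emeasure (cluster_process \<tau> w) A = (\<integral>\<^sup>+ i. cluster_count A (\<tau> i) (w i) \<partial>count_space UNIV)"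
proof -
  define S where "S = {(i, j). j < cluster_size (w i)}"
  define f where "f = (\<lambda>p. indicator A (case p of (i, j) \<Rightarrow> \<tau> i + cluster_pt (w i) j) * indicator S p :: ennreal)"
  have "emeasure (cluster_process \<tau> w) A = (\<integral>\<^sup>+ p. f p \<partial>count_space UNIV)"
    unfolding cluster_process_def emeasure_dirac_sum[OF assms] f_def S_def
    by (rule nn_integral_count_space_indicator) simp
  also have "\<dots> = (\<integral>\<^sup>+ i. \<integral>\<^sup>+ j. f (i, j) \<partial>count_space UNIV \<partial>count_space UNIV)"
    by (rule nn_integral_fst_count_space[symmetric])
  also have "\<dots> = (\<integral>\<^sup>+ i. cluster_count A (\<tau> i) (w i) \<partial>count_space UNIV)"
  proof (rule nn_integral_cong)
    fix i
    have "(\<integral>\<^sup>+ j. f (i, j) \<partial>count_space UNIV) = (\<Sum>j<cluster_size (w i). f (i, j))"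
      by (rule nn_integral_count_space') (auto simp: f_def S_def)
    then show "(\<integral>\<^sup>+ j. f (i, j) \<partial>count_space UNIV) = cluster_count A (\<tau> i) (w i)"
      by (simp add: cluster_count_def f_def S_def)
  qed
  finally show ?thesis .
qed

lemma measurable_cluster_process:
  fixes \<tau> :: "'i :: countable \<Rightarrow> 's \<Rightarrow> real"
  assumes [measurable]: "\<And>i. \<tau> i \<in> borel_measurable S" "\<And>i. w i \<in> S \<rightarrow>\<^sub>M mark_space"
  shows "(\<lambda>x. cluster_process (\<lambda>i. \<tau> i x) (\<lambda>i. w i x)) \<in> S \<rightarrow>\<^sub>M point_meas"
proof (rule measurable_point_measI)
  fix A :: "real set" assume [measurable]: "A \<in> sets borel"
  interpret sigma_finite_measure "count_space (UNIV :: 'i set)"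
    by (rule sigma_finite_measure_count_space)
  have "(\<lambda>(i, x). cluster_count A (\<tau> i x) (w i x)) \<in> borel_measurable (count_space UNIV \<Otimes>\<^sub>M S)"
    by (rule measurable_pair_measure_countable1) auto
  then have "(\<lambda>(x, i). cluster_count A (\<tau> i x) (w i x)) \<in> borel_measurable (S \<Otimes>\<^sub>M count_space UNIV)"
    by (subst measurable_pair_swap_iff) (simp add: split_def)
  then show "(\<lambda>x. emeasure (cluster_process (\<lambda>i. \<tau> i x) (\<lambda>i. w i x)) A) \<in> borel_measurable S"
    unfolding emeasure_cluster_process[OF \<open>A \<in> sets borel\<close>]
    by (rule borel_measurable_nn_integral)
qed simp

lemma theta_shift_cluster_process:
  "theta_shift t (cluster_process \<tau> w) = cluster_process (\<lambda>i. \<tau> i - t) w"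
  unfolding theta_shift_def cluster_process_def dirac_sum_def
  by (subst distr_distr) (auto simp: comp_def split_def algebra_simps)

text \<open>
  Agreement inside a window is expressed by the values on its Borel subsets, which keeps all measures
  on the whole line.
\<close>

definition agree_on_window :: "real \<Rightarrow> real measure \<Rightarrow> real measure \<Rightarrow> bool" where
  "agree_on_window r m m' \<longleftrightarrow> sets m = sets borel \<and> sets m' = sets borel \<and>
     (\<forall>A\<in>sets borel. A \<subseteq> {-r..r} \<longrightarrow> emeasure m A = emeasure m' A)"

definition hits :: "real \<Rightarrow> real \<Rightarrow> mark \<Rightarrow> bool" where
  "hits r s w \<longleftrightarrow> (\<exists>j<cluster_size w. \<bar>s + cluster_pt w j\<bar> \<le> r)"

lemma cluster_count_eq_0: "\<not> hits r s w \<Longrightarrow> A \<subseteq> {-r..r} \<Longrightarrow> cluster_count A s w = 0"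
  unfolding hits_def cluster_count_def by (fastforce simp: abs_le_iff indicator_def intro!: sum.neutral)

lemma cluster_count_ge_1: "hits r s w \<Longrightarrow> cluster_count {-r..r} s w \<ge> 1"
proof -
  assume "hits r s w"
  then obtain j where j: "j < cluster_size w" "\<bar>s + cluster_pt w j\<bar> \<le> r" by (auto simp: hits_def)
  then have "1 = (indicator {-r..r} (s + cluster_pt w j) :: ennreal)" by (auto simp: abs_le_iff)
  also have "\<dots> \<le> cluster_count {-r..r} s w"
    unfolding cluster_count_def using j by (intro member_le_sum) auto
  finally show ?thesis .
qed

text \<open>
  Clusters without points in the window may be dropped and the others renumbered. This serves both for
  removing the first cluster of a sequence and for truncating a two-sided sequence.
\<close>

lemma agree_on_window_subfamily:
  assumes "inj f" and "\<And>i. i \<notin> range f \<Longrightarrow> \<not> hits r (\<tau> i) (w i)"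
  shows "agree_on_window r (cluster_process \<tau> w) (cluster_process (\<lambda>i. \<tau> (f i)) (\<lambda>i. w (f i)))"
  unfolding agree_on_window_def
proof (intro conjI ballI impI)
  fix A :: "real set" assume A: "A \<in> sets borel" "A \<subseteq> {-r..r}"
  have "(\<integral>\<^sup>+ i. cluster_count A (\<tau> i) (w i) \<partial>count_space UNIV)
      = (\<integral>\<^sup>+ i. cluster_count A (\<tau> i) (w i) \<partial>count_space (range f))"
    by (rule nn_integral_count_space_eq) (use A cluster_count_eq_0[OF assms(2)] in auto)
  also have "\<dots> = (\<integral>\<^sup>+ i. cluster_count A (\<tau> (f i)) (w (f i)) \<partial>count_space UNIV)"
    by (rule nn_integral_bij_count_space[symmetric]) (use assms in \<open>simp add: bij_betw_def\<close>)
  finally show "emeasure (cluster_process \<tau> w) A = emeasure (cluster_process (\<lambda>i. \<tau> (f i)) (\<lambda>i. w (f i))) A"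
    by (simp add: emeasure_cluster_process A)
qed auto

text \<open>
  Each cluster that meets the window contributes at least 1 to the number of points in it.
\<close>

lemma finite_hits:
  assumes "emeasure (cluster_process \<tau> w) {-r..r} < \<infinity>"
  shows "finite {i. hits r (\<tau> i) (w i)}"
proof (rule ccontr)
  assume inf: "infinite {i. hits r (\<tau> i) (w i)}"
  have "emeasure (count_space UNIV) {i. hits r (\<tau> i) (w i)}
      = (\<integral>\<^sup>+ i. indicator {i. hits r (\<tau> i) (w i)} i \<partial>count_space UNIV)" by simp
  also have "\<dots> \<le> (\<integral>\<^sup>+ i. cluster_count {-r..r} (\<tau> i) (w i) \<partial>count_space UNIV)"
    by (intro nn_integral_mono) (auto simp: indicator_def cluster_count_ge_1)
  also have "\<dots> < \<infinity>" using assms by (simp add: emeasure_cluster_process)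
  finally show False using inf by simp
qed

lemma radius_nonneg: "radius w \<ge> 0"
proof (cases "cluster_size w = 0")
  case False
  then have "0 \<le> \<bar>cluster_pt w 0\<bar>" "\<bar>cluster_pt w 0\<bar> \<le> (SUP j \<in> {..<cluster_size w}. \<bar>cluster_pt w j\<bar>)"
    by (auto intro!: cSUP_upper bdd_above_finite)
  then show ?thesis using False by (simp add: radius_def)
qed (simp add: radius_def)

lemma hits_radius: "hits r s w \<Longrightarrow> \<bar>s\<bar> \<le> r + radius w"
proof -
  assume "hits r s w"
  then obtain j where j: "j < cluster_size w" "\<bar>s + cluster_pt w j\<bar> \<le> r" by (auto simp: hits_def)
  have "\<bar>cluster_pt w j\<bar> \<le> (SUP j \<in> {..<cluster_size w}. \<bar>cluster_pt w j\<bar>)"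
    using j by (intro cSUP_upper bdd_above_finite) auto
  then show ?thesis using j by (auto simp: radius_def)
qed

lemma measurable_radius [measurable]: "radius \<in> borel_measurable mark_space"
proof -
  have "(\<lambda>w. if n = 0 then 0 else SUP j \<in> {..<n}. \<bar>cluster_pt w j\<bar>) \<in> borel_measurable mark_space" for n :: nat
  proof (cases "n = 0")
    case False
    then show ?thesis by (auto intro!: borel_measurable_cSUP)
  qed simp
  then show ?thesis
    unfolding radius_def using measurable_compose_countable[OF _ measurable_cluster_size] by simp
qed

lemma locally_finite_iff:
  assumes "sets m = sets borel"
  shows "locally_finite m \<longleftrightarrow> (\<forall>n::nat. emeasure m {- real n..real n} < \<infinity>)"
proof
  assume *: "\<forall>n::nat. emeasure m {- real n..real n} < \<infinity>"
  show "locally_finite m"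
    unfolding locally_finite_def
  proof (intro ballI impI)
    fix B :: "real set" assume "B \<in> sets borel" "bounded B"
    then obtain a where "\<forall>x\<in>B. norm x \<le> a" by (auto simp: bounded_iff)
    moreover obtain n :: nat where "a \<le> real n" using real_arch_simple by blast
    ultimately have "B \<subseteq> {- real n..real n}" by force
    then have "emeasure m B \<le> emeasure m {- real n..real n}" by (intro emeasure_mono) (auto simp: assms)
    with * show "emeasure m B < \<infinity>" by (meson le_less_trans)
  qed
qed (auto simp: locally_finite_def)

text \<open>
  The functional is defined on all measures, also on those that are not locally finite; it is bounded
  there as well, so no exceptional null sets have to be considered.
\<close>

locale window_functional =
  fixes H :: "real measure \<Rightarrow> real" and r B :: real
  assumes H_measurable [measurable]: "H \<in> borel_measurable point_meas"
    and r_nonneg: "r \<ge> 0"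
    and H_bound: "\<And>m. \<bar>H m\<bar> \<le> B"
    and H_window: "\<And>m m'. agree_on_window r m m' \<Longrightarrow> H m = H m'"

section \<open>Primitives of bounded functions\<close>

text \<open>
  The integrand that turns Lebesgue integrals into oriented integrals from \<open>a\<close> to \<open>b\<close>. Compared
  with interval integrals, it makes measurability in the end points and Fubini's theorem immediate.
\<close>

definition signed_interval :: "real \<Rightarrow> real \<Rightarrow> real \<Rightarrow> real" where
  "signed_interval a b s = indicator {a<..b} s - indicator {b<..a} s"

definition primitive :: "(real \<Rightarrow> real) \<Rightarrow> real \<Rightarrow> real" where
  "primitive f t = (\<integral>s. signed_interval 0 t s * f s \<partial>lborel)"

lemma measurable_signed_interval [measurable]:
  assumes [measurable]: "a \<in> borel_measurable M" "b \<in> borel_measurable M" "s \<in> borel_measurable M"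
  shows "(\<lambda>x. signed_interval (a x) (b x) (s x)) \<in> borel_measurable M"
proof -
  have "signed_interval (a x) (b x) (s x) =
      (if a x < s x \<and> s x \<le> b x then 1 else 0) - (if b x < s x \<and> s x \<le> a x then 1 else 0)" for x
    by (auto simp: signed_interval_def indicator_def)
  then show ?thesis by simp
qed

lemma measurable_primitive [measurable]:
  assumes [measurable]: "(\<lambda>(p, s). f p s) \<in> borel_measurable (M \<Otimes>\<^sub>M borel)" "t \<in> borel_measurable M"
  shows "(\<lambda>p. primitive (f p) (t p)) \<in> borel_measurable M"
  unfolding primitive_def by measurable

lemma signed_interval_bound: "\<bar>signed_interval a b s\<bar> \<le> indicator {min a b..max a b} s"
  by (auto simp: signed_interval_def indicator_def)

lemma integrable_signed_interval:
  assumes [measurable]: "f \<in> borel_measurable borel" and b: "\<And>x. \<bar>f x\<bar> \<le> B"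
  shows "integrable lborel (\<lambda>s. signed_interval a b s * f s)"
proof (rule Bochner_Integration.integrable_bound)
  show "integrable lborel (\<lambda>s. B * indicator {min a b..max a b} s :: real)"
    by (intro integrable_mult_right integrable_real_indicator) (auto simp: emeasure_lborel_Icc_eq)
  have "B \<ge> 0" using b[of 0] by linarith
  then show "AE s in lborel. norm (signed_interval a b s * f s) \<le> norm (B * indicator {min a b..max a b} s :: real)"
    using b signed_interval_bound
    by (intro AE_I2) (auto simp: abs_mult mult.commute[of B] intro!: mult_mono)
qed measurable

lemma integral_signed_interval_const:
  "(\<integral>s. signed_interval a b s \<partial>lborel) = b - a"
proof -
  have i: "integrable lborel (indicator {c<..d} :: real \<Rightarrow> real)" for c d :: real
    by (cases "c \<le> d") (auto intro!: integrable_real_indicator)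
  show ?thesis
    unfolding signed_interval_def using i by (cases "a \<le> b") auto
qed

context
  fixes f :: "real \<Rightarrow> real" and B :: real
  assumes f_meas [measurable]: "f \<in> borel_measurable borel" and f_bound: "\<And>x. \<bar>f x\<bar> \<le> B"
begin

lemma primitive_diff_eq: "primitive f b - primitive f a = (\<integral>s. signed_interval a b s * f s \<partial>lborel)"
proof -
  have "primitive f b - primitive f a = (\<integral>s. signed_interval 0 b s * f s - signed_interval 0 a s * f s \<partial>lborel)"
    unfolding primitive_def
    by (rule Bochner_Integration.integral_diff[symmetric]) (rule integrable_signed_interval[OF f_meas f_bound])+
  also have "\<dots> = (\<integral>s. signed_interval a b s * f s \<partial>lborel)"
    by (intro Bochner_Integration.integral_cong)
      (auto simp: signed_interval_def left_diff_distrib[symmetric] indicator_def)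
  finally show ?thesis .
qed

lemma primitive_lipschitz: "\<bar>primitive f a - primitive f b\<bar> \<le> B * \<bar>a - b\<bar>"
proof -
  have *: "\<bar>primitive f b - primitive f a\<bar> \<le> B * (b - a)" if "a \<le> b" for a b
  proof -
    have "\<bar>primitive f b - primitive f a\<bar> \<le> (\<integral>s. \<bar>signed_interval a b s * f s\<bar> \<partial>lborel)"
      unfolding primitive_diff_eq by (rule integral_abs_bound)
    also have "\<dots> \<le> (\<integral>s. signed_interval a b s * B \<partial>lborel)"
      using integrable_abs[OF integrable_signed_interval[OF f_meas f_bound, of a b]]
        integrable_signed_interval[of "\<lambda>_. B" "\<bar>B\<bar>" a b] that f_bound
      by (intro integral_mono) (auto simp: abs_mult signed_interval_def indicator_def)
    also have "\<dots> = B * (b - a)"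
      using integral_signed_interval_const[of a b] by simp
    finally show ?thesis .
  qed
  show ?thesis
    using *[of a b] *[of b a] by (cases "a \<le> b") (auto simp: abs_minus_commute)
qed

lemma primitive_0 [simp]: "primitive f 0 = 0"
  by (simp add: primitive_def signed_interval_def)

lemma primitive_bound: "\<bar>primitive f t\<bar> \<le> B * \<bar>t\<bar>"
  using primitive_lipschitz[of t 0] by simp

lemma primitive_translate: "primitive (\<lambda>s. f (s - y)) t = primitive f (t - y) - primitive f (- y)"
proof -
  have "primitive f (t - y) - primitive f (- y) = (\<integral>s. signed_interval (- y) (t - y) s * f s \<partial>lborel)"
    by (rule primitive_diff_eq)
  also have "\<dots> = (\<integral>s. signed_interval (- y) (t - y) (- y + 1 * s) * f (- y + 1 * s) \<partial>lborel)"
    by (subst lborel_integral_real_affine[where c = 1 and t = "- y"]) simp_all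
  also have "\<dots> = primitive (\<lambda>s. f (s - y)) t"
    unfolding primitive_def
    by (intro Bochner_Integration.integral_cong) (auto simp: signed_interval_def indicator_def)
  finally show ?thesis by simp
qed

text \<open>
  The substitution that replaces an integral over a cycle of length \<open>g\<close> by the mean over a uniformly
  chosen point of the cycle.
\<close>

lemma primitive_affine:
  assumes "g \<ge> 0"
  shows "primitive f b - primitive f (b - g) = g * (\<integral>u. indicator {0..1} u * f (b - u * g) \<partial>lborel)"
proof (cases "g = 0")
  case False
  then have "primitive f b - primitive f (b - g) = (\<integral>s. signed_interval (b - g) b s * f s \<partial>lborel)"
    by (simp add: primitive_diff_eq)
  also have "\<dots> = \<bar>- g\<bar> *\<^sub>R (\<integral>u. signed_interval (b - g) b (b + (- g) * u) * f (b + (- g) * u) \<partial>lborel)"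
    by (rule lborel_integral_real_affine) (use False in auto)
  also have "(\<integral>u. signed_interval (b - g) b (b + (- g) * u) * f (b + (- g) * u) \<partial>lborel)
      = (\<integral>u. indicator {0..1} u * f (b - u * g) \<partial>lborel)"
  proof (rule integral_cong_AE)
    have "AE u in lborel. u \<noteq> 1" "AE u in lborel. u \<noteq> (0::real)" by (rule AE_lborel_singleton)+
    then show "AE u in lborel. signed_interval (b - g) b (b + (- g) * u) * f (b + (- g) * u)
        = indicator {0..1} u * f (b - u * g)"
    proof eventually_elim
      case (elim u)
      have "g > 0" using assms False by simp
      then have "b - g < b + (- g) * u \<longleftrightarrow> u < 1" "b + (- g) * u \<le> b \<longleftrightarrow> u \<ge> 0"
        by (auto simp: zero_le_mult_iff)
      then show ?case using elim \<open>g > 0\<close>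
        by (auto simp: signed_interval_def indicator_def mult.commute)
    qed
  qed measurable
  finally show ?thesis using assms by simp
qed simp

end

lemma primitive_diff:
  assumes [measurable]: "f \<in> borel_measurable borel" "g \<in> borel_measurable borel"
    and "\<And>x. \<bar>f x\<bar> \<le> B" "\<And>x. \<bar>g x\<bar> \<le> C"
  shows "primitive (\<lambda>s. f s - g s) t = primitive f t - primitive g t"
proof -
  have "primitive (\<lambda>s. f s - g s) t = (\<integral>s. signed_interval 0 t s * f s - signed_interval 0 t s * g s \<partial>lborel)"
    by (simp add: primitive_def algebra_simps)
  also have "\<dots> = primitive f t - primitive g t"
    unfolding primitive_def
    by (rule Bochner_Integration.integral_diff) (rule integrable_signed_interval[OF _ assms(3)] integrable_signed_interval[OF _ assms(4)], measurable)+
  finally show ?thesis .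
qed

lemma (in prob_space) integral_primitive:
  fixes f :: "'a \<Rightarrow> real \<Rightarrow> real"
  assumes [measurable]: "(\<lambda>(p, s). f p s) \<in> borel_measurable (M \<Otimes>\<^sub>M borel)"
    and b: "\<And>p s. \<bar>f p s\<bar> \<le> B"
  shows "expectation (\<lambda>p. primitive (f p) t) = primitive (\<lambda>s. expectation (\<lambda>p. f p s)) t"
proof -
  interpret pair_sigma_finite M lborel ..
  have B0: "B \<ge> 0" using b[of undefined 0] by linarith
  have "integrable (M \<Otimes>\<^sub>M lborel) (\<lambda>(p, s). signed_interval 0 t s * f p s)"
  proof (rule Bochner_Integration.integrable_bound)
    show "integrable (M \<Otimes>\<^sub>M lborel) (\<lambda>p. B * indicator (space M \<times> {min 0 t..max 0 t}) p :: real)"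
      by (intro integrable_mult_right integrable_real_indicator)
        (auto simp: lborel.emeasure_pair_measure_Times emeasure_space_1 emeasure_lborel_Icc_eq)
    show "AE p in M \<Otimes>\<^sub>M lborel. norm (case p of (p, s) \<Rightarrow> signed_interval 0 t s * f p s)
        \<le> norm (B * indicator (space M \<times> {min 0 t..max 0 t}) p :: real)"
    proof (rule AE_I2)
      fix p :: "'a \<times> real" assume "p \<in> space (M \<Otimes>\<^sub>M lborel)"
      moreover obtain q s where p: "p = (q, s)" by (cases p)
      ultimately have "indicator (space M \<times> {min 0 t..max 0 t}) p = (indicator {min 0 t..max 0 t} s :: real)"
        by (auto simp: space_pair_measure indicator_def)
      moreover have "\<bar>signed_interval 0 t s\<bar> * \<bar>f q s\<bar> \<le> indicator {min 0 t..max 0 t} s * B"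
        by (intro mult_mono signed_interval_bound b) auto
      ultimately show "norm (case p of (p, s) \<Rightarrow> signed_interval 0 t s * f p s)
        \<le> norm (B * indicator (space M \<times> {min 0 t..max 0 t}) p :: real)"
        using B0 by (simp add: p abs_mult mult.commute)
    qed
  qed measurable
  from Fubini_integral[OF this] show ?thesis
    by (simp add: primitive_def)
qed

lemma primitive_average:
  assumes [measurable]: "f \<in> borel_measurable borel" and b: "\<And>x. \<bar>f x\<bar> \<le> B"
    and "a \<le> b" and close: "\<And>s. a < s \<Longrightarrow> s \<le> b \<Longrightarrow> \<bar>f s - c\<bar> \<le> d"
  shows "\<bar>primitive f b - primitive f a - (b - a) * c\<bar> \<le> (b - a) * d"
proof -
  note i = integrable_signed_interval[OF assms(1) b, of a b]
    and ic = integrable_signed_interval[of "\<lambda>_. c" "\<bar>c\<bar>" a b]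
    and id = integrable_signed_interval[of "\<lambda>_. d" "\<bar>d\<bar>" a b]
  have "primitive f b - primitive f a - (b - a) * c
      = (\<integral>s. signed_interval a b s * f s \<partial>lborel) - (\<integral>s. signed_interval a b s * c \<partial>lborel)"
    by (simp add: primitive_diff_eq[OF assms(1) b] integral_signed_interval_const)
  also have "\<dots> = (\<integral>s. signed_interval a b s * f s - signed_interval a b s * c \<partial>lborel)"
    using i ic by simp
  finally have "\<bar>primitive f b - primitive f a - (b - a) * c\<bar>
      \<le> (\<integral>s. \<bar>signed_interval a b s * f s - signed_interval a b s * c\<bar> \<partial>lborel)"
    by simp
  also have "\<dots> \<le> (\<integral>s. signed_interval a b s * d \<partial>lborel)"
    using i ic id close \<open>a \<le> b\<close>
    by (intro integral_mono) (auto simp: signed_interval_def indicator_def)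
  also have "\<dots> = (b - a) * d"
    by (simp add: integral_signed_interval_const)
  finally show ?thesis .
qed

section \<open>Independent sequences of marks\<close>

lemma distr_pair_snd:
  assumes "prob_space A" "prob_space C"
  shows "distr (A \<Otimes>\<^sub>M C) C snd = C"
proof (rule measure_eqI)
  interpret A: prob_space A by fact
  interpret C: prob_space C by fact
  fix X assume "X \<in> sets (distr (A \<Otimes>\<^sub>M C) C snd)"
  then have X: "X \<in> sets C" by simp
  then have "snd -` X \<inter> space (A \<Otimes>\<^sub>M C) = space A \<times> X"
    using sets.sets_into_space by (auto simp: space_pair_measure)
  with X show "emeasure (distr (A \<Otimes>\<^sub>M C) C snd) X = emeasure C X"
    by (simp add: emeasure_distr C.emeasure_pair_measure_Times A.emeasure_space_1)
qed simp

text \<open>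
  The law \<open>P\<close> of a mark, together with the moment assumptions of the theorem.
\<close>

locale mark_law = prob_space P for P :: "mark measure" +
  assumes sets_P [measurable_cong, simp]: "sets P = sets mark_space"
    and nonarithmetic_gap: "nonarithmetic P gap"
    and integrable_gap: "integrable P gap"
    and mean_gap_pos: "expectation gap > 0"
    and integrable_radius: "integrable P radius"
begin

lemma space_P: "space P = space mark_space"
  by (rule sets_eq_imp_space_eq) simp

lemma gap_nonneg: "x \<in> space P \<Longrightarrow> gap x \<ge> 0"
  by (simp add: space_P space_mark_space_gap)

lemma measurable_gap_P [measurable]: "gap \<in> borel_measurable P"
  and measurable_radius_P [measurable]: "radius \<in> borel_measurable P"
  by (simp_all cong: measurable_cong_sets)

abbreviation Seq :: "(nat \<Rightarrow> mark) measure" where "Seq \<equiv> PiM UNIV (\<lambda>_. P)"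

sublocale seq: sequence_space P
  by unfold_locales

sublocale pair: pair_prob_space P Seq ..

abbreviation PSeq :: "(mark \<times> (nat \<Rightarrow> mark)) measure" where "PSeq \<equiv> P \<Otimes>\<^sub>M Seq"

lemma measurable_Seq_component [measurable (raw)]:
  assumes "w \<in> S \<rightarrow>\<^sub>M Seq"
  shows "(\<lambda>p. w p i) \<in> S \<rightarrow>\<^sub>M mark_space"
proof -
  have "(\<lambda>p. w p i) \<in> S \<rightarrow>\<^sub>M P" using assms by measurable
  then show ?thesis by (simp cong: measurable_cong_sets)
qed

lemma measurable_renewal_time [measurable]:
  assumes [measurable]: "w \<in> S \<rightarrow>\<^sub>M Seq"
  shows "(\<lambda>p. renewal_time (w p) i) \<in> borel_measurable S"
  unfolding renewal_time_def by measurable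

lemma measurable_prepend [measurable]: "(\<lambda>p. case_nat (fst p) (snd p)) \<in> PSeq \<rightarrow>\<^sub>M Seq"
  by (rule measurable_case_nat') measurable

lemma renewal_time_Suc: "renewal_time w (Suc i) = renewal_time w i + gap (w (Suc i))"
  by (simp add: renewal_time_def)

lemma renewal_time_0: "renewal_time w 0 = gap (w 0)"
  by (simp add: renewal_time_def)

lemma renewal_time_prepend: "renewal_time (case_nat x w) (Suc i) = gap x + renewal_time w i"
  by (induction i) (auto simp: renewal_time_Suc renewal_time_0)

lemma renewal_time_nonneg: "w \<in> space Seq \<Longrightarrow> renewal_time w i \<ge> 0"
  unfolding renewal_time_def by (intro sum_nonneg gap_nonneg) (auto simp: space_PiM)

lemma distr_prepend: "distr PSeq Seq (\<lambda>p. case_nat (fst p) (snd p)) = Seq"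
  using seq.PiM_iter by (simp add: split_def)

text \<open>
  A sequence of independent marks is again such a sequence after an independent mark has been put in
  front. All computations with the first mark use this on the space \<open>PSeq\<close>.
\<close>

lemma integral_prepend:
  fixes f :: "(nat \<Rightarrow> mark) \<Rightarrow> real"
  assumes "f \<in> borel_measurable Seq"
  shows "(\<integral>p. f (case_nat (fst p) (snd p)) \<partial>PSeq) = (\<integral>w. f w \<partial>Seq)"
    and "integrable PSeq (\<lambda>p. f (case_nat (fst p) (snd p))) \<longleftrightarrow> integrable Seq f"
  using integral_distr[OF measurable_prepend assms] integrable_distr_eq[OF measurable_prepend assms]
  by (simp_all add: distr_prepend)

lemma integral_PSeq_fst:
  fixes f :: "mark \<Rightarrow> real"
  assumes [measurable]: "f \<in> borel_measurable P"
  shows "(\<integral>p. f (fst p) \<partial>PSeq) = (\<integral>x. f x \<partial>P)"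
    and "integrable PSeq (\<lambda>p. f (fst p)) \<longleftrightarrow> integrable P f"
  using integral_distr[of fst PSeq P f] integrable_distr_eq[of fst PSeq P f]
  by (simp_all add: seq.P.distr_pair_fst)

lemma integral_PSeq_snd:
  fixes f :: "(nat \<Rightarrow> mark) \<Rightarrow> real"
  assumes [measurable]: "f \<in> borel_measurable Seq"
  shows "(\<integral>p. f (snd p) \<partial>PSeq) = (\<integral>x. f x \<partial>Seq)"
    and "integrable PSeq (\<lambda>p. f (snd p)) \<longleftrightarrow> integrable Seq f"
  using integral_distr[of snd PSeq Seq f] integrable_distr_eq[of snd PSeq Seq f]
  by (simp_all add: distr_pair_snd prob_space_axioms seq.P.prob_space_axioms)

lemma distr_Seq_component: "distr Seq P (\<lambda>w. w i) = P"
  by (rule seq.PiM_component) simp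

lemma integrable_renewal_time: "integrable Seq (\<lambda>w. renewal_time w i)"
proof -
  have "integrable Seq (\<lambda>w. gap (w j))" for j
    using integrable_distr_eq[of "\<lambda>w. w j" Seq P gap] integrable_gap by (simp add: distr_Seq_component)
  then show ?thesis unfolding renewal_time_def by simp
qed

text \<open>
  With \<open>q = E exp (- X) < 1\<close>, the mean of \<open>exp (- T\<^sub>n)\<close> at the renewal time \<open>T\<^sub>n\<close> is \<open>q ^ (n + 1)\<close>, which
  is summable. So the series of the \<open>exp (- T\<^sub>n)\<close> converges almost surely.
\<close>

lemma renewal_time_tendsto_infinity: "AE w in Seq. \<forall>C. \<forall>\<^sub>F n in sequentially. C < renewal_time w n"
proof -
  define q where "q = expectation (\<lambda>x. exp (- gap x))"
  have int: "integrable P (\<lambda>x. exp (- gap x))"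
    by (rule integrable_const_bound[of _ 1]) (use gap_nonneg in \<open>auto intro!: AE_I2\<close>)
  have q0: "q \<ge> 0" unfolding q_def by simp
  have q1: "q < 1"
  proof (rule ccontr)
    assume "\<not> q < 1"
    moreover have i1: "integrable P (\<lambda>x. 1 - exp (- gap x))" using int by simp
    moreover have "AE x in P. 0 \<le> 1 - exp (- gap x)"
      using gap_nonneg by (intro AE_I2) auto
    moreover have "expectation (\<lambda>x. 1 - exp (- gap x)) = 1 - q"
      using int by (simp add: q_def prob_space)
    moreover have "0 \<le> expectation (\<lambda>x. 1 - exp (- gap x))"
      using gap_nonneg by (intro integral_nonneg_AE AE_I2) auto
    ultimately have "AE x in P. 1 - exp (- gap x) = 0"
      by (subst integral_nonneg_eq_0_iff_AE[symmetric]) auto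
    then have "expectation gap = expectation (\<lambda>x. 0)"
      by (intro integral_cong_AE) auto
    with mean_gap_pos show False by simp
  qed
  have e: "(\<integral>\<^sup>+ w. ennreal (exp (- renewal_time w n)) \<partial>Seq) = ennreal (q ^ Suc n)" for n
  proof (induction n)
    case 0
    have "(\<integral>\<^sup>+ w. ennreal (exp (- renewal_time w 0)) \<partial>Seq) = (\<integral>\<^sup>+ x. ennreal (exp (- gap x)) \<partial>distr Seq P (\<lambda>w. w 0))"
      by (subst nn_integral_distr) (auto simp: renewal_time_0)
    then show ?case using int by (simp add: distr_Seq_component nn_integral_eq_integral q_def)
  next
    case (Suc n)
    have "(\<integral>\<^sup>+ w. ennreal (exp (- renewal_time w (Suc n))) \<partial>Seq)
        = (\<integral>\<^sup>+ w. ennreal (exp (- renewal_time w (Suc n))) \<partial>distr PSeq Seq (\<lambda>p. case_nat (fst p) (snd p)))"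
      by (simp add: distr_prepend)
    also have "\<dots> = (\<integral>\<^sup>+ p. ennreal (exp (- gap (fst p))) * ennreal (exp (- renewal_time (snd p) n)) \<partial>PSeq)"
      by (subst nn_integral_distr)
        (auto simp: renewal_time_prepend exp_add[symmetric] ennreal_mult[symmetric] intro!: nn_integral_cong)
    also have "\<dots> = (\<integral>\<^sup>+ x. \<integral>\<^sup>+ w. ennreal (exp (- gap x)) * ennreal (exp (- renewal_time w n)) \<partial>Seq \<partial>P)"
      by (subst seq.P.nn_integral_fst[symmetric]) auto
    also have "\<dots> = ennreal q * ennreal (q ^ Suc n)"
      using int by (simp add: nn_integral_cmult nn_integral_multc Suc nn_integral_eq_integral q_def)
    finally show ?case using q0 by (simp add: ennreal_mult[symmetric])
  qed
  have "(\<integral>\<^sup>+ w. (\<Sum>n. ennreal (exp (- renewal_time w n))) \<partial>Seq) = (\<Sum>n. ennreal (q ^ Suc n))"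
    by (subst nn_integral_suminf) (auto simp: e)
  also have "\<dots> = ennreal (\<Sum>n. q ^ Suc n)"
    using q0 q1 by (intro suminf_ennreal2 summable_ignore_initial_segment[of _ 1, simplified]) (auto simp: summable_geometric)
  finally have "(\<integral>\<^sup>+ w. (\<Sum>n. ennreal (exp (- renewal_time w n))) \<partial>Seq) \<noteq> \<infinity>" by simp
  then have "AE w in Seq. (\<Sum>n. ennreal (exp (- renewal_time w n))) \<noteq> \<infinity>"
    by (intro nn_integral_PInf_AE) auto
  then show ?thesis
  proof eventually_elim
    case (elim w)
    then have "summable (\<lambda>n. exp (- renewal_time w n))"
      by (intro summable_suminf_not_top) auto
    then have lim: "(\<lambda>n. exp (- renewal_time w n)) \<longlonglongrightarrow> 0" by (rule summable_LIMSEQ_zero)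
    show ?case
    proof
      fix C
      have "\<forall>\<^sub>F n in sequentially. exp (- renewal_time w n) < exp (- C)"
        by (rule order_tendstoD(2)[OF lim]) simp
      then show "\<forall>\<^sub>F n in sequentially. C < renewal_time w n" by eventually_elim simp
    qed
  qed
qed

definition gap_law :: "real measure" where "gap_law = distr P borel gap"

sublocale gap: renewal_law gap_law
proof -
  interpret G: prob_space gap_law unfolding gap_law_def by (rule prob_space_distr) simp
  show "renewal_law gap_law"
  proof
    show "AE x in gap_law. x \<ge> 0"
      unfolding gap_law_def by (subst AE_distr_iff) (auto intro!: AE_I2 gap_nonneg)
    show "nonarithmetic gap_law (\<lambda>x. x)"
      unfolding nonarithmetic_def
    proof (intro allI impI notI)
      fix h :: real assume "h > 0" "AE x in gap_law. \<exists>k::int. x = h * of_int k"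
      then have "AE x in P. \<exists>k::int. gap x = h * of_int k"
        unfolding gap_law_def by (subst (asm) AE_distr_iff) auto
      with nonarithmetic_gap \<open>h > 0\<close> show False by (auto simp: nonarithmetic_def)
    qed
    show "integrable gap_law (\<lambda>x. x)"
      unfolding gap_law_def by (subst integrable_distr_eq) (auto simp: integrable_gap)
    show "(\<integral>x. x \<partial>gap_law) > 0"
      unfolding gap_law_def by (subst integral_distr) (auto simp: mean_gap_pos)
  qed (simp add: gap_law_def)
qed

lemma mean_gap_law: "(\<integral>x. x \<partial>gap_law) = expectation gap"
  unfolding gap_law_def by (subst integral_distr) auto

end

section \<open>Removing the first cluster\<close>

lemma (in prob_space) integral_tendsto_of_eventually_eq:
  fixes f :: "nat \<Rightarrow> 'a \<Rightarrow> real"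
  assumes [measurable]: "\<And>n. f n \<in> borel_measurable M" "g \<in> borel_measurable M"
    and "integrable M u" and "\<And>n. AE x in M. \<bar>f n x\<bar> \<le> u x"
    and "AE x in M. \<forall>\<^sub>F n in sequentially. f n x = g x"
  shows "(\<lambda>n. \<integral>x. f n x \<partial>M) \<longlonglongrightarrow> (\<integral>x. g x \<partial>M)"
  by (rule integral_dominated_convergence[of _ _ _ u])
    (use assms in \<open>auto elim!: eventually_mono intro: tendsto_eventually\<close>)

locale window_functional_of_renewal = mark_law P + window_functional H r B for P H r B
begin

definition shifted_value :: "real \<Rightarrow> (nat \<Rightarrow> mark) \<Rightarrow> real" where
  "shifted_value t w = H (cluster_process (\<lambda>i. renewal_time w i - t) w)"

abbreviation value_primitive :: "(nat \<Rightarrow> mark) \<Rightarrow> real \<Rightarrow> real" where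
  "value_primitive w \<equiv> primitive (\<lambda>t. shifted_value t w)"

definition shifted_mean :: "real \<Rightarrow> real" where
  "shifted_mean t = (\<integral>w. shifted_value t w \<partial>Seq)"

text \<open>
  The change of the value seen from \<open>t\<close> when the mark \<open>x\<close> is put in front of the sequence \<open>w\<close>; the
  later clusters are shifted by the gap of \<open>x\<close>.
\<close>

definition first_cluster_effect :: "mark \<Rightarrow> (nat \<Rightarrow> mark) \<Rightarrow> real \<Rightarrow> real" where
  "first_cluster_effect x w t = shifted_value t (case_nat x w) - shifted_value (t - gap x) w"

lemma B_nonneg: "B \<ge> 0"
  using H_bound[of undefined] by linarith

lemma shifted_value_bound: "\<bar>shifted_value t w\<bar> \<le> B"
  by (simp add: shifted_value_def H_bound)

lemma measurable_shifted_value [measurable]: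
  assumes [measurable]: "t \<in> borel_measurable S" "w \<in> S \<rightarrow>\<^sub>M Seq"
  shows "(\<lambda>p. shifted_value (t p) (w p)) \<in> borel_measurable S"
  unfolding shifted_value_def
  by (rule measurable_compose[OF measurable_cluster_process H_measurable]) measurable

lemma measurable_first_cluster_effect [measurable]:
  assumes [measurable]: "t \<in> borel_measurable S" "x \<in> S \<rightarrow>\<^sub>M P" "w \<in> S \<rightarrow>\<^sub>M Seq"
  shows "(\<lambda>p. first_cluster_effect (x p) (w p) (t p)) \<in> borel_measurable S"
  unfolding first_cluster_effect_def by measurable

lemma shifted_mean_bound: "\<bar>shifted_mean t\<bar> \<le> B"
  unfolding shifted_mean_def by (rule seq.P.abs_expectation_le) (auto simp: shifted_value_bound)

lemma measurable_shifted_mean [measurable]: "shifted_mean \<in> borel_measurable borel"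
  unfolding shifted_mean_def by measurable

lemma shifted_value_prepend:
  assumes "\<not> hits r (gap x - t) x"
  shows "shifted_value t (case_nat x w) = shifted_value (t - gap x) w"
proof -
  let ?w = "case_nat x w"
  have "agree_on_window r (cluster_process (\<lambda>i. renewal_time ?w i - t) ?w)
      (cluster_process (\<lambda>i. renewal_time ?w (Suc i) - t) (\<lambda>i. ?w (Suc i)))"
    by (rule agree_on_window_subfamily) (use assms in \<open>auto simp: renewal_time_0 elim: nat.exhaust split: nat.split\<close>)
  then show ?thesis
    by (auto simp: shifted_value_def renewal_time_prepend algebra_simps dest!: H_window)
qed

lemma first_cluster_effect_eq_0:
  assumes "t > gap x + r + radius x"
  shows "first_cluster_effect x w t = 0"
proof -
  have "\<not> hits r (gap x - t) x" using hits_radius[of r "gap x - t" x] assms by linarith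
  from shifted_value_prepend[OF this] show ?thesis by (simp add: first_cluster_effect_def)
qed

lemma first_cluster_effect_bound: "\<bar>first_cluster_effect x w t\<bar> \<le> 2 * B"
  using shifted_value_bound[of t "case_nat x w"] shifted_value_bound[of "t - gap x" w]
  by (simp add: first_cluster_effect_def)

text \<open>
  The integral of the effect over the positive half-line, as there is no effect after
  \<open>gap x + r + radius x\<close>.
\<close>

definition total_first_cluster_effect :: "mark \<Rightarrow> (nat \<Rightarrow> mark) \<Rightarrow> real" where
  "total_first_cluster_effect x w = primitive (first_cluster_effect x w) (gap x + r + radius x)"

lemma measurable_curried:
  assumes "w \<in> space Seq"
  shows "(\<lambda>t. shifted_value t w) \<in> borel_measurable borel"
    and "x \<in> space P \<Longrightarrow> first_cluster_effect x w \<in> borel_measurable borel"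
  using assms by measurable

lemma primitive_first_cluster_effect_cutoff:
  assumes "x \<in> space P" "w \<in> space Seq" and "t \<ge> gap x + r + radius x"
  shows "primitive (first_cluster_effect x w) t = total_first_cluster_effect x w"
proof -
  have "0 \<le> gap x + r + radius x"
    using gap_nonneg[OF assms(1)] radius_nonneg[of x] r_nonneg by simp
  with assms show ?thesis
    unfolding total_first_cluster_effect_def primitive_def
    by (intro Bochner_Integration.integral_cong)
      (auto simp: signed_interval_def indicator_def first_cluster_effect_eq_0)
qed

lemma primitive_first_cluster_effect_bound:
  assumes "x \<in> space P" "w \<in> space Seq" and "t \<ge> 0"
  shows "\<bar>primitive (first_cluster_effect x w) t\<bar> \<le> 2 * B * (gap x + r + radius x)"
proof -
  have nn: "0 \<le> gap x + r + radius x"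
    using gap_nonneg[OF assms(1)] radius_nonneg[of x] r_nonneg by simp
  note b = primitive_bound[OF measurable_curried(2)[OF assms(2,1)] first_cluster_effect_bound]
  show ?thesis
  proof (cases "t \<ge> gap x + r + radius x")
    case True
    show ?thesis
      unfolding primitive_first_cluster_effect_cutoff[OF assms(1,2) True] total_first_cluster_effect_def
      using b[of "gap x + r + radius x"] nn by simp
  next
    case False
    then have "2 * B * t \<le> 2 * B * (gap x + r + radius x)"
      using B_nonneg by (intro mult_left_mono) auto
    then show ?thesis using b[of t] assms(3) by simp
  qed
qed

abbreviation net_effect :: "real \<Rightarrow> mark \<times> (nat \<Rightarrow> mark) \<Rightarrow> real" where
  "net_effect t p \<equiv>
    primitive (first_cluster_effect (fst p) (snd p)) t - value_primitive (snd p) (- gap (fst p))"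

text \<open>
  The number \<open>c\<close> of the introduction: with \<open>Z = shifted_mean\<close> and a gap \<open>X\<close>, it is the mean of
  \<open>\<integral>\<^bsub>-X\<^esub>\<^bsup>0\<^esup> Z s ds\<close> plus the integral of \<open>Z s - E Z (s - X)\<close> over \<open>s > 0\<close>.
\<close>

definition limit_constant :: real where
  "limit_constant =
     (\<integral>p. total_first_cluster_effect (fst p) (snd p) - value_primitive (snd p) (- gap (fst p)) \<partial>PSeq)"

lemma measurable_primitives [measurable]:
  assumes [measurable]: "t \<in> borel_measurable S" "x \<in> S \<rightarrow>\<^sub>M P" "w \<in> S \<rightarrow>\<^sub>M Seq"
  shows "(\<lambda>p. value_primitive (w p) (t p)) \<in> borel_measurable S"
    and "(\<lambda>p. primitive (first_cluster_effect (x p) (w p)) (t p)) \<in> borel_measurable S"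
    and "(\<lambda>p. total_first_cluster_effect (x p) (w p)) \<in> borel_measurable S"
  unfolding total_first_cluster_effect_def by measurable

lemma space_PSeq: "p \<in> space PSeq \<longleftrightarrow> fst p \<in> space P \<and> snd p \<in> space Seq"
  by (cases p) (auto simp: space_pair_measure)

lemma primitive_shifted_value_bound: "w \<in> space Seq \<Longrightarrow> \<bar>value_primitive w t\<bar> \<le> B * \<bar>t\<bar>"
  by (rule primitive_bound[OF measurable_curried(1) shifted_value_bound])

lemma integrable_gap_PSeq: "integrable PSeq (\<lambda>p. gap (fst p))"
  and integrable_radius_PSeq: "integrable PSeq (\<lambda>p. radius (fst p))"
  using integral_PSeq_fst(2) integrable_gap integrable_radius by auto

lemma integrable_primitive_before_0: "integrable PSeq (\<lambda>p. value_primitive (snd p) (- gap (fst p)))"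
proof (rule Bochner_Integration.integrable_bound)
  show "integrable PSeq (\<lambda>p. B * gap (fst p))" using integrable_gap_PSeq by simp
  show "AE p in PSeq. norm (value_primitive (snd p) (- gap (fst p))) \<le> norm (B * gap (fst p))"
    using primitive_shifted_value_bound[of "snd p" "- gap (fst p)" for p] B_nonneg
    by (intro AE_I2) (auto simp: space_PSeq abs_mult)
qed measurable

text \<open>
  The first-mark decomposition in integrated form. It is used at deterministic times for the renewal
  theorem and at renewal times for the means over cycles.
\<close>

lemma primitive_prepend:
  assumes "x \<in> space P" "w \<in> space Seq"
  shows "value_primitive (case_nat x w) t =
    primitive (first_cluster_effect x w) t + value_primitive w (t - gap x) - value_primitive w (- gap x)"
proof -
  have c: "case_nat x w \<in> space Seq"
    using measurable_space[OF measurable_prepend, of "(x, w)"] assms by (simp add: space_pair_measure)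
  note [measurable] = measurable_curried(1)[OF assms(2)] measurable_curried(1)[OF c]
  have "primitive (first_cluster_effect x w) t =
      value_primitive (case_nat x w) t - primitive (\<lambda>t. shifted_value (t - gap x) w) t"
    unfolding first_cluster_effect_def[abs_def]
    by (rule primitive_diff[OF _ _ shifted_value_bound shifted_value_bound]) measurable
  also have "primitive (\<lambda>t. shifted_value (t - gap x) w) t =
      value_primitive w (t - gap x) - value_primitive w (- gap x)"
    by (rule primitive_translate[OF _ shifted_value_bound]) measurable
  finally show ?thesis by simp
qed

text \<open>
  The effect is eventually constant in the upper limit of integration, and it is dominated by a
  multiple of \<open>gap + r + radius\<close>. This is where the finite mean of the radius enters.
\<close>

lemma expected_effect_tendsto:
  assumes [measurable]: "\<And>n::nat. \<tau> n \<in> borel_measurable PSeq"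
    and nonneg: "\<And>n p. p \<in> space PSeq \<Longrightarrow> \<tau> n p \<ge> 0"
    and lim: "AE p in PSeq. \<forall>C. \<forall>\<^sub>F n in sequentially. C < \<tau> n p"
  shows "(\<lambda>n. \<integral>p. net_effect (\<tau> n p) p \<partial>PSeq) \<longlonglongrightarrow> limit_constant"
  unfolding limit_constant_def
proof (rule pair.P.integral_tendsto_of_eventually_eq)
  show "integrable PSeq (\<lambda>p. 2 * B * (gap (fst p) + r + radius (fst p)) + B * gap (fst p))"
    using integrable_gap_PSeq integrable_radius_PSeq by simp
  show "AE p in PSeq. \<bar>net_effect (\<tau> n p) p\<bar> \<le> 2 * B * (gap (fst p) + r + radius (fst p)) + B * gap (fst p)" for n
  proof (rule AE_I2)
    fix p assume p: "p \<in> space PSeq"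
    show "\<bar>net_effect (\<tau> n p) p\<bar> \<le> 2 * B * (gap (fst p) + r + radius (fst p)) + B * gap (fst p)"
      using primitive_first_cluster_effect_bound[of "fst p" "snd p" "\<tau> n p"] nonneg[OF p]
        primitive_shifted_value_bound[of "snd p" "- gap (fst p)"] gap_nonneg[of "fst p"] p
      by (simp add: space_PSeq)
  qed
  show "AE p in PSeq. \<forall>\<^sub>F n in sequentially.
      net_effect (\<tau> n p) p =
      total_first_cluster_effect (fst p) (snd p) - value_primitive (snd p) (- gap (fst p))"
    using lim AE_space
  proof eventually_elim
    case (elim p)
    then have "\<forall>\<^sub>F n in sequentially. gap (fst p) + r + radius (fst p) < \<tau> n p" by blast
    then show ?case
      by eventually_elim (use elim in \<open>simp add: primitive_first_cluster_effect_cutoff space_PSeq\<close>)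
  qed
qed measurable

lemma integrable_primitive_first_cluster_effect:
  assumes [measurable]: "\<tau> \<in> borel_measurable PSeq" and "\<And>p. p \<in> space PSeq \<Longrightarrow> \<tau> p \<ge> 0"
  shows "integrable PSeq (\<lambda>p. primitive (first_cluster_effect (fst p) (snd p)) (\<tau> p))"
proof (rule Bochner_Integration.integrable_bound)
  show "integrable PSeq (\<lambda>p. 2 * B * (gap (fst p) + r + radius (fst p)))"
    using integrable_gap_PSeq integrable_radius_PSeq by simp
  show "AE p in PSeq. norm (primitive (first_cluster_effect (fst p) (snd p)) (\<tau> p)) \<le> norm (2 * B * (gap (fst p) + r + radius (fst p)))"
  proof (rule AE_I2)
    fix p assume "p \<in> space PSeq"
    then show "norm (primitive (first_cluster_effect (fst p) (snd p)) (\<tau> p)) \<le> norm (2 * B * (gap (fst p) + r + radius (fst p)))"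
      using primitive_first_cluster_effect_bound[of "fst p" "snd p" "\<tau> p"] assms(2)[of p]
      unfolding real_norm_def by (simp add: space_PSeq)
  qed
qed measurable

lemma integrable_primitive_Seq:
  assumes [measurable]: "t \<in> borel_measurable Seq" and "integrable Seq t"
  shows "integrable Seq (\<lambda>w. value_primitive w (t w))"
proof (rule Bochner_Integration.integrable_bound)
  show "integrable Seq (\<lambda>w. B * \<bar>t w\<bar>)" using assms by simp
  show "AE w in Seq. norm (value_primitive w (t w)) \<le> norm (B * \<bar>t w\<bar>)"
    using primitive_shifted_value_bound B_nonneg by (intro AE_I2) (auto simp: abs_mult)
qed measurable

text \<open>
  The mean of the integral of the shifted value over the cycle of length \<open>gap (w n)\<close> that ends at the
  renewal time with number \<open>n\<close>.
\<close>

definition cycle_mean :: "nat \<Rightarrow> real" where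
  "cycle_mean n = (\<integral>w. value_primitive w (renewal_time w n)
      - value_primitive w (renewal_time w n - gap (w n)) \<partial>Seq)"

text \<open>
  Let \<open>K n\<close> be the mean of the integral from 0 to the renewal time with number \<open>n\<close>, so that cycle
  means are increments of \<open>K\<close>. After the first mark the sequence starts afresh, hence
  \<open>K (n + 1) - K n\<close> only consists of the effect of the first mark and an integral over
  \<open>[- gap, 0]\<close>.
\<close>

lemma cycle_mean_tendsto: "(\<lambda>n. cycle_mean n) \<longlonglongrightarrow> limit_constant"
proof -
  define K where "K = (\<lambda>n. \<integral>w. value_primitive w (renewal_time w n) \<partial>Seq)"
  note int = integrable_primitive_Seq[OF _ integrable_renewal_time, simplified]
  have "cycle_mean (Suc n) = K (Suc n) - K n" for n
    unfolding cycle_mean_def K_def renewal_time_Suc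
    using int[of "Suc n"] int[of n]
    by (simp add: renewal_time_Suc)
  moreover have "K (Suc n) - K n = (\<integral>p. net_effect (gap (fst p) + renewal_time (snd p) n) p \<partial>PSeq)" for n
  proof -
    have "K (Suc n) = (\<integral>p. value_primitive (case_nat (fst p) (snd p)) (gap (fst p) + renewal_time (snd p) n) \<partial>PSeq)"
      unfolding K_def by (subst integral_prepend(1)[symmetric]) (auto simp: renewal_time_prepend)
    also have "\<dots> = (\<integral>p. (net_effect (gap (fst p) + renewal_time (snd p) n) p)
        + value_primitive (snd p) (renewal_time (snd p) n) \<partial>PSeq)"
      by (intro Bochner_Integration.integral_cong) (auto simp: primitive_prepend space_PSeq)
    also have "\<dots> = (\<integral>p. net_effect (gap (fst p) + renewal_time (snd p) n) p \<partial>PSeq)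
        + (\<integral>p. value_primitive (snd p) (renewal_time (snd p) n) \<partial>PSeq)"
    proof (rule Bochner_Integration.integral_add)
      show "integrable PSeq (\<lambda>p. net_effect (gap (fst p) + renewal_time (snd p) n) p)"
        by (intro Bochner_Integration.integrable_diff integrable_primitive_first_cluster_effect integrable_primitive_before_0)
          (auto simp: space_PSeq gap_nonneg renewal_time_nonneg)
      show "integrable PSeq (\<lambda>p. value_primitive (snd p) (renewal_time (snd p) n))"
        using int[of n] by (subst integral_PSeq_snd(2)) auto
    qed
    also have "(\<integral>p. value_primitive (snd p) (renewal_time (snd p) n) \<partial>PSeq) = K n"
      unfolding K_def by (subst integral_PSeq_snd(1)[symmetric]) auto
    finally show ?thesis by simp
  qed
  moreover have "(\<lambda>n. \<integral>p. net_effect (gap (fst p) + renewal_time (snd p) n) p \<partial>PSeq) \<longlonglongrightarrow> limit_constant"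
  proof (rule expected_effect_tendsto)
    show "AE p in PSeq. \<forall>C. \<forall>\<^sub>F n in sequentially. C < gap (fst p) + renewal_time (snd p) n"
    proof -
      have "AE w in distr PSeq Seq snd. \<forall>C. \<forall>\<^sub>F n in sequentially. C < renewal_time w n"
        unfolding distr_pair_snd[OF prob_space_axioms seq.P.prob_space_axioms]
        by (rule renewal_time_tendsto_infinity)
      then have "AE p in PSeq. \<forall>C. \<forall>\<^sub>F n in sequentially. C < renewal_time (snd p) n"
        by (rule AE_distrD[rotated]) simp
      then show ?thesis using AE_space
      proof eventually_elim
        case (elim p)
        show ?case
        proof
          fix C
          have "\<forall>\<^sub>F n in sequentially. C < renewal_time (snd p) n" using elim by blast
          then show "\<forall>\<^sub>F n in sequentially. C < gap (fst p) + renewal_time (snd p) n"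
            by eventually_elim (use elim gap_nonneg[of "fst p"] in \<open>simp add: space_PSeq\<close>)
        qed
      qed
    qed
  qed (auto simp: space_PSeq gap_nonneg renewal_time_nonneg)
  ultimately have "(\<lambda>n. cycle_mean (Suc n)) \<longlonglongrightarrow> limit_constant" by simp
  then show ?thesis by (rule LIMSEQ_imp_Suc)
qed

text \<open>
  The first-mark decomposition at a fixed time \<open>t\<close> shows that the hypothesis of the renewal theorem
  holds with the same limit as for the cycle means.
\<close>

lemma averaged_shifted_mean_tendsto:
  assumes "e > 0"
  shows "((\<lambda>t. primitive shifted_mean (t + e) - primitive shifted_mean t) \<longlongrightarrow> e * limit_constant / expectation gap) at_top"
proof -
  note lip = primitive_lipschitz[OF measurable_shifted_mean shifted_mean_bound]
  have shm: "(\<integral>w. value_primitive w t \<partial>Seq) = primitive shifted_mean t" for t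
    unfolding shifted_mean_def
    by (rule seq.P.integral_primitive[OF _ shifted_value_bound]) measurable
  have eq: "(\<integral>y. primitive shifted_mean t - primitive shifted_mean (t - y) \<partial>gap_law) =
      (\<integral>p. net_effect t p \<partial>PSeq)" if "t \<ge> 0" for t
  proof -
    have i3: "integrable PSeq (\<lambda>p. value_primitive (snd p) (t - gap (fst p)))"
    proof (rule Bochner_Integration.integrable_bound)
      show "integrable PSeq (\<lambda>p. B * (\<bar>t\<bar> + gap (fst p)))" using integrable_gap_PSeq by simp
      show "AE p in PSeq. norm (value_primitive (snd p) (t - gap (fst p))) \<le> norm (B * (\<bar>t\<bar> + gap (fst p)))"
      proof (rule AE_I2)
        fix p assume p: "p \<in> space PSeq"
        have "\<bar>value_primitive (snd p) (t - gap (fst p))\<bar> \<le> B * \<bar>t - gap (fst p)\<bar>"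
          using p by (intro primitive_shifted_value_bound) (simp add: space_PSeq)
        also have "\<dots> \<le> B * (\<bar>t\<bar> + gap (fst p))"
          using p gap_nonneg[of "fst p"] B_nonneg by (intro mult_left_mono) (auto simp: space_PSeq)
        finally show "norm (value_primitive (snd p) (t - gap (fst p))) \<le> norm (B * (\<bar>t\<bar> + gap (fst p)))"
          by simp
      qed
    qed measurable
    have i1: "integrable Seq (\<lambda>w. value_primitive w t)"
      by (rule integrable_primitive_Seq) auto
    have mean_prepend: "primitive shifted_mean t = (\<integral>p. value_primitive (case_nat (fst p) (snd p)) t \<partial>PSeq)"
      unfolding shm[symmetric] by (subst integral_prepend(1)[symmetric]) auto
    have int_back: "integrable P (\<lambda>x. primitive shifted_mean (t - gap x))"
      and step_back: "(\<integral>x. primitive shifted_mean (t - gap x) \<partial>P) = (\<integral>p. value_primitive (snd p) (t - gap (fst p)) \<partial>PSeq)"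
      using pair.integrable_fst'[OF i3] pair.integral_fst'[OF i3] by (simp_all add: shm)
    have "(\<integral>y. primitive shifted_mean t - primitive shifted_mean (t - y) \<partial>gap_law) =
        (\<integral>x. primitive shifted_mean t - primitive shifted_mean (t - gap x) \<partial>P)"
      unfolding gap_law_def by (rule integral_distr) auto
    also have "\<dots> = primitive shifted_mean t - (\<integral>x. primitive shifted_mean (t - gap x) \<partial>P)"
      using int_back by (simp add: prob_space)
    also have "\<dots> =
        (\<integral>p. value_primitive (case_nat (fst p) (snd p)) t - value_primitive (snd p) (t - gap (fst p)) \<partial>PSeq)"
      unfolding step_back mean_prepend using i1 i3
      by (subst Bochner_Integration.integral_diff) (simp_all add: integral_prepend(2)[of "\<lambda>w. value_primitive w t"])
    also have "\<dots> = (\<integral>p. net_effect t p \<partial>PSeq)"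
      by (intro Bochner_Integration.integral_cong) (auto simp: primitive_prepend space_PSeq)
    finally show ?thesis .
  qed
  have "((\<lambda>t. \<integral>y. primitive shifted_mean t - primitive shifted_mean (t - y) \<partial>gap_law) \<longlongrightarrow> limit_constant) at_top"
  proof (rule tendsto_at_topI_sequentially)
    fix X :: "nat \<Rightarrow> real" assume X: "filterlim X at_top sequentially"
    define Y where "Y = (\<lambda>n. max 0 (X n))"
    have ev: "\<forall>\<^sub>F n in sequentially. Y n = X n"
      using X by (auto simp: Y_def filterlim_at_top max_def elim!: allE[of _ 0] eventually_mono)
    have Y: "\<forall>\<^sub>F n in sequentially. C < Y n" for C
    proof -
      have "\<forall>\<^sub>F n in sequentially. C < X n" using X by (simp add: filterlim_at_top_dense)
      then show ?thesis by eventually_elim (simp add: Y_def)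
    qed
    have "(\<lambda>n. \<integral>p. net_effect (Y n) p \<partial>PSeq) \<longlonglongrightarrow> limit_constant"
      by (rule expected_effect_tendsto) (use Y in \<open>auto simp: Y_def\<close>)
    then have "(\<lambda>n. \<integral>y. primitive shifted_mean (Y n) - primitive shifted_mean (Y n - y) \<partial>gap_law) \<longlonglongrightarrow> limit_constant"
      by (subst eq) (auto simp: Y_def)
    then show "(\<lambda>n. \<integral>y. primitive shifted_mean (X n) - primitive shifted_mean (X n - y) \<partial>gap_law) \<longlonglongrightarrow> limit_constant"
      by (rule Lim_transform_eventually) (use ev in \<open>auto elim!: eventually_mono\<close>)
  qed
  from gap.renewal_theorem[OF lip this assms] show ?thesis by (simp add: mean_gap_law)
qed

end

section \<open>Product laws\<close>

lemma (in prob_space) distr_indep_vars_reindex: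
  fixes X :: "'i \<Rightarrow> 'a \<Rightarrow> 'b" and f :: "'j \<Rightarrow> 'i"
  assumes ind: "indep_vars (\<lambda>_. S) X UNIV" and "inj f"
  shows "distr M (PiM UNIV (\<lambda>_. S)) (\<lambda>\<omega> j. X (f j) \<omega>) = PiM UNIV (\<lambda>j. distr M S (X (f j)))"
proof -
  have rv [measurable]: "X i \<in> M \<rightarrow>\<^sub>M S" for i using ind by (auto simp: indep_vars_def)
  have law: "distr M (PiM UNIV (\<lambda>_. S)) (\<lambda>\<omega> i. X i \<omega>) = PiM UNIV (\<lambda>i. distr M S (X i))"
    using indep_vars_iff_distr_eq_PiM'[where I = UNIV and M' = "\<lambda>_. S" and X = X] ind rv by (simp add: restrict_UNIV)
  have "(\<lambda>v j. v (f j)) \<in> PiM UNIV (\<lambda>_. S) \<rightarrow>\<^sub>M PiM UNIV (\<lambda>_. S)"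
    by (intro measurable_PiM_single') (auto simp: space_PiM PiE_iff)
  moreover have "(\<lambda>\<omega> i. X i \<omega>) \<in> M \<rightarrow>\<^sub>M PiM UNIV (\<lambda>_. S)"
    by (intro measurable_PiM_single') (use measurable_space[OF rv] in \<open>auto simp: PiE_iff\<close>)
  ultimately have "distr M (PiM UNIV (\<lambda>_. S)) (\<lambda>\<omega> j. X (f j) \<omega>)
      = distr (PiM UNIV (\<lambda>i. distr M S (X i))) (PiM UNIV (\<lambda>_. S)) (\<lambda>v j. v (f j))"
    unfolding law[symmetric] by (subst distr_distr) (auto simp: comp_def)
  also have "\<dots> = distr (PiM UNIV (\<lambda>i. distr M S (X i))) (PiM UNIV (\<lambda>j. distr M S (X (f j)))) (\<lambda>v. \<lambda>j\<in>UNIV. v (f j))"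
    by (intro distr_cong sets_PiM_cong) (auto simp: restrict_UNIV)
  also have "\<dots> = PiM UNIV (\<lambda>j. distr M S (X (f j)))"
    by (rule distr_PiM_reindex) (use \<open>inj f\<close> in \<open>auto intro: prob_space_distr\<close>)
  finally show ?thesis .
qed

text \<open>
  For \<open>g x = gap x / \<mu>\<close>, length biasing of a single mark of an independent sequence amounts to weighting
  the law of the whole sequence by the gap of this mark.
\<close>

lemma (in prob_space) PiM_density_one_coordinate:
  fixes g :: "'a \<Rightarrow> ennreal" and m :: 'i
  assumes [measurable]: "g \<in> borel_measurable M" and prob: "prob_space (density M g)"
  shows "PiM UNIV (\<lambda>i::'i. if i = m then density M g else M) = density (PiM UNIV (\<lambda>_. M)) (\<lambda>w. g (w m))"
proof -
  define Q where "Q = PiM (UNIV - {m}) (\<lambda>_::'i. M)"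
  interpret Q: prob_space Q unfolding Q_def by (intro prob_space_PiM prob_space_axioms)
  define ins where "ins = (\<lambda>p :: 'a \<times> ('i \<Rightarrow> 'a). (snd p)(m := fst p))"
  have UNIV: "insert m (UNIV - {m}) = UNIV" by auto
  have [measurable]: "ins \<in> M \<Otimes>\<^sub>M Q \<rightarrow>\<^sub>M PiM UNIV (\<lambda>_. M)"
  proof -
    have "(\<lambda>p. (snd p)(m := fst p)) \<in> M \<Otimes>\<^sub>M Q \<rightarrow>\<^sub>M PiM (insert m (UNIV - {m})) (\<lambda>_. M)"
      unfolding Q_def by (rule measurable_fun_upd[of _ "UNIV - {m}"]) auto
    then show ?thesis unfolding UNIV ins_def .
  qed
  have law: "distr (A \<Otimes>\<^sub>M Q) (PiM UNIV (\<lambda>_. M)) ins = PiM UNIV (\<lambda>i. if i = m then A else M)"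
    if "prob_space A" "sets A = sets M" for A
  proof -
    have "PiM (UNIV - {m}) (\<lambda>i. if i = m then A else M) = Q"
      unfolding Q_def by (intro PiM_cong) auto
    then have "distr (A \<Otimes>\<^sub>M Q) (PiM UNIV (\<lambda>i. if i = m then A else M)) (\<lambda>(x, X). X(m := x)) = PiM UNIV (\<lambda>i. if i = m then A else M)"
      using distr_pair_PiM_eq_PiM[of "UNIV - {m}" "\<lambda>i. if i = m then A else M" m] that prob_space_axioms
      by (simp add: UNIV)
    moreover have "sets (PiM UNIV (\<lambda>i. if i = m then A else M)) = sets (PiM UNIV (\<lambda>_. M))"
      by (intro sets_PiM_cong) (use that in auto)
    ultimately show ?thesis
      by (metis (mono_tags, lifting) distr_cong ins_def split_def)
  qed
  have "PiM UNIV (\<lambda>i::'i. if i = m then density M g else M) = distr (density M g \<Otimes>\<^sub>M Q) (PiM UNIV (\<lambda>_. M)) ins"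
    by (rule law[symmetric]) (use prob in auto)
  also have "density M g \<Otimes>\<^sub>M Q = density M g \<Otimes>\<^sub>M density Q (\<lambda>_. 1)" by (simp add: density_1)
  also have "\<dots> = density (M \<Otimes>\<^sub>M Q) (\<lambda>(x, y). g x * 1)"
    by (rule pair_measure_density) (auto simp: density_1 Q.sigma_finite_measure_axioms)
  also have "distr \<dots> (PiM UNIV (\<lambda>_. M)) ins = density (distr (M \<Otimes>\<^sub>M Q) (PiM UNIV (\<lambda>_. M)) ins) (\<lambda>w. g (w m))"
  proof -
    have "density (distr (M \<Otimes>\<^sub>M Q) (PiM UNIV (\<lambda>_. M)) ins) (\<lambda>w. g (w m))
        = distr (density (M \<Otimes>\<^sub>M Q) (\<lambda>p. g (ins p m))) (PiM UNIV (\<lambda>_. M)) ins"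
      by (rule density_distr) measurable
    moreover have "(\<lambda>p. g (ins p m)) = (\<lambda>(x, y). g x * 1)" by (auto simp: ins_def)
    ultimately show ?thesis by simp
  qed
  also have "distr (M \<Otimes>\<^sub>M Q) (PiM UNIV (\<lambda>_. M)) ins = PiM UNIV (\<lambda>_. M)"
    using law[OF prob_space_axioms] by simp
  finally show ?thesis .
qed

lemma (in prob_space) distr_pair_eq_product:
  assumes [measurable]: "X \<in> M \<rightarrow>\<^sub>M S" "Y \<in> M \<rightarrow>\<^sub>M T"
    and indep: "\<And>A B. A \<in> sets S \<Longrightarrow> B \<in> sets T \<Longrightarrow>
      prob ((X -` A \<inter> space M) \<inter> (Y -` B \<inter> space M)) = prob (X -` A \<inter> space M) * prob (Y -` B \<inter> space M)"
  shows "distr M (S \<Otimes>\<^sub>M T) (\<lambda>\<omega>. (X \<omega>, Y \<omega>)) = distr M S X \<Otimes>\<^sub>M distr M T Y"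
proof (rule pair_measure_eqI[symmetric])
  interpret X: prob_space "distr M S X" by (rule prob_space_distr) simp
  interpret Y: prob_space "distr M T Y" by (rule prob_space_distr) simp
  show "sigma_finite_measure (distr M S X)" "sigma_finite_measure (distr M T Y)" by unfold_locales
  fix A B assume "A \<in> sets (distr M S X)" "B \<in> sets (distr M T Y)"
  then have AB: "A \<in> sets S" "B \<in> sets T" by auto
  have "(\<lambda>\<omega>. (X \<omega>, Y \<omega>)) -` (A \<times> B) \<inter> space M = (X -` A \<inter> space M) \<inter> (Y -` B \<inter> space M)" by auto
  then show "emeasure (distr M S X) A * emeasure (distr M T Y) B = emeasure (distr M (S \<Otimes>\<^sub>M T) (\<lambda>\<omega>. (X \<omega>, Y \<omega>))) (A \<times> B)"
    using AB indep[OF AB] by (simp add: emeasure_distr emeasure_eq_measure ennreal_mult)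
qed (auto intro!: sets_pair_measure_cong)

section \<open>The laws of the marks\<close>

locale renewal_cluster_setting =
  M: renewal_cluster_process M W' + N: stationary_version M W' N W U
  for M :: "'a measure" and W' :: "nat \<Rightarrow> 'a \<Rightarrow> mark"
    and N :: "'b measure" and W :: "int \<Rightarrow> 'b \<Rightarrow> mark" and U :: "'b \<Rightarrow> real" +
  assumes integrable_radius: "integrable M (\<lambda>\<omega>. radius (W' 1 \<omega>))"
begin

abbreviation renewal_at :: "real \<Rightarrow> 'a \<Rightarrow> real measure" where
  "renewal_at t \<omega> \<equiv> theta_shift t (renewal_cluster W' \<omega>)"

lemma measurable_W' [measurable]: "W' i \<in> M \<rightarrow>\<^sub>M mark_space"
  using M.indep_marks by (auto simp: M.indep_vars_def)

lemma measurable_W [measurable]: "W i \<in> N \<rightarrow>\<^sub>M mark_space"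
  using N.indep_marks by (auto simp: N.indep_vars_def)

definition P :: "mark measure" where "P = distr M mark_space (W' 1)"

sublocale law: mark_law P
proof -
  interpret p: prob_space P unfolding P_def by (rule M.prob_space_distr) simp
  show "mark_law P"
  proof
    show "nonarithmetic P gap"
      unfolding nonarithmetic_def
    proof (intro allI impI notI)
      fix h :: real assume "h > 0" "AE x in P. \<exists>k::int. gap x = h * of_int k"
      then have "AE \<omega> in M. \<exists>k::int. gap (W' 1 \<omega>) = h * of_int k"
        unfolding P_def by (subst (asm) AE_distr_iff) auto
      with M.nonarithmetic_gap \<open>h > 0\<close> show False by (auto simp: nonarithmetic_def)
    qed
    show "integrable P gap" "integrable P radius"
      unfolding P_def using M.integrable_gap integrable_radius by (simp_all add: integrable_distr_eq)
    show "(\<integral>x. gap x \<partial>P) > 0"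
      unfolding P_def using M.mean_gap_pos by (simp add: integral_distr)
  qed (simp add: P_def)
qed

abbreviation \<mu> :: real where "\<mu> \<equiv> law.expectation gap"

lemma \<mu>_eq: "\<mu> = M.expectation (\<lambda>\<omega>. gap (W' 1 \<omega>))"
  unfolding P_def by (simp add: integral_distr)

lemma sets_Seq: "sets law.Seq = sets (PiM UNIV (\<lambda>_. mark_space))"
  by (intro sets_PiM_cong) auto

lemma measurable_mark_sequence:
  assumes "\<And>i. V i \<in> S \<rightarrow>\<^sub>M mark_space"
  shows "(\<lambda>\<omega> i. V i \<omega>) \<in> S \<rightarrow>\<^sub>M law.Seq"
  unfolding measurable_cong_sets[OF refl sets_Seq]
  by (intro measurable_PiM_single') (use assms measurable_space[OF assms] in \<open>auto simp: PiE_iff\<close>)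

lemma distr_later_marks: "distr M law.Seq (\<lambda>\<omega> i. W' (Suc i) \<omega>) = law.Seq"
proof -
  have "distr M law.Seq (\<lambda>\<omega> i. W' (Suc i) \<omega>) = distr M (PiM UNIV (\<lambda>_. mark_space)) (\<lambda>\<omega> i. W' (Suc i) \<omega>)"
    by (intro distr_cong sets_Seq refl)
  also have "\<dots> = PiM UNIV (\<lambda>i. distr M mark_space (W' (Suc i)))"
    by (rule M.distr_indep_vars_reindex[OF M.indep_marks]) simp
  also have "\<dots> = law.Seq"
  proof -
    have "distr M mark_space (W' (Suc i)) = P" for i
      unfolding P_def by (rule M.ident_marks) simp
    then show ?thesis by simp
  qed
  finally show ?thesis .
qed

text \<open>
  Both variables of \<open>indep_var\<close> have the same type, so the first mark is encoded as a constant
  sequence.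
\<close>

lemma indep_first_later:
  "M.indep_var law.Seq (\<lambda>\<omega> i. W' 0 \<omega>) law.Seq (\<lambda>\<omega> i. W' (Suc i) \<omega>)"
proof -
  have "M.indep_var (PiM {0} (\<lambda>_. mark_space)) (\<lambda>\<omega>. restrict (\<lambda>i. W' i \<omega>) {0})
      (PiM (range Suc) (\<lambda>_. mark_space)) (\<lambda>\<omega>. restrict (\<lambda>i. W' i \<omega>) (range Suc))"
    by (rule M.indep_var_restrict[OF M.indep_marks]) auto
  moreover have "(\<lambda>v i. v 0) \<in> PiM {0::nat} (\<lambda>_. mark_space) \<rightarrow>\<^sub>M law.Seq"
    by (rule measurable_mark_sequence) simp
  moreover have "(\<lambda>v i. v (Suc i)) \<in> PiM (range Suc) (\<lambda>_. mark_space) \<rightarrow>\<^sub>M law.Seq"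
    by (rule measurable_mark_sequence) simp
  ultimately have "M.indep_var law.Seq ((\<lambda>v i. v 0) \<circ> (\<lambda>\<omega>. restrict (\<lambda>i. W' i \<omega>) {0}))
      law.Seq ((\<lambda>v i. v (Suc i)) \<circ> (\<lambda>\<omega>. restrict (\<lambda>i. W' i \<omega>) (range Suc)))"
    by (rule M.indep_var_compose)
  then show ?thesis by (simp add: comp_def)
qed

lemma integral_first_later:
  fixes f :: "mark \<Rightarrow> (nat \<Rightarrow> mark) \<Rightarrow> real"
  assumes [measurable]: "(\<lambda>(x, w). f x w) \<in> borel_measurable (mark_space \<Otimes>\<^sub>M law.Seq)"
    and b: "\<And>x w. \<bar>f x w\<bar> \<le> C"
  shows "M.expectation (\<lambda>\<omega>. f (W' 0 \<omega>) (\<lambda>i. W' (Suc i) \<omega>)) = M.expectation (\<lambda>\<omega>. \<integral>w. f (W' 0 \<omega>) w \<partial>law.Seq)"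
proof -
  let ?Z = "\<lambda>\<omega> i. W' (Suc i) \<omega>" and ?X = "\<lambda>\<omega> (i::nat). W' 0 \<omega>"
  have [measurable]: "?Z \<in> M \<rightarrow>\<^sub>M law.Seq" "?X \<in> M \<rightarrow>\<^sub>M law.Seq"
    by (rule measurable_mark_sequence; simp)+
  interpret P0: prob_space "distr M law.Seq ?X" by (rule M.prob_space_distr) simp
  interpret pp: pair_prob_space "distr M law.Seq ?X" law.Seq ..
  have joint: "distr M (law.Seq \<Otimes>\<^sub>M law.Seq) (\<lambda>\<omega>. (?X \<omega>, ?Z \<omega>)) = distr M law.Seq ?X \<Otimes>\<^sub>M law.Seq"
    using indep_first_later unfolding M.indep_var_distribution_eq by (simp add: distr_later_marks)
  have f [measurable]: "(\<lambda>p. f (fst p 0) (snd p)) \<in> borel_measurable (law.Seq \<Otimes>\<^sub>M law.Seq)"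
  proof -
    have "(\<lambda>p. (fst p 0, snd p)) \<in> law.Seq \<Otimes>\<^sub>M law.Seq \<rightarrow>\<^sub>M mark_space \<Otimes>\<^sub>M law.Seq" by measurable
    from measurable_compose[OF this assms(1)] show ?thesis by simp
  qed
  have fm: "(\<lambda>v. \<integral>w. f (v 0) w \<partial>law.Seq) \<in> borel_measurable law.Seq"
    using f by (intro law.seq.P.borel_measurable_lebesgue_integral) (simp add: split_def)
  have "M.expectation (\<lambda>\<omega>. f (W' 0 \<omega>) (?Z \<omega>)) = (\<integral>p. f (fst p 0) (snd p) \<partial>distr M (law.Seq \<Otimes>\<^sub>M law.Seq) (\<lambda>\<omega>. (?X \<omega>, ?Z \<omega>)))"
    by (subst integral_distr) auto
  also have "\<dots> = (\<integral>v. \<integral>w. f (v 0) w \<partial>law.Seq \<partial>distr M law.Seq ?X)"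
  proof -
    have "integrable (distr M law.Seq ?X \<Otimes>\<^sub>M law.Seq) (\<lambda>p. f (fst p 0) (snd p))"
      by (rule pp.P.integrable_const_bound[of _ C]) (use b f in \<open>auto cong: measurable_cong_sets\<close>)
    from pp.integral_fst'[OF this] show ?thesis unfolding joint by simp
  qed
  also have "\<dots> = M.expectation (\<lambda>\<omega>. \<integral>w. f (W' 0 \<omega>) w \<partial>law.Seq)"
    by (subst integral_distr[OF _ fm]) auto
  finally show ?thesis .
qed

lemma distr_W_0: "distr N mark_space (W 0) = density P (\<lambda>x. ennreal (gap x / \<mu>))"
proof (rule measure_eqI)
  fix A assume "A \<in> sets (distr N mark_space (W 0))"
  then have A [measurable]: "A \<in> sets mark_space" by simp
  have \<mu>0: "\<mu> > 0" by (rule law.mean_gap_pos)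
  have "N.prob (W 0 -` A \<inter> space N) = N.expectation (\<lambda>\<omega>. (indicator A (W 0 \<omega>) :: real))"
  proof -
    have "N.expectation (\<lambda>\<omega>. (indicator A (W 0 \<omega>) :: real)) = N.expectation (indicator (W 0 -` A \<inter> space N) :: _ \<Rightarrow> real)"
      by (intro Bochner_Integration.integral_cong) (auto simp: indicator_def)
    then show ?thesis by simp
  qed
  also have "\<dots> = 1 / \<mu> * M.expectation (\<lambda>\<omega>. gap (W' 1 \<omega>) * indicator A (W' 1 \<omega>))"
    unfolding \<mu>_eq
    by (rule N.length_biased) (auto intro!: boundedI[of _ 1] simp: indicator_def)
  also have "\<dots> = (\<integral>x. indicator A x * (gap x / \<mu>) \<partial>P)"
    unfolding P_def by (subst integral_distr) (auto simp: ac_simps)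
  finally have p: "N.prob (W 0 -` A \<inter> space N) = (\<integral>x. indicator A x * (gap x / \<mu>) \<partial>P)" .
  have "emeasure (density P (\<lambda>x. ennreal (gap x / \<mu>))) A = (\<integral>\<^sup>+ x. ennreal (indicator A x * (gap x / \<mu>)) \<partial>P)"
    by (subst emeasure_density) (auto intro!: nn_integral_cong simp: indicator_def)
  also have "\<dots> = ennreal (\<integral>x. indicator A x * (gap x / \<mu>) \<partial>P)"
  proof (rule nn_integral_eq_integral)
    show "integrable P (\<lambda>x. indicator A x * (gap x / \<mu>))"
      using integrable_real_mult_indicator[of A P "\<lambda>x. gap x / \<mu>"] law.integrable_gap
      by (simp add: mult.commute)
    show "AE x in P. 0 \<le> indicator A x * (gap x / \<mu>)"
      using law.gap_nonneg \<mu>0 by (intro AE_I2) (auto simp: indicator_def)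
  qed
  finally show "emeasure (distr N mark_space (W 0)) A = emeasure (density P (\<lambda>x. ennreal (gap x / \<mu>))) A"
    unfolding p[symmetric] by (simp add: emeasure_distr N.emeasure_eq_measure)
qed simp

text \<open>
  Renumbered from \<open>- m\<close> on, the stationary times are the renewal times of the renumbered marks, seen
  from the point that divides the cycle with number \<open>m\<close> according to \<open>u\<close>. Both sides have the same
  increments and agree at the index \<open>m\<close>.
\<close>

lemma stationary_time_eq:
  "stationary_time w u (int i - int m) =
    renewal_time (\<lambda>i. w (int i - int m)) i - (renewal_time (\<lambda>i. w (int i - int m)) m - u * gap (w 0))"
proof -
  have step: "stationary_time w u (k + 1) = stationary_time w u k + gap (w (k + 1))" for k
  proof -
    consider "k \<ge> 0" | "k = -1" | "k < -1" by linarith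
    then show ?thesis
    proof cases
      case 1
      then have "{1..k + 1} = insert (k + 1) {1..k}" by auto
      with 1 show ?thesis by (simp add: stationary_time_def)
    next
      case 2
      then show ?thesis by (simp add: stationary_time_def algebra_simps)
    next
      case 3
      then have "{k + 1..-1} = insert (k + 1) {k + 1 + 1..-1}" by auto
      with 3 show ?thesis by (simp add: stationary_time_def)
    qed
  qed
  define d where "d = (\<lambda>i. stationary_time w u (int i - int m) - renewal_time (\<lambda>i. w (int i - int m)) i)"
  have "d (Suc i) = d i" for i
    using step[of "int i - int m"]
    by (simp add: d_def renewal_time_def algebra_simps)
  then have "d i = d 0" for i by (induction i) auto
  then have "d i = d m" by metis
  moreover have "stationary_time w u 0 = u * gap (w 0)" by (simp add: stationary_time_def)
  ultimately show ?thesis by (simp add: d_def)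
qed

lemma measurable_U [measurable]: "U \<in> borel_measurable N"
proof (rule measurableI)
  fix A :: "real set" assume "A \<in> sets borel"
  then show "U -` A \<inter> space N \<in> sets N"
    using N.indep_setD_ev1[OF N.indep_uniform] by blast
qed simp

lemma measurable_stationary_time [measurable]:
  "(\<lambda>\<omega>. stationary_time (\<lambda>i. W i \<omega>) (U \<omega>) i) \<in> borel_measurable N"
proof -
  show ?thesis unfolding stationary_time_def by measurable
qed

text \<open>
  The marks of the stationary version with index at least \<open>- m\<close>; the length-biased mark gets the
  number \<open>m\<close>.
\<close>

definition marks_from :: "nat \<Rightarrow> 'b \<Rightarrow> nat \<Rightarrow> mark" where
  "marks_from m \<omega> i = W (int i - int m) \<omega>"

abbreviation truncated_stationary :: "nat \<Rightarrow> 'b \<Rightarrow> real measure" where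
  "truncated_stationary m \<omega> \<equiv>
    cluster_process (\<lambda>i. stationary_time (\<lambda>i. W i \<omega>) (U \<omega>) (int i - int m)) (marks_from m \<omega>)"

lemma measurable_marks_from [measurable]: "marks_from m \<in> N \<rightarrow>\<^sub>M law.Seq"
  unfolding marks_from_def[abs_def] by (rule measurable_mark_sequence) simp

lemma \<mu>_pos: "\<mu> > 0"
  by (rule law.mean_gap_pos)

lemma distr_marks_from:
  "distr N law.Seq (marks_from m) = density law.Seq (\<lambda>w. ennreal (gap (w m) / \<mu>))"
proof -
  have "distr N law.Seq (marks_from m) = distr N (PiM UNIV (\<lambda>_. mark_space)) (\<lambda>\<omega> i. W (int i - int m) \<omega>)"
    by (intro distr_cong sets_Seq refl) (simp add: marks_from_def fun_eq_iff)
  also have "\<dots> = PiM UNIV (\<lambda>i. distr N mark_space (W (int i - int m)))"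
    by (rule N.distr_indep_vars_reindex[OF N.indep_marks]) (auto simp: inj_def)
  also have "\<dots> = PiM UNIV (\<lambda>i. if i = m then density P (\<lambda>x. ennreal (gap x / \<mu>)) else P)"
  proof (intro PiM_cong refl)
    fix i
    show "distr N mark_space (W (int i - int m)) = (if i = m then density P (\<lambda>x. ennreal (gap x / \<mu>)) else P)"
      using N.ident_marks[of "int i - int m"] by (cases "i = m") (simp_all add: distr_W_0 P_def)
  qed
  also have "\<dots> = density law.Seq (\<lambda>w. ennreal (gap (w m) / \<mu>))"
  proof (rule law.PiM_density_one_coordinate)
    show "prob_space (density P (\<lambda>x. ennreal (gap x / \<mu>)))"
      unfolding distr_W_0[symmetric] by (rule N.prob_space_distr) simp
  qed simp
  finally show ?thesis .
qed

lemma distr_U: "distr N borel U = density lborel (\<lambda>u. ennreal (indicator {0..1} u))"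
  unfolding N.uniform uniform_measure_def
  by (intro arg_cong2[where f = density] refl ext) (simp split: split_indicator)

lemma distr_U_marks_from:
  "distr N (borel \<Otimes>\<^sub>M law.Seq) (\<lambda>\<omega>. (U \<omega>, marks_from m \<omega>)) = distr N borel U \<Otimes>\<^sub>M distr N law.Seq (marks_from m)"
proof (rule N.distr_pair_eq_product)
  fix A :: "real set" and B assume A: "A \<in> sets borel" and B: "B \<in> sets law.Seq"
  define \<rho> where "\<rho> = (\<lambda>(v :: int \<Rightarrow> mark) (i :: nat). v (int i - int m))"
  have "\<rho> \<in> PiM UNIV (\<lambda>_. mark_space) \<rightarrow>\<^sub>M law.Seq"
    unfolding \<rho>_def by (rule measurable_mark_sequence) simp
  then have C: "\<rho> -` B \<inter> space (PiM UNIV (\<lambda>_. mark_space)) \<in> sets (PiM UNIV (\<lambda>_::int. mark_space))"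
    using B by (rule measurable_sets)
  have "(\<lambda>\<omega> i. W i \<omega>) \<in> N \<rightarrow>\<^sub>M PiM UNIV (\<lambda>_. mark_space)"
    by (intro measurable_PiM_single') (use measurable_space[OF measurable_W] in \<open>auto simp: PiE_iff\<close>)
  then have "marks_from m -` B \<inter> space N = (\<lambda>\<omega> i. W i \<omega>) -` (\<rho> -` B \<inter> space (PiM UNIV (\<lambda>_. mark_space))) \<inter> space N"
    by (auto simp: \<rho>_def marks_from_def[abs_def] dest: measurable_space)
  with C have "marks_from m -` B \<inter> space N \<in> {(\<lambda>\<omega> i. W i \<omega>) -` B \<inter> space N | B. B \<in> sets (PiM UNIV (\<lambda>_. mark_space))}"
    by blast
  moreover have "U -` A \<inter> space N \<in> {U -` A \<inter> space N | A. A \<in> sets borel}" using A by blast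
  ultimately show "N.prob ((U -` A \<inter> space N) \<inter> (marks_from m -` B \<inter> space N)) =
      N.prob (U -` A \<inter> space N) * N.prob (marks_from m -` B \<inter> space N)"
    by (intro N.indep_setD[OF N.indep_uniform])
qed measurable

lemma integral_U_marks_from:
  fixes f :: "real \<Rightarrow> (nat \<Rightarrow> mark) \<Rightarrow> real"
  assumes f: "(\<lambda>p. f (fst p) (snd p)) \<in> borel_measurable (borel \<Otimes>\<^sub>M law.Seq)"
    and b: "\<And>u w. \<bar>f u w\<bar> \<le> C"
  shows "N.expectation (\<lambda>\<omega>. f (U \<omega>) (marks_from m \<omega>)) =
    (\<integral>w. gap (w m) / \<mu> * (\<integral>u. indicator {0..1} u * f u w \<partial>lborel) \<partial>law.Seq)"
proof -
  note [measurable] = f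
  have U: "prob_space (distr N borel U)" by (rule N.prob_space_distr) simp
  have V: "prob_space (distr N law.Seq (marks_from m))" by (rule N.prob_space_distr) simp
  interpret U: prob_space "distr N borel U" by (rule U)
  interpret V: prob_space "distr N law.Seq (marks_from m)" by (rule V)
  interpret pp: pair_prob_space "distr N borel U" "distr N law.Seq (marks_from m)" ..
  have "N.expectation (\<lambda>\<omega>. f (U \<omega>) (marks_from m \<omega>)) =
      (\<integral>p. f (fst p) (snd p) \<partial>distr N (borel \<Otimes>\<^sub>M law.Seq) (\<lambda>\<omega>. (U \<omega>, marks_from m \<omega>)))"
    by (subst integral_distr) auto
  also have "\<dots> = (\<integral>p. f (fst p) (snd p) \<partial>(distr N borel U \<Otimes>\<^sub>M distr N law.Seq (marks_from m)))"
    by (simp add: distr_U_marks_from)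
  also have "\<dots> = (\<integral>w. \<integral>u. f u w \<partial>distr N borel U \<partial>distr N law.Seq (marks_from m))"
  proof -
    have "integrable (distr N borel U \<Otimes>\<^sub>M distr N law.Seq (marks_from m)) (\<lambda>(u, w). f u w)"
      by (rule pp.P.integrable_const_bound[of _ C]) (use b f in \<open>auto simp: split_def cong: measurable_cong_sets\<close>)
    from pp.integral_snd[OF this] show ?thesis by (simp add: split_def)
  qed
  also have "\<dots> = (\<integral>w. (\<integral>u. indicator {0..1} u * f u w \<partial>lborel) \<partial>distr N law.Seq (marks_from m))"
  proof (rule Bochner_Integration.integral_cong)
    fix w assume "w \<in> space (distr N law.Seq (marks_from m))"
    then have "(\<lambda>u. f u w) \<in> borel_measurable borel"
      using measurable_compose[OF measurable_Pair2' f, of w] by simp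
    then show "(\<integral>u. f u w \<partial>distr N borel U) = (\<integral>u. indicator {0..1} u * f u w \<partial>lborel)"
      unfolding distr_U by (subst integral_density) auto
  qed simp
  also have "\<dots> = (\<integral>w. gap (w m) / \<mu> * (\<integral>u. indicator {0..1} u * f u w \<partial>lborel) \<partial>law.Seq)"
  proof -
    have "(\<lambda>(w, u). indicator {0..1} u * f u w) \<in> borel_measurable (law.Seq \<Otimes>\<^sub>M lborel)"
      using measurable_compose[OF measurable_pair_swap' f] by (simp add: split_def)
    then have "(\<lambda>w. \<integral>u. indicator {0..1} u * f u w \<partial>lborel) \<in> borel_measurable law.Seq"
      by (rule lborel.borel_measurable_lebesgue_integral)
    moreover have "AE w in law.Seq. 0 \<le> gap (w m) / \<mu>"
      using \<mu>_pos by (intro AE_I2) (auto simp: space_PiM intro!: divide_nonneg_pos law.gap_nonneg)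
    ultimately show ?thesis
      unfolding distr_marks_from by (subst integral_density) auto
  qed
  finally show ?thesis .
qed

end

section \<open>Convergence of time averages\<close>

locale window_functional_in_setting =
  renewal_cluster_setting M W' N W U + window_functional H r B
  for M :: "'a measure" and W' :: "nat \<Rightarrow> 'a \<Rightarrow> mark"
    and N :: "'b measure" and W :: "int \<Rightarrow> 'b \<Rightarrow> mark" and U :: "'b \<Rightarrow> real"
    and H r B
begin

sublocale R: window_functional_of_renewal P H r B ..

lemma measurable_H_stationary [measurable]: "(\<lambda>\<omega>. H (stationary_cluster W U \<omega>)) \<in> borel_measurable N"
  unfolding stationary_cluster_def
  by (rule measurable_compose[OF measurable_cluster_process H_measurable]) auto

text \<open>
  The density \<open>gap (w m) / \<mu>\<close> of the length-biased law supplies the factor that turns the mean over the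
  uniform variable into an integral over the cycle. The clusters are thereby seen from a uniformly
  distributed point of an ordinary cycle of the renewal process.
\<close>

lemma truncated_stationary_mean:
  "N.expectation (\<lambda>\<omega>. H (truncated_stationary m \<omega>))
    = R.cycle_mean m / \<mu>"
proof -
  define f where "f = (\<lambda>u w. R.shifted_value (renewal_time w m - u * gap (w m)) w)"
  have f: "(\<lambda>p. f (fst p) (snd p)) \<in> borel_measurable (borel \<Otimes>\<^sub>M law.Seq)"
    unfolding f_def by measurable
  have "H (truncated_stationary m \<omega>) = f (U \<omega>) (marks_from m \<omega>)" for \<omega>
    by (simp add: f_def R.shifted_value_def stationary_time_eq marks_from_def[abs_def])
  then have "N.expectation (\<lambda>\<omega>. H (truncated_stationary m \<omega>))
      = N.expectation (\<lambda>\<omega>. f (U \<omega>) (marks_from m \<omega>))" by simp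
  also have "\<dots> = (\<integral>w. gap (w m) / \<mu> * (\<integral>u. indicator {0..1} u * f u w \<partial>lborel) \<partial>law.Seq)"
    by (rule integral_U_marks_from[OF f, where C = B]) (simp add: f_def R.shifted_value_bound)
  also have "\<dots> = (\<integral>w. (R.value_primitive w (renewal_time w m)
      - R.value_primitive w (renewal_time w m - gap (w m))) / \<mu> \<partial>law.Seq)"
  proof (rule Bochner_Integration.integral_cong)
    fix w assume w: "w \<in> space law.Seq"
    then have "gap (w m) \<ge> 0" by (auto simp: space_PiM intro!: law.gap_nonneg)
    then show "gap (w m) / \<mu> * (\<integral>u. indicator {0..1} u * f u w \<partial>lborel) =
      (R.value_primitive w (renewal_time w m)
      - R.value_primitive w (renewal_time w m - gap (w m))) / \<mu>"
      unfolding f_def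
      by (subst primitive_affine[OF R.measurable_curried(1)[OF w] R.shifted_value_bound]) auto
  qed simp
  also have "\<dots> = R.cycle_mean m / \<mu>"
    by (simp add: R.cycle_mean_def)
  finally show ?thesis .
qed

text \<open>
  Only finitely many clusters of the stationary version meet the window, so truncation at a
  sufficiently small index does not change the value.
\<close>

lemma stationary_mean_eq: "N.expectation (\<lambda>\<omega>. H (stationary_cluster W U \<omega>)) = R.limit_constant / \<mu>"
proof (rule LIMSEQ_unique)
  show "(\<lambda>m. R.cycle_mean m / \<mu>) \<longlonglongrightarrow> R.limit_constant / \<mu>"
    by (intro tendsto_divide R.cycle_mean_tendsto tendsto_const) (use \<mu>_pos in auto)
  have "(\<lambda>m. N.expectation (\<lambda>\<omega>. H (truncated_stationary m \<omega>)))
      \<longlonglongrightarrow> N.expectation (\<lambda>\<omega>. H (stationary_cluster W U \<omega>))"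
  proof (rule N.integral_tendsto_of_eventually_eq[where u = "\<lambda>_. B"])
    show "(\<lambda>\<omega>. H (truncated_stationary m \<omega>)) \<in> borel_measurable N" for m
      unfolding marks_from_def
      by (rule measurable_compose[OF measurable_cluster_process H_measurable]) auto
    show "AE \<omega> in N. \<forall>\<^sub>F m in sequentially.
        H (truncated_stationary m \<omega>) = H (stationary_cluster W U \<omega>)"
      using N.AE_locally_finite
    proof eventually_elim
      case (elim \<omega>)
      let ?\<tau> = "stationary_time (\<lambda>i. W i \<omega>) (U \<omega>)" and ?w = "\<lambda>i. W i \<omega>"
      have "emeasure (cluster_process ?\<tau> ?w) {-r..r} < \<infinity>"
        using elim unfolding locally_finite_def stationary_cluster_def by auto
      then have "bdd_below {i. hits r (?\<tau> i) (?w i)}" by (intro bdd_below_finite finite_hits)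
      then obtain b where b: "\<And>i. hits r (?\<tau> i) (?w i) \<Longrightarrow> b \<le> i"
        unfolding bdd_below_def by auto
      have "H (truncated_stationary m \<omega>) = H (stationary_cluster W U \<omega>)"
        if "m \<ge> nat (- b)" for m
      proof -
        have "agree_on_window r (cluster_process ?\<tau> ?w)
            (cluster_process (\<lambda>i::nat. ?\<tau> (int i - int m)) (\<lambda>i. ?w (int i - int m)))"
        proof (rule agree_on_window_subfamily)
          fix i assume "i \<notin> range (\<lambda>i. int i - int m)"
          moreover have "i \<in> range (\<lambda>i. int i - int m)" if "i \<ge> - int m"
            using that by (intro image_eqI[of _ _ "nat (i + int m)"]) auto
          ultimately have "i < b" using that by (cases "i < - int m") auto
          then show "\<not> hits r (?\<tau> i) (?w i)" using b by force
        qed (auto simp: inj_def)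
        then show ?thesis
          by (auto simp: stationary_cluster_def marks_from_def[abs_def] dest!: H_window)
      qed
      then show ?case unfolding eventually_sequentially by blast
    qed
  qed (auto simp: H_bound)
  then show "(\<lambda>m. R.cycle_mean m / \<mu>) \<longlonglongrightarrow> N.expectation (\<lambda>\<omega>. H (stationary_cluster W U \<omega>))"
    by (simp add: truncated_stationary_mean)
qed

definition renewal_mean :: "real \<Rightarrow> real" where
  "renewal_mean t = M.expectation (\<lambda>\<omega>. H (renewal_at t \<omega>))"

lemma renewal_cluster_value:
  "H (renewal_at t \<omega>) =
    R.shifted_value (t - gap (W' 0 \<omega>)) (\<lambda>i. W' (Suc i) \<omega>) + R.first_cluster_effect (W' 0 \<omega>) (\<lambda>i. W' (Suc i) \<omega>) t"
proof -
  have "case_nat (W' 0 \<omega>) (\<lambda>i. W' (Suc i) \<omega>) = (\<lambda>i. W' i \<omega>)"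
    by (auto simp: fun_eq_iff split: nat.split)
  then show ?thesis
    by (simp add: renewal_cluster_def theta_shift_cluster_process R.first_cluster_effect_def R.shifted_value_def)
qed

lemma measurable_renewal_value [measurable]:
  assumes [measurable]: "t \<in> borel_measurable S" "p \<in> S \<rightarrow>\<^sub>M M"
  shows "(\<lambda>x. H (theta_shift (t x) (renewal_cluster W' (p x)))) \<in> borel_measurable S"
  unfolding renewal_cluster_def theta_shift_cluster_process renewal_time_def
  by (rule measurable_compose[OF measurable_cluster_process H_measurable]) auto

lemma integrable_renewal_value: "integrable M (\<lambda>\<omega>. H (renewal_at t \<omega>))"
  by (rule M.integrable_const_bound[of _ B]) (auto simp: H_bound)

lemma measurable_renewal_mean [measurable]: "renewal_mean \<in> borel_measurable borel"
  unfolding renewal_mean_def by measurable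

lemma renewal_mean_bound: "\<bar>renewal_mean t\<bar> \<le> B"
  unfolding renewal_mean_def by (rule M.abs_expectation_le) (auto simp: H_bound)

text \<open>
  Given the delay \<open>gap (W' 0 \<omega>)\<close>, the process without its first cluster is a shifted i.i.d. cluster
  process, to which the renewal theorem applies; the delay is then integrated out. The first cluster is
  finite, hence it leaves the window as \<open>t\<close> grows.
\<close>

lemma averaged_convergence:
  assumes "e > 0"
  shows "((\<lambda>t. primitive renewal_mean (t + e) - primitive renewal_mean t)
    \<longlongrightarrow> e * N.expectation (\<lambda>\<omega>. H (stationary_cluster W U \<omega>))) at_top"
proof -
  let ?Z = "\<lambda>\<omega> i. W' (Suc i) \<omega>"
  have [measurable]: "?Z \<in> M \<rightarrow>\<^sub>M law.Seq" by (rule measurable_mark_sequence) simp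
  have [measurable]: "W' 0 \<in> M \<rightarrow>\<^sub>M P" by (simp cong: measurable_cong_sets)
  define main where "main = (\<lambda>t. M.expectation (\<lambda>\<omega>. R.shifted_mean (t - gap (W' 0 \<omega>))))"
  define err where "err = (\<lambda>t. M.expectation (\<lambda>\<omega>. R.first_cluster_effect (W' 0 \<omega>) (?Z \<omega>) t))"
  have [measurable]: "main \<in> borel_measurable borel" "err \<in> borel_measurable borel"
    unfolding main_def err_def by measurable
  have mean_eq: "renewal_mean t = main t + err t" for t
  proof -
    have "M.expectation (\<lambda>\<omega>. R.shifted_value (t - gap (W' 0 \<omega>)) (?Z \<omega>)) = main t"
      unfolding main_def R.shifted_mean_def
      by (rule integral_first_later[of "\<lambda>x w. R.shifted_value (t - gap x) w" B])
        (simp_all add: R.shifted_value_bound)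
    moreover have "integrable M (\<lambda>\<omega>. R.shifted_value (t - gap (W' 0 \<omega>)) (?Z \<omega>))"
      by (rule M.integrable_const_bound[of _ B]) (auto simp: R.shifted_value_bound)
    moreover have "integrable M (\<lambda>\<omega>. R.first_cluster_effect (W' 0 \<omega>) (?Z \<omega>) t)"
      by (rule M.integrable_const_bound[of _ "2 * B"]) (auto simp: R.first_cluster_effect_bound)
    ultimately show ?thesis by (simp add: renewal_mean_def renewal_cluster_value err_def)
  qed
  have err_bound: "\<bar>err t\<bar> \<le> 2 * B" for t
    unfolding err_def by (rule M.abs_expectation_le) (auto simp: R.first_cluster_effect_bound)
  have err_lim: "(err \<longlongrightarrow> 0) at_top"
  proof -
    have "(err \<longlongrightarrow> M.expectation (\<lambda>\<omega>. 0)) at_top"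
      unfolding err_def
    proof (rule integral_dominated_convergence_at_top[where w = "\<lambda>_. 2 * B"])
      show "AE \<omega> in M. ((\<lambda>t. R.first_cluster_effect (W' 0 \<omega>) (?Z \<omega>) t) \<longlongrightarrow> 0) at_top"
      proof (rule AE_I2)
        fix \<omega>
        have "\<forall>\<^sub>F t in at_top. R.first_cluster_effect (W' 0 \<omega>) (?Z \<omega>) t = 0"
          using eventually_gt_at_top[of "gap (W' 0 \<omega>) + r + radius (W' 0 \<omega>)"]
          by eventually_elim (rule R.first_cluster_effect_eq_0)
        then show "((\<lambda>t. R.first_cluster_effect (W' 0 \<omega>) (?Z \<omega>) t) \<longlongrightarrow> 0) at_top"
          by (rule tendsto_eventually)
      qed
    qed (auto simp: R.first_cluster_effect_bound)
    then show ?thesis by simp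
  qed
  note sm = R.measurable_shifted_mean R.shifted_mean_bound
  have main_primitive: "primitive main t = M.expectation (\<lambda>\<omega>. primitive R.shifted_mean (t - gap (W' 0 \<omega>)) - primitive R.shifted_mean (- gap (W' 0 \<omega>)))" for t
    unfolding main_def primitive_translate[OF sm, symmetric]
    by (rule M.integral_primitive[symmetric, OF _ R.shifted_mean_bound]) measurable
  have int_step: "integrable M (\<lambda>\<omega>. primitive R.shifted_mean (t - gap (W' 0 \<omega>)) - primitive R.shifted_mean (- gap (W' 0 \<omega>)))" for t
    by (rule M.integrable_const_bound[of _ "B * \<bar>t\<bar>"])
      (use primitive_lipschitz[OF sm, of "t - gap (W' 0 \<omega>)" "- gap (W' 0 \<omega>)" for \<omega>] in auto)
  have "((\<lambda>t. primitive main (t + e) - primitive main t) \<longlongrightarrow> e * (R.limit_constant / \<mu>)) at_top"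
  proof -
    have "((\<lambda>t. M.expectation (\<lambda>\<omega>. primitive R.shifted_mean (t - gap (W' 0 \<omega>) + e) - primitive R.shifted_mean (t - gap (W' 0 \<omega>))))
        \<longlongrightarrow> M.expectation (\<lambda>\<omega>. e * R.limit_constant / \<mu>)) at_top"
    proof (rule integral_dominated_convergence_at_top[where w = "\<lambda>_. B * e"])
      show "AE \<omega> in M. ((\<lambda>t. primitive R.shifted_mean (t - gap (W' 0 \<omega>) + e) - primitive R.shifted_mean (t - gap (W' 0 \<omega>)))
        \<longlongrightarrow> e * R.limit_constant / \<mu>) at_top"
        by (intro AE_I2 law.gap.tendsto_translate R.averaged_shifted_mean_tendsto assms)
      show "\<forall>\<^sub>F t in at_top. AE \<omega> in M. norm (primitive R.shifted_mean (t - gap (W' 0 \<omega>) + e) - primitive R.shifted_mean (t - gap (W' 0 \<omega>))) \<le> B * e"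
        using primitive_lipschitz[OF sm, of "t - gap (W' 0 \<omega>) + e" "t - gap (W' 0 \<omega>)" for t \<omega>] assms
        by (intro always_eventually allI AE_I2) auto
    qed auto
    moreover have "M.expectation (\<lambda>\<omega>. primitive R.shifted_mean (t - gap (W' 0 \<omega>) + e) - primitive R.shifted_mean (t - gap (W' 0 \<omega>)))
        = primitive main (t + e) - primitive main t" for t
      unfolding main_primitive
      by (subst Bochner_Integration.integral_diff[symmetric, OF int_step int_step]) (simp add: algebra_simps)
    ultimately show ?thesis by (simp add: M.prob_space)
  qed
  moreover have "((\<lambda>t. primitive err (t + e) - primitive err t) \<longlongrightarrow> 0) at_top"
  proof (rule tendstoI)
    fix d :: real assume "d > 0"
    then have "\<forall>\<^sub>F t in at_top. \<bar>err t\<bar> < d / (2 * e)"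
      using tendstoD[OF err_lim, of "d / (2 * e)"] assms by simp
    then obtain T where T: "\<And>t. t \<ge> T \<Longrightarrow> \<bar>err t\<bar> < d / (2 * e)" by (auto simp: eventually_at_top_linorder)
    show "\<forall>\<^sub>F t in at_top. dist (primitive err (t + e) - primitive err t) 0 < d"
      using eventually_ge_at_top[of T]
    proof eventually_elim
      case (elim t)
      have "\<bar>primitive err (t + e) - primitive err t - (t + e - t) * 0\<bar> \<le> (t + e - t) * (d / (2 * e))"
        by (rule primitive_average[OF _ err_bound]) (use T elim assms in \<open>auto intro!: less_imp_le\<close>)
      then show ?case using assms \<open>d > 0\<close> by simp
    qed
  qed
  ultimately have "((\<lambda>t. (primitive main (t + e) - primitive main t) + (primitive err (t + e) - primitive err t)) \<longlongrightarrow> e * (R.limit_constant / \<mu>) + 0) at_top"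
    by (rule tendsto_add)
  moreover have "primitive renewal_mean t = primitive main t + primitive err t" for t
  proof -
    have "primitive main t = primitive (\<lambda>s. renewal_mean s - err s) t" by (simp add: mean_eq)
    also have "\<dots> = primitive renewal_mean t - primitive err t"
      by (rule primitive_diff[OF _ _ renewal_mean_bound err_bound]) measurable
    finally show ?thesis by simp
  qed
  ultimately show ?thesis by (simp add: stationary_mean_eq algebra_simps)
qed

end

section \<open>Pointwise convergence for Lipschitz functionals\<close>

lemma sets_theta_shift [simp]: "sets (theta_shift t m) = sets borel"
  by (simp add: theta_shift_def)

lemma locally_finite_theta_shift:
  assumes "sets m = sets borel" "locally_finite m"
  shows "locally_finite (theta_shift t m)"
  unfolding locally_finite_def
proof (intro ballI impI)
  fix B :: "real set" assume B: "B \<in> sets borel" "bounded B"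
  have "(\<lambda>x. x + t) ` B = (\<lambda>x. x - t) -` B" by force
  then have "(\<lambda>x. x + t) ` B \<in> sets borel"
    using measurable_sets[of "\<lambda>x. x - t" borel borel B] B by simp
  moreover have "bounded ((\<lambda>x. x + t) ` B)"
    using B bounded_translation[of B t] by (simp add: add.commute)
  ultimately show "emeasure (theta_shift t m) B < \<infinity>"
    using assms B unfolding locally_finite_def by (simp add: emeasure_theta_shift)
qed

lemma integral_agree_on_window:
  fixes f :: "real \<Rightarrow> real"
  assumes [measurable]: "f \<in> borel_measurable borel" and supp: "\<And>x. \<bar>x\<bar> > r \<Longrightarrow> f x = 0"
    and agree: "agree_on_window r m m'"
  shows "(\<integral>x. f x \<partial>m) = (\<integral>x. f x \<partial>m')"
proof -
  have sets [measurable_cong]: "sets m = sets borel" "sets m' = sets borel"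
    using agree by (auto simp: agree_on_window_def)
  have "density m (\<lambda>x. ennreal (indicator {-r..r} x)) = density m' (\<lambda>x. ennreal (indicator {-r..r} x))"
  proof (rule measure_eqI)
    fix A assume "A \<in> sets (density m (\<lambda>x. ennreal (indicator {-r..r} x)))"
    then have [measurable]: "A \<in> sets borel" by (simp add: sets)
    have "emeasure (density \<nu> (\<lambda>x. ennreal (indicator {-r..r} x))) A = emeasure \<nu> ({-r..r} \<inter> A)"
      if [measurable_cong]: "sets \<nu> = sets borel" for \<nu>
    proof -
      have "emeasure (density \<nu> (\<lambda>x. ennreal (indicator {-r..r} x))) A = (\<integral>\<^sup>+ x. ennreal (indicator {-r..r} x) * indicator A x \<partial>\<nu>)"
        by (rule emeasure_density) measurable
      also have "\<dots> = (\<integral>\<^sup>+ x. indicator ({-r..r} \<inter> A) x \<partial>\<nu>)"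
        by (intro nn_integral_cong) (auto simp: indicator_def)
      finally have "emeasure (density \<nu> (\<lambda>x. ennreal (indicator {-r..r} x))) A = (\<integral>\<^sup>+ x. indicator ({-r..r} \<inter> A) x \<partial>\<nu>)" .
      then show ?thesis by simp
    qed
    then show "emeasure (density m (\<lambda>x. ennreal (indicator {-r..r} x))) A = emeasure (density m' (\<lambda>x. ennreal (indicator {-r..r} x))) A"
      using agree by (simp add: agree_on_window_def)
  qed (simp add: sets)
  moreover have "(\<integral>x. f x \<partial>\<nu>) = (\<integral>x. f x \<partial>density \<nu> (\<lambda>x. ennreal (indicator {-r..r} x)))"
    if [measurable_cong]: "sets \<nu> = sets borel" for \<nu>
  proof -
    have "indicator {-r..r} x * f x = f x" for x
      using supp[of x] by (cases "\<bar>x\<bar> > r") (auto simp: indicator_def)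
    then have "(\<integral>x. f x \<partial>\<nu>) = (\<integral>x. indicator {-r..r} x * f x \<partial>\<nu>)" by (simp only:)
    also have "\<dots> = (\<integral>x. f x \<partial>density \<nu> (\<lambda>x. ennreal (indicator {-r..r} x)))"
      by (subst integral_density) auto
    finally show ?thesis .
  qed
  ultimately show ?thesis using sets by metis
qed

lemma integrable_compact_support:
  fixes f :: "real \<Rightarrow> real"
  assumes [measurable]: "f \<in> borel_measurable borel" and b: "\<And>x. \<bar>f x\<bar> \<le> C" and s: "\<And>x. \<bar>x\<bar> > r \<Longrightarrow> f x = 0"
    and [measurable_cong]: "sets m = sets borel" and fin: "locally_finite m"
  shows "integrable m f"
proof (rule Bochner_Integration.integrable_bound)
  have "emeasure m {-r..r} < \<infinity>" using fin by (auto simp: locally_finite_def)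
  then show "integrable m (\<lambda>x. C * indicator {-r..r} x :: real)"
    by (intro integrable_mult_right integrable_real_indicator) auto
  show "AE x in m. norm (f x) \<le> norm (C * indicator {-r..r} x)"
  proof (intro AE_I2)
    fix x
    show "norm (f x) \<le> norm (C * indicator {-r..r} x)"
    proof (cases "\<bar>x\<bar> > r")
      case True
      then show ?thesis using s by simp
    next
      case False
      then have "x \<in> {-r..r}" by auto
      then show ?thesis using b[of x] by simp
    qed
  qed
qed measurable

text \<open>
  Functionals \<open>g (\<integral>f 0 dm, \<integral>f 1 dm, \<dots>)\<close>. The Lipschitz condition makes \<open>g\<close> depend on its first \<open>K\<close>
  arguments only; taking all sequences as arguments avoids types that depend on \<open>K\<close>.
\<close>

locale lipschitz_functional =
  fixes K :: nat and f :: "nat \<Rightarrow> real \<Rightarrow> real" and g :: "(nat \<Rightarrow> real) \<Rightarrow> real" and a C L B L' :: real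
  assumes a_nonneg: "a \<ge> 0"
    and f_bound: "\<And>k x. k < K \<Longrightarrow> \<bar>f k x\<bar> \<le> C"
    and f_supp: "\<And>k x. k < K \<Longrightarrow> \<bar>x\<bar> > a \<Longrightarrow> f k x = 0"
    and f_lip: "\<And>k x y. k < K \<Longrightarrow> \<bar>f k x - f k y\<bar> \<le> L * \<bar>x - y\<bar>"
    and f_meas: "\<And>k. f k \<in> borel_measurable borel"
    and g_bound: "\<And>x. \<bar>g x\<bar> \<le> B"
    and g_lip: "\<And>x y. \<bar>g x - g y\<bar> \<le> L' * (\<Sum>k<K. \<bar>x k - y k\<bar>)"
    and L_nonneg: "L \<ge> 0" "L' \<ge> 0"
begin

definition H :: "real measure \<Rightarrow> real" where
  "H m = g (\<lambda>k. \<integral>x. f k x \<partial>m)"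

lemma g_continuous: "continuous_on UNIV g"
proof -
  have "(g \<longlongrightarrow> g x) (at x)" for x
  proof (rule Lim_null[THEN iffD2], rule Lim_null_comparison)
    show "\<forall>\<^sub>F y in at x. norm (g y - g x) \<le> L' * (\<Sum>k<K. \<bar>y k - x k\<bar>)"
      using g_lip by (intro always_eventually) auto
    have "((\<lambda>y. y k) \<longlongrightarrow> x k) (at x)" for k
      using continuous_on_product_coordinates[of k] by (auto simp: continuous_on_def)
    then have "((\<lambda>y. L' * (\<Sum>k<K. \<bar>y k - x k\<bar>)) \<longlongrightarrow> L' * (\<Sum>k<K. \<bar>x k - x k\<bar>)) (at x)"
      by (intro tendsto_intros)
    then show "((\<lambda>y. L' * (\<Sum>k<K. \<bar>y k - x k\<bar>)) \<longlongrightarrow> 0) (at x)" by simp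
  qed
  then show ?thesis by (simp add: continuous_on_def)
qed

lemma g_measurable [measurable]: "g \<in> borel_measurable borel"
  by (rule borel_measurable_continuous_onI[OF g_continuous])

sublocale window_functional H a B
proof
  have "(\<lambda>m k. \<integral>x. f k x \<partial>m) \<in> borel_measurable point_meas"
    by (rule measurable_coordinatewise_then_product) (use f_meas in measurable)
  then show "H \<in> borel_measurable point_meas" unfolding H_def by measurable
  show "\<bar>H m\<bar> \<le> B" for m unfolding H_def by (rule g_bound)
  show "H m = H m'" if "agree_on_window a m m'" for m m'
  proof -
    have "(\<integral>x. f k x \<partial>m) = (\<integral>x. f k x \<partial>m')" if "k < K" for k
      by (rule integral_agree_on_window[OF f_meas f_supp \<open>agree_on_window a m m'\<close>]) (use that in auto)
    then show ?thesis
      using g_lip[of "\<lambda>k. \<integral>x. f k x \<partial>m" "\<lambda>k. \<integral>x. f k x \<partial>m'"] by (simp add: H_def)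
  qed
qed (rule a_nonneg)

lemma integrable_f: "sets m = sets borel \<Longrightarrow> locally_finite m \<Longrightarrow> k < K \<Longrightarrow> integrable m (f k)"
  by (rule integrable_compact_support[OF f_meas f_bound f_supp])

lemma H_shift_diff:
  assumes [measurable_cong]: "sets m = sets borel" and fin: "locally_finite m" and s: "0 \<le> s" "s \<le> 1"
  shows "\<bar>H m - H (theta_shift s m)\<bar> \<le> L' * (real K * (L * s * measure m {-a-1..a+1}))"
proof -
  have I: "emeasure m {-a-1..a+1} < \<infinity>" using fin by (auto simp: locally_finite_def)
  have "\<bar>(\<integral>x. f k x \<partial>m) - (\<integral>x. f k x \<partial>theta_shift s m)\<bar> \<le> L * s * measure m {-a-1..a+1}" if k: "k < K" for k
  proof -
    have eq: "(\<integral>x. f k x \<partial>theta_shift s m) = (\<integral>x. f k (x - s) \<partial>m)"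
      unfolding theta_shift_def by (rule integral_distr) (use f_meas in auto)
    have "integrable (theta_shift s m) (f k)"
      by (rule integrable_f[OF _ locally_finite_theta_shift[OF _ fin] k]) (use assms in auto)
    then have i2: "integrable m (\<lambda>x. f k (x - s))"
      unfolding theta_shift_def by (subst (asm) integrable_distr_eq) (use f_meas in auto)
    note i1 = integrable_f[OF assms(1) fin k]
    have "\<bar>(\<integral>x. f k x \<partial>m) - (\<integral>x. f k x \<partial>theta_shift s m)\<bar> = \<bar>\<integral>x. f k x - f k (x - s) \<partial>m\<bar>"
      unfolding eq using i1 i2 by simp
    also have "\<dots> \<le> (\<integral>x. \<bar>f k x - f k (x - s)\<bar> \<partial>m)" by (rule integral_abs_bound)
    also have "\<dots> \<le> (\<integral>x. L * s * indicator {-a-1..a+1} x \<partial>m)"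
    proof (rule integral_mono)
      show "integrable m (\<lambda>x. \<bar>f k x - f k (x - s)\<bar>)" using i1 i2 by simp
      show "integrable m (\<lambda>x. L * s * indicator {-a-1..a+1} x)"
        using I by (intro integrable_mult_right integrable_real_indicator) auto
      show "\<bar>f k x - f k (x - s)\<bar> \<le> L * s * indicator {-a-1..a+1} x" for x
      proof (cases "x \<in> {-a-1..a+1}")
        case True
        then show ?thesis using f_lip[OF k, of x "x - s"] s by simp
      next
        case False
        then have "f k x = 0" "f k (x - s) = 0"
          using s by (auto intro!: f_supp[OF k])
        then show ?thesis using s False by simp
      qed
    qed
    also have "\<dots> = L * s * measure m {-a-1..a+1}" by simp
    finally show ?thesis .
  qed
  then have "(\<Sum>k<K. \<bar>(\<integral>x. f k x \<partial>m) - (\<integral>x. f k x \<partial>theta_shift s m)\<bar>) \<le> (\<Sum>k<K. L * s * measure m {-a-1..a+1})"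
    by (intro sum_mono) auto
  then have "L' * (\<Sum>k<K. \<bar>(\<integral>x. f k x \<partial>m) - (\<integral>x. f k x \<partial>theta_shift s m)\<bar>) \<le> L' * (real K * (L * s * measure m {-a-1..a+1}))"
    using L_nonneg by (intro mult_left_mono) auto
  with g_lip[of "\<lambda>k. \<integral>x. f k x \<partial>m" "\<lambda>k. \<integral>x. f k x \<partial>theta_shift s m"] show ?thesis
    unfolding H_def by linarith
qed

end

text \<open>
  The functional behind tightness: its mean is small uniformly in \<open>t\<close>, for small \<open>e\<close>, if and only if
  the numbers of points in the window are tight.
\<close>

definition capped_count :: "real \<Rightarrow> real \<Rightarrow> real measure \<Rightarrow> real" where
  "capped_count r e m = enn2real (min 1 (ennreal e * emeasure m {-r..r}))"

lemma window_functional_capped_count: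
  assumes "r \<ge> 0"
  shows "window_functional (capped_count r e) r 1"
proof
  show "capped_count r e \<in> borel_measurable point_meas" unfolding capped_count_def by measurable
  have "enn2real (min 1 x) \<le> enn2real 1" for x :: ennreal
    by (rule enn2real_mono) auto
  then show "\<bar>capped_count r e m\<bar> \<le> 1" for m by (simp add: capped_count_def)
  show "capped_count r e m = capped_count r e m'" if "agree_on_window r m m'" for m m'
    using that by (simp add: agree_on_window_def capped_count_def)
qed fact

lemma capped_count_eq:
  assumes "locally_finite m" "e \<ge> 0"
  shows "capped_count r e m = min 1 (e * measure m {-r..r})"
proof -
  have "emeasure m {-r..r} < \<infinity>" using assms by (auto simp: locally_finite_def)
  then have "emeasure m {-r..r} = ennreal (measure m {-r..r})" by (intro emeasure_eq_ennreal_measure) auto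
  then have "min 1 (ennreal e * emeasure m {-r..r}) = ennreal (min 1 (e * measure m {-r..r}))"
    using assms by (simp add: ennreal_mult[symmetric] ennreal_1[symmetric] min_def del: ennreal_1)
  then show ?thesis using assms by (simp add: capped_count_def)
qed

lemma theta_shift_theta_shift:
  assumes [measurable_cong]: "sets m = sets borel"
  shows "theta_shift s (theta_shift t m) = theta_shift (t + s) m"
  unfolding theta_shift_def by (subst distr_distr) (auto simp: comp_def algebra_simps)

lemma sets_renewal_cluster [simp]: "sets (renewal_cluster W \<omega>) = sets borel"
  by (simp add: renewal_cluster_def)

lemma sets_stationary_cluster [simp]: "sets (stationary_cluster W U \<omega>) = sets borel"
  by (simp add: stationary_cluster_def)

context renewal_cluster_setting begin

lemma AE_renewal_locally_finite: "AE \<omega> in M. locally_finite (renewal_at t \<omega>)"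
  using M.AE_locally_finite by eventually_elim (simp add: locally_finite_theta_shift)

text \<open>
  For \<open>s \<le> e\<close>, the mean at time \<open>t + s\<close> differs from the mean at time \<open>t\<close> by at most \<open>D\<close> times the mean
  of the capped count of \<open>[-a - 1, a + 1]\<close> at time \<open>t\<close>, hence so does its average over \<open>[t, t + e]\<close>. The
  capped count is in turn bounded by the average over \<open>[t, t + 1]\<close> of the capped counts of the larger
  window \<open>[-a - 2, a + 2]\<close>, which converges to the corresponding mean \<open>stat e\<close> for the stationary
  version. The latter tends to 0 with \<open>e\<close> because the stationary version is locally finite.
\<close>

theorem lipschitz_functional_convergence:
  assumes "lipschitz_functional K f g a C L B L'"
  defines "H \<equiv> lipschitz_functional.H f g"
  shows "((\<lambda>t. M.expectation (\<lambda>\<omega>. H (renewal_at t \<omega>)))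
    \<longlongrightarrow> N.expectation (\<lambda>\<omega>. H (stationary_cluster W U \<omega>))) at_top"
proof -
  interpret f: lipschitz_functional K f g a C L B L' by fact
  interpret A: window_functional_in_setting M W' N W U H a B
    unfolding H_def by unfold_locales
  have B0: "B \<ge> 0" by (rule A.R.B_nonneg)
  define D where "D = max (2 * B) (L' * (real K * L))"
  have D0: "D \<ge> 0" using B0 by (simp add: D_def)
  have shift_diff: "\<bar>H m - H (theta_shift s m)\<bar> \<le> D * min 1 (e * measure m {-a-1..a+1})"
    if "sets m = sets borel" "locally_finite m" "0 \<le> s" "s \<le> e" "e \<le> 1" for m s e
  proof -
    let ?c = "measure m {-a-1..a+1}"
    have "\<bar>H m - H (theta_shift s m)\<bar> \<le> L' * (real K * (L * s * ?c))"
      unfolding H_def by (rule f.H_shift_diff) (use that in auto)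
    also have "\<dots> = (L' * (real K * L)) * (s * ?c)" by simp
    also have "\<dots> \<le> D * (e * ?c)"
      using that D0 f.L_nonneg by (intro mult_mono mult_right_mono) (auto simp: D_def)
    finally have 1: "\<bar>H m - H (theta_shift s m)\<bar> \<le> D * (e * ?c)" .
    have "\<bar>H m - H (theta_shift s m)\<bar> \<le> 2 * B" using A.H_bound[of m] A.H_bound[of "theta_shift s m"] by linarith
    also have "\<dots> \<le> D" by (simp add: D_def)
    finally show ?thesis using 1 by (simp add: min_def)
  qed
  define stat where "stat = (\<lambda>e. N.expectation (\<lambda>\<omega>. capped_count (a + 2) e (stationary_cluster W U \<omega>)))"
  let ?lim = "N.expectation (\<lambda>\<omega>. H (stationary_cluster W U \<omega>))"
  have close: "\<forall>\<^sub>F t in at_top. \<bar>A.renewal_mean t - ?lim\<bar> < D * (stat e + \<delta>) + \<delta>"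
    if e: "0 < e" "e \<le> 1" and "\<delta> > 0" for e \<delta>
  proof -
    interpret T: window_functional_in_setting M W' N W U "capped_count (a + 2) e" "a + 2" 1
    proof -
      interpret window_functional "capped_count (a + 2) e" "a + 2" 1
        by (rule window_functional_capped_count) (use f.a_nonneg in simp)
      show "window_functional_in_setting M W' N W U (capped_count (a + 2) e) (a + 2) 1" by unfold_locales
    qed
    interpret T': window_functional_in_setting M W' N W U "capped_count (a + 1) e" "a + 1" 1
    proof -
      interpret window_functional "capped_count (a + 1) e" "a + 1" 1
        by (rule window_functional_capped_count) (use f.a_nonneg in simp)
      show "window_functional_in_setting M W' N W U (capped_count (a + 1) e) (a + 1) 1" by unfold_locales
    qed
    have T_le: "T'.renewal_mean t \<le> T.renewal_mean (t + s)" if s: "0 \<le> s" "s \<le> 1" for t s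
      unfolding T.renewal_mean_def T'.renewal_mean_def
    proof (rule integral_mono_AE[OF T'.integrable_renewal_value T.integrable_renewal_value])
      show "AE \<omega> in M. capped_count (a + 1) e (renewal_at t \<omega>)
          \<le> capped_count (a + 2) e (renewal_at (t + s) \<omega>)"
      proof (rule AE_I2)
        fix \<omega>
        let ?m = "renewal_at t \<omega>"
        have "emeasure ?m {-(a+1)..a+1} \<le> emeasure ?m ((\<lambda>x. x + s) ` {-(a+2)..a+2})"
        proof (rule emeasure_mono)
          have eq: "(\<lambda>x. x + s) ` {-(a+2)..a+2} = {-(a+2)+s..a+2+s}"
            by (simp add: image_add_atLeastAtMost')
          show "{-(a+1)..a+1} \<subseteq> (\<lambda>x. x + s) ` {-(a+2)..a+2}" unfolding eq using s by auto
          show "(\<lambda>x. x + s) ` {-(a+2)..a+2} \<in> sets ?m" unfolding eq by simp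
        qed
        also have "\<dots> = emeasure (theta_shift s ?m) {-(a+2)..a+2}" by (simp add: emeasure_theta_shift)
        finally have le: "emeasure ?m {-(a+1)..a+1} \<le> emeasure (renewal_at (t + s) \<omega>) {-(a+2)..a+2}"
          by (simp add: theta_shift_theta_shift)
        show "capped_count (a + 1) e ?m \<le> capped_count (a + 2) e (renewal_at (t + s) \<omega>)"
          unfolding capped_count_def
          by (intro enn2real_mono min.mono mult_left_mono le) (auto simp: min_less_iff_disj)
      qed
    qed
    have T_avg: "T'.renewal_mean t \<le> primitive T.renewal_mean (t + 1) - primitive T.renewal_mean t" for t
    proof -
      let ?c = "T'.renewal_mean t" and ?f = "T.renewal_mean"
      have "primitive (\<lambda>_. ?c) (t + 1) - primitive (\<lambda>_. ?c) t = ?c"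
        by (subst primitive_diff_eq[of _ "\<bar>?c\<bar>"]) (auto simp: integral_signed_interval_const)
      moreover have pc: "primitive (\<lambda>_. ?c) (t + 1) - primitive (\<lambda>_. ?c) t = (\<integral>s. signed_interval t (t + 1) s * ?c \<partial>lborel)"
        by (rule primitive_diff_eq[of _ "\<bar>?c\<bar>"]) auto
      moreover have "primitive (\<lambda>_. ?c) (t + 1) - primitive (\<lambda>_. ?c) t \<le> primitive ?f (t + 1) - primitive ?f t"
        unfolding primitive_diff_eq[OF T.measurable_renewal_mean T.renewal_mean_bound] pc
      proof (rule integral_mono)
        show "integrable lborel (\<lambda>s. signed_interval t (t + 1) s * ?c)"
          by (rule integrable_signed_interval[of _ "\<bar>?c\<bar>"]) auto
        show "integrable lborel (\<lambda>s. signed_interval t (t + 1) s * ?f s)"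
          by (rule integrable_signed_interval[OF T.measurable_renewal_mean T.renewal_mean_bound])
        show "signed_interval t (t + 1) s * ?c \<le> signed_interval t (t + 1) s * ?f s" for s
          using T_le[of "s - t" t] by (auto simp: signed_interval_def indicator_def)
      qed
      ultimately show ?thesis by linarith
    qed
    have diff: "\<bar>A.renewal_mean (t + s) - A.renewal_mean t\<bar> \<le> D * T'.renewal_mean t" if s: "0 \<le> s" "s \<le> e" for t s
    proof -
      have "\<bar>A.renewal_mean (t + s) - A.renewal_mean t\<bar> =
          \<bar>M.expectation (\<lambda>\<omega>. H (renewal_at (t + s) \<omega>) - H (renewal_at t \<omega>))\<bar>"
        unfolding A.renewal_mean_def using A.integrable_renewal_value by simp
      also have "\<dots> \<le> M.expectation (\<lambda>\<omega>. \<bar>H (renewal_at (t + s) \<omega>) - H (renewal_at t \<omega>)\<bar>)"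
        by (rule integral_abs_bound)
      also have "\<dots> \<le> M.expectation (\<lambda>\<omega>. D * capped_count (a + 1) e (renewal_at t \<omega>))"
      proof (rule integral_mono_AE)
        show "AE \<omega> in M. \<bar>H (renewal_at (t + s) \<omega>) - H (renewal_at t \<omega>)\<bar>
            \<le> D * capped_count (a + 1) e (renewal_at t \<omega>)"
          using AE_renewal_locally_finite[of t]
        proof eventually_elim
          case (elim \<omega>)
          let ?m = "renewal_at t \<omega>"
          have "\<bar>H ?m - H (theta_shift s ?m)\<bar> \<le> D * min 1 (e * measure ?m {-a-1..a+1})"
            by (rule shift_diff) (use elim s e in auto)
          then show ?case
            using elim e by (simp add: theta_shift_theta_shift capped_count_eq abs_minus_commute)
        qed
      qed (use A.integrable_renewal_value T'.integrable_renewal_value in auto)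
      finally show ?thesis by (simp add: T'.renewal_mean_def)
    qed
    have "((\<lambda>t. (primitive A.renewal_mean (t + e) - primitive A.renewal_mean t) / e) \<longlongrightarrow> e * ?lim / e) at_top"
      by (intro tendsto_divide A.averaged_convergence e) (use e in auto)
    then have "\<forall>\<^sub>F t in at_top. \<bar>(primitive A.renewal_mean (t + e) - primitive A.renewal_mean t) / e - ?lim\<bar> < \<delta>"
      using e \<open>\<delta> > 0\<close> by (auto dest!: tendstoD[of _ _ _ \<delta>] simp: dist_real_def)
    moreover have "\<forall>\<^sub>F t in at_top. primitive T.renewal_mean (t + 1) - primitive T.renewal_mean t < stat e + \<delta>"
      using T.averaged_convergence[of 1] \<open>\<delta> > 0\<close> unfolding stat_def
      by (intro order_tendstoD(2)) auto
    ultimately show ?thesis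
    proof eventually_elim
      case (elim t)
      have "\<bar>primitive A.renewal_mean (t + e) - primitive A.renewal_mean t - (t + e - t) * A.renewal_mean t\<bar> \<le> (t + e - t) * (D * T'.renewal_mean t)"
      proof (rule primitive_average[OF A.measurable_renewal_mean A.renewal_mean_bound])
        fix s assume "t < s" "s \<le> t + e"
        then show "\<bar>A.renewal_mean s - A.renewal_mean t\<bar> \<le> D * T'.renewal_mean t"
          using diff[of "s - t" t] by simp
      qed (use e in auto)
      then have "\<bar>(primitive A.renewal_mean (t + e) - primitive A.renewal_mean t) / e - A.renewal_mean t\<bar> \<le> D * T'.renewal_mean t"
        using e by (simp add: abs_le_iff field_simps)
      also have "\<dots> \<le> D * (stat e + \<delta>)"
        using elim T_avg[of t] D0 by (intro mult_left_mono) auto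
      finally show ?case using elim by linarith
    qed
  qed
  have stat_lim: "(\<lambda>n. stat (1 / real (Suc n))) \<longlonglongrightarrow> 0"
  proof -
    have "(\<lambda>n. stat (1 / real (Suc n))) \<longlonglongrightarrow> N.expectation (\<lambda>\<omega>. 0)"
      unfolding stat_def
    proof (rule integral_dominated_convergence[where w = "\<lambda>_. 1"])
      fix n
      interpret T: window_functional "capped_count (a + 2) (1 / real (Suc n))" "a + 2" 1
        by (rule window_functional_capped_count) (use f.a_nonneg in simp)
      interpret T: window_functional_in_setting M W' N W U "capped_count (a + 2) (1 / real (Suc n))" "a + 2" 1
        by unfold_locales
      show "(\<lambda>\<omega>. capped_count (a + 2) (1 / real (Suc n)) (stationary_cluster W U \<omega>)) \<in> borel_measurable N"
        by (rule T.measurable_H_stationary)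
      show "AE \<omega> in N. norm (capped_count (a + 2) (1 / real (Suc n)) (stationary_cluster W U \<omega>)) \<le> 1"
        using T.H_bound by simp
    next
      show "AE \<omega> in N. (\<lambda>n. capped_count (a + 2) (1 / real (Suc n)) (stationary_cluster W U \<omega>)) \<longlonglongrightarrow> 0"
        using N.AE_locally_finite
      proof eventually_elim
        case (elim \<omega>)
        let ?c = "measure (stationary_cluster W U \<omega>) {-(a+2)..a+2}"
        have "(\<lambda>n. min 1 (1 / real (Suc n) * ?c)) \<longlonglongrightarrow> min 1 (0 * ?c)"
          by (intro tendsto_intros LIMSEQ_Suc lim_1_over_n)
        then show ?case using elim by (simp add: capped_count_eq)
      qed
    qed auto
    then show ?thesis by simp
  qed
  have "(A.renewal_mean \<longlongrightarrow> ?lim) at_top"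
  proof (rule tendstoI)
    fix \<eta> :: real assume "\<eta> > 0"
    define \<delta> where "\<delta> = \<eta> / (2 * D + 1)"
    have "\<delta> > 0" using D0 \<open>\<eta> > 0\<close> by (simp add: \<delta>_def)
    have "\<forall>\<^sub>F n in sequentially. stat (1 / real (Suc n)) < \<delta>"
      by (rule order_tendstoD(2)[OF stat_lim \<open>\<delta> > 0\<close>])
    then obtain n where n: "stat (1 / real (Suc n)) < \<delta>"
      unfolding eventually_sequentially by blast
    have "\<forall>\<^sub>F t in at_top. \<bar>A.renewal_mean t - ?lim\<bar> < D * (stat (1 / real (Suc n)) + \<delta>) + \<delta>"
      by (rule close) (use \<open>\<delta> > 0\<close> in auto)
    then show "\<forall>\<^sub>F t in at_top. dist (A.renewal_mean t) ?lim < \<eta>"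
    proof eventually_elim
      case (elim t)
      have "D * (stat (1 / real (Suc n)) + \<delta>) \<le> D * (2 * \<delta>)" using n D0 by (intro mult_left_mono) auto
      moreover have "D * (2 * \<delta>) + \<delta> = \<eta>"
      proof -
        have "\<delta> * (2 * D + 1) = \<eta>" using D0 by (simp add: \<delta>_def)
        then show ?thesis by (simp add: algebra_simps)
      qed
      ultimately show ?case using elim by (simp add: dist_real_def)
    qed
  qed
  then show ?thesis by (simp add: A.renewal_mean_def[abs_def])
qed

end

section \<open>Countably many integrals determine the vague topology\<close>

definition bump :: "nat \<Rightarrow> real \<Rightarrow> real" where
  "bump n x = max 0 (min 1 (real n + 1 - \<bar>x\<bar>))"

text \<open>
  The functions \<open>x ^ j * bump n x\<close>, enumerated by \<open>k = prod_encode (j, n)\<close>.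
\<close>

definition basic_test :: "nat \<Rightarrow> real \<Rightarrow> real" where
  "basic_test k x = x ^ fst (prod_decode k) * bump (snd (prod_decode k)) x"

definition basic_integral :: "nat \<Rightarrow> real measure \<Rightarrow> real" where
  "basic_integral k m = (\<integral>x. basic_test k x \<partial>m)"

lemma basic_test_encode: "basic_test (prod_encode (j, n)) x = x ^ j * bump n x"
  by (simp add: basic_test_def)

lemma bump_bounds: "0 \<le> bump n x" "bump n x \<le> 1"
  by (auto simp: bump_def)

lemma bump_eq_0: "\<bar>x\<bar> \<ge> real n + 1 \<Longrightarrow> bump n x = 0"
  by (auto simp: bump_def)

lemma bump_eq_1: "\<bar>x\<bar> \<le> real n \<Longrightarrow> bump n x = 1"
  by (auto simp: bump_def)

lemma bump_lipschitz: "\<bar>bump n x - bump n y\<bar> \<le> \<bar>x - y\<bar>"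
proof -
  have "\<bar>max 0 (min 1 p) - max 0 (min 1 q)\<bar> \<le> \<bar>p - q\<bar>" for p q :: real
    by (auto simp: max_def min_def)
  then have "\<bar>bump n x - bump n y\<bar> \<le> \<bar>(real n + 1 - \<bar>x\<bar>) - (real n + 1 - \<bar>y\<bar>)\<bar>"
    unfolding bump_def .
  also have "\<dots> = \<bar>\<bar>y\<bar> - \<bar>x\<bar>\<bar>" by simp
  also have "\<dots> \<le> \<bar>y - x\<bar>" by (rule abs_triangle_ineq3)
  finally show ?thesis by (simp add: abs_minus_commute)
qed

lemma basic_test_measurable [measurable]: "basic_test k \<in> borel_measurable borel"
  unfolding basic_test_def[abs_def] bump_def[abs_def] by measurable

lemma lipschitz_bounded_mult:
  fixes u v :: "real \<Rightarrow> real"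
  assumes "\<exists>C L. \<forall>x y. \<bar>u x\<bar> \<le> C \<and> \<bar>u x - u y\<bar> \<le> L * \<bar>x - y\<bar>"
    and "\<exists>C L. \<forall>x y. \<bar>v x\<bar> \<le> C \<and> \<bar>v x - v y\<bar> \<le> L * \<bar>x - y\<bar>"
  shows "\<exists>C L. \<forall>x y. \<bar>u x * v x\<bar> \<le> C \<and> \<bar>u x * v x - u y * v y\<bar> \<le> L * \<bar>x - y\<bar>"
proof -
  obtain C L where u: "\<And>x. \<bar>u x\<bar> \<le> C" "\<And>x y. \<bar>u x - u y\<bar> \<le> L * \<bar>x - y\<bar>" using assms(1) by blast
  obtain C' L' where v: "\<And>x. \<bar>v x\<bar> \<le> C'" "\<And>x y. \<bar>v x - v y\<bar> \<le> L' * \<bar>x - y\<bar>" using assms(2) by blast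
  have C: "C \<ge> 0" "C' \<ge> 0" using u(1)[of 0] v(1)[of 0] by linarith+
  have "\<bar>u x * v x\<bar> \<le> C * C'" for x
    unfolding abs_mult by (intro mult_mono u v) (use C in auto)
  moreover have "\<bar>u x * v x - u y * v y\<bar> \<le> (C * L' + C' * L) * \<bar>x - y\<bar>" for x y
  proof -
    have "u x * v x - u y * v y = u x * (v x - v y) + v y * (u x - u y)" by (simp add: algebra_simps)
    then have "\<bar>u x * v x - u y * v y\<bar> \<le> \<bar>u x\<bar> * \<bar>v x - v y\<bar> + \<bar>v y\<bar> * \<bar>u x - u y\<bar>"
      by (metis abs_mult abs_triangle_ineq)
    also have "\<dots> \<le> C * (L' * \<bar>x - y\<bar>) + C' * (L * \<bar>x - y\<bar>)"
      by (intro add_mono mult_mono u v) (use C in auto)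
    finally show ?thesis by (simp add: algebra_simps)
  qed
  ultimately show ?thesis by blast
qed

text \<open>
  Outside the support of the bump the factor \<open>x ^ j\<close> may be replaced by a power of the truncated
  argument \<open>clip x\<close>, and products of bounded Lipschitz functions are bounded and Lipschitz.
\<close>

lemma basic_test_lipschitz_bounded:
  "\<exists>C L. \<forall>x y. \<bar>basic_test k x\<bar> \<le> C \<and> \<bar>basic_test k x - basic_test k y\<bar> \<le> L * \<bar>x - y\<bar>"
proof -
  obtain j n where k: "k = prod_encode (j, n)" by (metis prod_decode_inverse surj_pair)
  define clip where "clip = (\<lambda>x. max (- (real n + 1)) (min (real n + 1) x))"
  have clip: "\<exists>C L. \<forall>x y. \<bar>clip x\<bar> \<le> C \<and> \<bar>clip x - clip y\<bar> \<le> L * \<bar>x - y\<bar>"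
    by (rule exI[of _ "real n + 1"], rule exI[of _ 1]) (auto simp: clip_def max_def min_def)
  have "\<exists>C L. \<forall>x y. \<bar>clip x ^ j\<bar> \<le> C \<and> \<bar>clip x ^ j - clip y ^ j\<bar> \<le> L * \<bar>x - y\<bar>"
  proof (induction j)
    case 0
    show ?case by (rule exI[of _ 1], rule exI[of _ 0]) simp
  next
    case (Suc j)
    show ?case unfolding power_Suc by (rule lipschitz_bounded_mult[OF clip Suc])
  qed
  moreover have "\<exists>C L. \<forall>x y. \<bar>bump n x\<bar> \<le> C \<and> \<bar>bump n x - bump n y\<bar> \<le> L * \<bar>x - y\<bar>"
    by (rule exI[of _ 1], rule exI[of _ 1]) (use bump_bounds bump_lipschitz in auto)
  ultimately have "\<exists>C L. \<forall>x y. \<bar>clip x ^ j * bump n x\<bar> \<le> C \<and>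
      \<bar>clip x ^ j * bump n x - clip y ^ j * bump n y\<bar> \<le> L * \<bar>x - y\<bar>"
    by (rule lipschitz_bounded_mult)
  moreover have "clip x ^ j * bump n x = basic_test k x" for x
  proof (cases "\<bar>x\<bar> \<ge> real n + 1")
    case True
    then show ?thesis by (simp add: k basic_test_encode bump_eq_0)
  next
    case False
    then have "clip x = x" by (auto simp: clip_def)
    then show ?thesis by (simp add: k basic_test_encode)
  qed
  ultimately show ?thesis by simp
qed

lemma basic_test_supp: "\<bar>x\<bar> > real (snd (prod_decode k)) + 1 \<Longrightarrow> basic_test k x = 0"
  by (simp add: basic_test_def bump_eq_0)

lemma basic_lipschitz_functional:
  assumes "\<And>x. \<bar>g x\<bar> \<le> B" "\<And>x y. \<bar>g x - g y\<bar> \<le> L' * (\<Sum>k<K. \<bar>x k - y k\<bar>)" "L' \<ge> 0"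
  shows "\<exists>a C L. lipschitz_functional K basic_test g a C L B L'"
proof -
  obtain C L where CL: "\<And>k x y. \<bar>basic_test k x\<bar> \<le> C k \<and> \<bar>basic_test k x - basic_test k y\<bar> \<le> L k * \<bar>x - y\<bar>"
    using basic_test_lipschitz_bounded by metis
  have C0: "C k \<ge> 0" for k using CL[of k 0] abs_ge_zero order_trans by blast
  have L0: "L k \<ge> 0" for k using order_trans[OF abs_ge_zero conjunct2[OF CL[of k 1 0]]] by simp
  define a where "a = (\<Sum>k<K. real (snd (prod_decode k)) + 1)"
  have "lipschitz_functional K basic_test g a (\<Sum>k<K. C k) (\<Sum>k<K. L k) B L'"
  proof
    show "a \<ge> 0" unfolding a_def by (intro sum_nonneg) auto
    show "0 \<le> (\<Sum>k<K. L k)" by (intro sum_nonneg L0)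
    fix k assume k: "k < K"
    show "\<bar>basic_test k x\<bar> \<le> (\<Sum>k<K. C k)" for x
      using CL[of k x] member_le_sum[of k "{..<K}" C] k C0 by fastforce
    have "real (snd (prod_decode k)) + 1 \<le> a"
      unfolding a_def using k by (intro member_le_sum[of k "{..<K}"]) auto
    then show "basic_test k x = 0" if "\<bar>x\<bar> > a" for x
      using that by (intro basic_test_supp) simp
    show "\<bar>basic_test k x - basic_test k y\<bar> \<le> (\<Sum>k<K. L k) * \<bar>x - y\<bar>" for x y
    proof -
      have "\<bar>basic_test k x - basic_test k y\<bar> \<le> L k * \<bar>x - y\<bar>" using CL by blast
      also have "\<dots> \<le> (\<Sum>k<K. L k) * \<bar>x - y\<bar>"
        using k L0 by (intro mult_right_mono member_le_sum) auto
      finally show ?thesis .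
    qed
  qed (use assms in auto)
  then show ?thesis by blast
qed

lemma Mp_D: "m \<in> Mp \<Longrightarrow> sets m = sets borel" "m \<in> Mp \<Longrightarrow> locally_finite m"
  by (auto simp: Mp_def dirac_sum_def)

lemma integrable_basic_test:
  assumes "m \<in> Mp"
  shows "integrable m (basic_test k)"
proof -
  obtain C where "\<And>x. \<bar>basic_test k x\<bar> \<le> C" using basic_test_lipschitz_bounded[of k] by blast
  then show ?thesis
    using Mp_D[OF assms] basic_test_supp by (intro integrable_compact_support) auto
qed

lemma test_function_support:
  assumes "f \<in> test_functions"
  obtains n :: nat where "\<And>x. \<bar>x\<bar> > real n \<Longrightarrow> f x = 0"
proof -
  obtain b where b: "\<And>x. f x \<noteq> 0 \<Longrightarrow> \<bar>x\<bar> \<le> b"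
    using assms by (auto simp: test_functions_def bounded_iff)
  obtain n :: nat where "b \<le> real n" using real_arch_simple by blast
  with b have "f x = 0" if "\<bar>x\<bar> > real n" for x using that by force
  then show thesis using that by blast
qed

text \<open>
  A polynomial approximation of \<open>f\<close> on the support of the bump is multiplied by the bump. The error is
  then at most a multiple of the bump itself, whose integral is one of the basic integrals.
\<close>

lemma test_function_approx:
  assumes f: "continuous_on UNIV f" and supp: "\<And>x. \<bar>x\<bar> > real n \<Longrightarrow> f x = 0" and "\<epsilon> > 0"
  obtains d :: nat and a :: "nat \<Rightarrow> real"
  where "\<And>x. \<bar>f x - (\<Sum>i\<le>d. a i * basic_test (prod_encode (i, n)) x)\<bar> \<le> \<epsilon> * bump n x"
proof -
  obtain p where p: "real_polynomial_function p" "\<And>x. x \<in> {- (real n + 1)..real n + 1} \<Longrightarrow> \<bar>f x - p x\<bar> < \<epsilon>"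
    using Stone_Weierstrass_real_polynomial_function[of "{- (real n + 1)..real n + 1}" f \<epsilon>] f \<open>\<epsilon> > 0\<close>
    by (metis compact_Icc continuous_on_subset subset_UNIV)
  obtain a d where pa: "p = (\<lambda>x. \<Sum>i\<le>d. a i * x ^ i)"
    using p(1) by (auto simp: real_polynomial_function_iff_sum)
  have "\<bar>f x - (\<Sum>i\<le>d. a i * basic_test (prod_encode (i, n)) x)\<bar> \<le> \<epsilon> * bump n x" for x
  proof -
    have "(\<Sum>i\<le>d. a i * basic_test (prod_encode (i, n)) x) = p x * bump n x"
      by (simp add: pa basic_test_encode sum_distrib_right mult.assoc)
    moreover have "\<bar>f x - p x * bump n x\<bar> \<le> \<epsilon> * bump n x"
    proof (cases "\<bar>x\<bar> \<le> real n + 1")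
      case True
      have "f x = f x * bump n x"
        using supp[of x] bump_eq_1[of x n] by (cases "\<bar>x\<bar> \<le> real n") auto
      then have "\<bar>f x - p x * bump n x\<bar> = \<bar>f x - p x\<bar> * bump n x"
        by (metis abs_mult abs_of_nonneg bump_bounds(1) left_diff_distrib)
      also have "\<dots> \<le> \<epsilon> * bump n x"
      proof -
        have "x \<in> {- (real n + 1)..real n + 1}" using True by (simp add: abs_le_iff)
        then show ?thesis by (intro mult_right_mono bump_bounds less_imp_le p(2))
      qed
      finally show ?thesis .
    next
      case False
      then show ?thesis using supp[of x] by (simp add: bump_eq_0)
    qed
    ultimately show ?thesis by simp
  qed
  then show thesis using that by blast
qed

text \<open>
  Finitely many basic integrals suffice to describe neighbourhoods. For a subbasic set given by \<open>f\<close>, a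
  linear combination of basic integrals approximates \<open>\<integral>f dm'\<close> up to \<open>\<epsilon>\<close> times the integral of a bump;
  control of this latter integral makes the approximation uniform in a neighbourhood.
\<close>

lemma vague_open_box:
  assumes "openin vague O'" "m \<in> O'"
  shows "\<exists>J::nat. \<exists>\<delta>>0. \<forall>m'\<in>Mp. (\<forall>k<J. \<bar>basic_integral k m' - basic_integral k m\<bar> < \<delta>) \<longrightarrow> m' \<in> O'"
proof -
  have "generate_topology_on {{m \<in> Mp. (\<integral>x. f x \<partial>m) \<in> V} | f V. f \<in> test_functions \<and> open V} O'"
    using assms(1) unfolding vague_def by (rule openin_topology_generated_by)
  then show ?thesis using assms(2)
  proof (induction arbitrary: m)
    case Empty
    then show ?case by simp
  next
    case (Int A B)
    obtain J \<delta> where A: "\<delta> > 0" "\<And>m'. m' \<in> Mp \<Longrightarrow> (\<And>k. k < J \<Longrightarrow> \<bar>basic_integral k m' - basic_integral k m\<bar> < \<delta>) \<Longrightarrow> m' \<in> A"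
      using Int.IH(1)[of m] Int.prems by blast
    obtain J' \<delta>' where B: "\<delta>' > 0" "\<And>m'. m' \<in> Mp \<Longrightarrow> (\<And>k. k < J' \<Longrightarrow> \<bar>basic_integral k m' - basic_integral k m\<bar> < \<delta>') \<Longrightarrow> m' \<in> B"
      using Int.IH(2)[of m] Int.prems by blast
    show ?case
    proof (rule exI[of _ "max J J'"], rule exI[of _ "min \<delta> \<delta>'"], intro conjI ballI impI)
      fix m' assume m': "m' \<in> Mp" "\<forall>k<max J J'. \<bar>basic_integral k m' - basic_integral k m\<bar> < min \<delta> \<delta>'"
      then show "m' \<in> A \<inter> B" using A(2)[OF m'(1)] B(2)[OF m'(1)] by simp
    qed (use A B in auto)
  next
    case (UN \<K>)
    then obtain k where "k \<in> \<K>" "m \<in> k" by blast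
    from UN.IH[OF this] \<open>k \<in> \<K>\<close> show ?case by (meson UnionI)
  next
    case (Basis S)
    then obtain f V where S: "S = {m \<in> Mp. (\<integral>x. f x \<partial>m) \<in> V}" and f: "f \<in> test_functions" and V: "open V" by blast
    have m: "m \<in> Mp" "(\<integral>x. f x \<partial>m) \<in> V" using Basis.prems S by auto
    then obtain \<eta> where \<eta>: "\<eta> > 0" "\<And>y. \<bar>y - (\<integral>x. f x \<partial>m)\<bar> < \<eta> \<Longrightarrow> y \<in> V"
      using V unfolding open_dist by (auto simp: dist_real_def)
    obtain C where C: "\<And>x. \<bar>f x\<bar> \<le> C" using f unfolding test_functions_def bounded_iff by auto
    have cont: "continuous_on UNIV f" using f by (simp add: test_functions_def)
    then have fm [measurable]: "f \<in> borel_measurable borel" by (rule borel_measurable_continuous_onI)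
    obtain n :: nat where n: "\<And>x. \<bar>x\<bar> > real n \<Longrightarrow> f x = 0" using test_function_support[OF f] by blast
    define code where "code = (\<lambda>i. prod_encode (i, n))"
    have code_0: "basic_test (code 0) = bump n" by (simp add: code_def basic_test_encode fun_eq_iff)
    define b where "b = basic_integral (code 0) m"
    have b0: "b \<ge> 0" unfolding b_def basic_integral_def code_0 using bump_bounds by simp
    \<comment> \<open>The approximation errors for \<open>m\<close> and \<open>m'\<close>, where the integral of the bump is at most \<open>b + 1\<close>, and the difference of the linear combinations are at most \<open>\<eta> / 4\<close> each.\<close>
    define \<epsilon> where "\<epsilon> = \<eta> / (4 * (b + 1))"
    have \<epsilon>: "\<epsilon> > 0" "\<epsilon> * (b + 1) = \<eta> / 4" using \<eta> b0 by (auto simp: \<epsilon>_def field_simps)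
    obtain d a where a: "\<And>x. \<bar>f x - (\<Sum>i\<le>d. a i * basic_test (code i) x)\<bar> \<le> \<epsilon> * bump n x"
      using test_function_approx[OF cont n \<epsilon>(1)] unfolding code_def by blast
    define A where "A = (\<Sum>i\<le>d. \<bar>a i\<bar>)"
    have A0: "A \<ge> 0" unfolding A_def by (intro sum_nonneg) auto
    define \<delta> where "\<delta> = min 1 (\<eta> / (4 * (A + 1)))"
    have \<delta>: "\<delta> > 0" "\<delta> \<le> 1" "A * \<delta> \<le> \<eta> / 4"
    proof -
      show "\<delta> > 0" "\<delta> \<le> 1" using \<eta> A0 by (auto simp: \<delta>_def)
      have "A * \<delta> \<le> (A + 1) * (\<eta> / (4 * (A + 1)))"
        using A0 \<eta> by (intro mult_mono) (auto simp: \<delta>_def)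
      also have "\<dots> = \<eta> / 4" using A0 by (simp add: field_simps)
      finally show "A * \<delta> \<le> \<eta> / 4" .
    qed
    have approx: "\<bar>(\<integral>x. f x \<partial>m') - (\<Sum>i\<le>d. a i * basic_integral (code i) m')\<bar> \<le> \<epsilon> * basic_integral (code 0) m'"
      if m': "m' \<in> Mp" for m'
    proof -
      note int = integrable_basic_test[OF m']
      have fi: "integrable m' f"
        by (rule integrable_compact_support[OF fm C n]) (use Mp_D[OF m'] in auto)
      have "(\<integral>x. f x \<partial>m') - (\<Sum>i\<le>d. a i * basic_integral (code i) m')
          = (\<integral>x. f x - (\<Sum>i\<le>d. a i * basic_test (code i) x) \<partial>m')"
        using fi int by (simp add: basic_integral_def)
      also have "\<bar>\<dots>\<bar> \<le> (\<integral>x. \<bar>f x - (\<Sum>i\<le>d. a i * basic_test (code i) x)\<bar> \<partial>m')"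
        by (rule integral_abs_bound)
      also have "\<dots> \<le> (\<integral>x. \<epsilon> * basic_test (code 0) x \<partial>m')"
        using fi int int[of "code 0", unfolded code_0] a by (intro integral_mono) (auto simp: code_0)
      also have "\<dots> = \<epsilon> * basic_integral (code 0) m'" by (simp add: basic_integral_def)
      finally show ?thesis .
    qed
    define J where "J = Suc (\<Sum>i\<le>d. code i)"
    have J: "code i < J" if "i \<le> d" for i
      unfolding J_def using member_le_sum[of i "{..d}" code] that by (simp add: less_Suc_eq_le)
    show ?case
    proof (rule exI[of _ J], rule exI[of _ \<delta>], intro conjI ballI impI)
      fix m' assume m': "m' \<in> Mp" "\<forall>k<J. \<bar>basic_integral k m' - basic_integral k m\<bar> < \<delta>"
      have close: "\<bar>basic_integral (code i) m' - basic_integral (code i) m\<bar> \<le> \<delta>" if "i \<le> d" for i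
        using m'(2) J[OF that] by (simp add: less_imp_le)
      have "basic_integral (code 0) m' \<le> b + 1" using close[of 0] \<delta> by (simp add: b_def)
      then have "\<epsilon> * basic_integral (code 0) m' \<le> \<eta> / 4"
        using \<epsilon> by (metis mult_left_mono less_imp_le)
      moreover have "\<epsilon> * basic_integral (code 0) m \<le> \<eta> / 4"
        using \<epsilon> b_def by (metis less_imp_le mult_left_mono le_add_same_cancel1 zero_le_one)
      moreover have "\<bar>(\<Sum>i\<le>d. a i * basic_integral (code i) m') - (\<Sum>i\<le>d. a i * basic_integral (code i) m)\<bar> \<le> \<eta> / 4"
      proof -
        have "\<bar>(\<Sum>i\<le>d. a i * basic_integral (code i) m') - (\<Sum>i\<le>d. a i * basic_integral (code i) m)\<bar>
            = \<bar>\<Sum>i\<le>d. a i * (basic_integral (code i) m' - basic_integral (code i) m)\<bar>"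
          by (simp add: sum_subtractf algebra_simps)
        also have "\<dots> \<le> (\<Sum>i\<le>d. \<bar>a i\<bar> * \<delta>)"
          using close by (intro order_trans[OF sum_abs] sum_mono) (auto simp: abs_mult intro!: mult_left_mono)
        also have "\<dots> = A * \<delta>" by (simp add: A_def sum_distrib_right)
        finally show ?thesis using \<delta> by linarith
      qed
      ultimately have "\<bar>(\<integral>x. f x \<partial>m') - (\<integral>x. f x \<partial>m)\<bar> < \<eta>"
        using approx[OF m'(1)] approx[OF m(1)] \<eta>(1) by linarith
      then show "m' \<in> S" using \<eta>(2) m' by (simp add: S)
    qed (use \<delta> in auto)
  qed
qed

text \<open>
  A vaguely open set is the preimage of an open set of sequences under the map to all basic integrals,
  and the Borel sets of sequences are generated by the coordinates. Without the countable family, the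
  vague Borel sets might be more than the evaluations can measure.
\<close>

lemma vague_measurableI:
  assumes [measurable]: "X \<in> S \<rightarrow>\<^sub>M point_meas" and Mp: "\<And>\<omega>. \<omega> \<in> space S \<Longrightarrow> X \<omega> \<in> Mp"
  shows "X \<in> S \<rightarrow>\<^sub>M borel_of_topology vague"
  unfolding borel_of_topology_def
proof (rule measurable_measure_of)
  show "{V. openin vague V} \<subseteq> Pow (topspace vague)" using openin_subset by auto
  show "X \<in> space S \<rightarrow> topspace vague" using Mp by (simp add: topspace_vague)
  fix O' assume "O' \<in> {V. openin vague V}"
  then have O': "openin vague O'" by simp
  obtain J \<delta> where J: "\<And>m. m \<in> O' \<Longrightarrow> \<delta> m > 0"
    "\<And>m m'. m \<in> O' \<Longrightarrow> m' \<in> Mp \<Longrightarrow> (\<And>k. k < (J m :: nat) \<Longrightarrow> \<bar>basic_integral k m' - basic_integral k m\<bar> < \<delta> m) \<Longrightarrow> m' \<in> O'"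
    using vague_open_box[OF O'] by metis
  define V where "V = (\<Union>m\<in>O'. \<Inter>k\<in>{..<J m}. {x :: nat \<Rightarrow> real. \<bar>x k - basic_integral k m\<bar> < \<delta> m})"
  have "open V"
    unfolding V_def by (intro open_UN open_INT ballI open_Collect_less continuous_intros) auto
  moreover have "(\<lambda>\<omega> k. basic_integral k (X \<omega>)) \<in> borel_measurable S"
    by (rule measurable_coordinatewise_then_product) (simp add: basic_integral_def)
  ultimately have "(\<lambda>\<omega> k. basic_integral k (X \<omega>)) -` V \<inter> space S \<in> sets S"
    by (intro measurable_sets[of _ S borel]) auto
  moreover have "(\<lambda>\<omega> k. basic_integral k (X \<omega>)) -` V \<inter> space S = X -` O' \<inter> space S"
  proof (intro set_eqI iffI)
    fix \<omega> assume "\<omega> \<in> (\<lambda>\<omega> k. basic_integral k (X \<omega>)) -` V \<inter> space S"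
    then show "\<omega> \<in> X -` O' \<inter> space S" using J(2) Mp by (auto simp: V_def)
  next
    fix \<omega> assume "\<omega> \<in> X -` O' \<inter> space S"
    then show "\<omega> \<in> (\<lambda>\<omega> k. basic_integral k (X \<omega>)) -` V \<inter> space S"
      using J(1) by (auto simp: V_def intro!: bexI[of _ "X \<omega>"])
  qed
  ultimately show "X -` O' \<inter> space S \<in> sets S" by simp
qed

lemma dirac_sum_countable:
  fixes x :: "'i :: countable \<Rightarrow> real"
  shows "\<exists>(I' :: nat set) x'. dirac_sum I x = dirac_sum I' x'"
proof -
  have "dirac_sum I x = dirac_sum (to_nat ` I) (\<lambda>n. x (from_nat n))"
  proof (rule measure_eqI)
    fix A assume "A \<in> sets (dirac_sum I x)"
    then have A: "A \<in> sets borel" by (simp add: dirac_sum_def)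
    have "(\<integral>\<^sup>+ i. indicator A (x (from_nat (to_nat i))) \<partial>count_space I)
        = (\<integral>\<^sup>+ n. indicator A (x (from_nat n)) \<partial>count_space (to_nat ` I))"
      by (rule nn_integral_bij_count_space) (auto simp: bij_betw_def intro: inj_on_subset[OF inj_to_nat])
    then show "emeasure (dirac_sum I x) A = emeasure (dirac_sum (to_nat ` I) (\<lambda>n. x (from_nat n))) A"
      by (simp add: emeasure_dirac_sum[OF A])
  qed (simp add: dirac_sum_def)
  then show ?thesis by blast
qed

text \<open>
  Only the indexing of the points by natural numbers has to be provided.
\<close>

lemma cluster_process_in_Mp_iff:
  fixes \<tau> :: "'i :: countable \<Rightarrow> real"
  shows "cluster_process \<tau> w \<in> Mp \<longleftrightarrow> locally_finite (cluster_process \<tau> w)"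
  using dirac_sum_countable unfolding Mp_def cluster_process_def by blast

lemma null_measure_in_Mp: "null_measure borel \<in> Mp"
proof -
  have "null_measure borel = dirac_sum ({} :: nat set) (\<lambda>_. 0)"
  proof (rule measure_eqI)
    fix A :: "real set" assume "A \<in> sets (null_measure borel)"
    then have A: "A \<in> sets borel" by simp
    show "emeasure (null_measure borel) A = emeasure (dirac_sum ({} :: nat set) (\<lambda>_. 0)) A"
      by (simp add: emeasure_dirac_sum[OF A])
  qed (simp add: dirac_sum_def)
  moreover have "locally_finite (null_measure borel)" by (simp add: locally_finite_def)
  ultimately show ?thesis unfolding Mp_def by blast
qed

lemma Mp_version_in_Mp: "Mp_version m \<in> Mp"
  by (simp add: Mp_version_def null_measure_in_Mp)

lemma Mp_version_cluster_measurable: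
  fixes \<tau> :: "'i :: countable \<Rightarrow> 's \<Rightarrow> real"
  assumes [measurable]: "\<And>i. \<tau> i \<in> borel_measurable S" "\<And>i. w i \<in> S \<rightarrow>\<^sub>M mark_space"
  shows "(\<lambda>x. Mp_version (cluster_process (\<lambda>i. \<tau> i x) (\<lambda>i. w i x))) \<in> S \<rightarrow>\<^sub>M borel_of_topology vague"
proof (rule vague_measurableI[OF _ Mp_version_in_Mp])
  have c [measurable]: "(\<lambda>x. cluster_process (\<lambda>i. \<tau> i x) (\<lambda>i. w i x)) \<in> S \<rightarrow>\<^sub>M point_meas"
    by (rule measurable_cluster_process) auto
  have "Measurable.pred S (\<lambda>x. \<forall>n::nat. emeasure (cluster_process (\<lambda>i. \<tau> i x) (\<lambda>i. w i x)) {- real n..real n} < \<infinity>)"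
    by measurable
  then have p: "Measurable.pred S (\<lambda>x. locally_finite (cluster_process (\<lambda>i. \<tau> i x) (\<lambda>i. w i x)))"
    by (simp add: locally_finite_iff)
  have n: "(\<lambda>x. null_measure borel) \<in> S \<rightarrow>\<^sub>M point_meas"
    by (simp add: space_point_meas)
  show "(\<lambda>x. Mp_version (cluster_process (\<lambda>i. \<tau> i x) (\<lambda>i. w i x))) \<in> S \<rightarrow>\<^sub>M point_meas"
    unfolding Mp_version_def cluster_process_in_Mp_iff
    using p by (intro measurable_If c n) (simp add: pred_def)
qed

lemma continuous_map_borel_measurable:
  assumes "continuous_map T euclideanreal F"
  shows "F \<in> borel_measurable (borel_of_topology T)"
proof (rule borel_measurableI)
  fix V :: "real set" assume "open V"
  then have "openin T {x \<in> topspace T. F x \<in> V}"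
    using assms by (simp add: continuous_map_def open_openin[symmetric])
  moreover have "space (borel_of_topology T) = topspace T"
    unfolding borel_of_topology_def by (rule space_measure_of) (use openin_subset in auto)
  moreover have "sets (borel_of_topology T) = sigma_sets (topspace T) {V. openin T V}"
    unfolding borel_of_topology_def by (rule sets_measure_of) (use openin_subset in auto)
  moreover have "F -` V \<inter> topspace T = {x \<in> topspace T. F x \<in> V}" by auto
  ultimately show "F -` V \<inter> space (borel_of_topology T) \<in> sets (borel_of_topology T)"
    by (auto intro: sigma_sets.Basic)
qed

section \<open>Convergence in distribution\<close>

text \<open>
  The Lipschitz regularization of \<open>F\<close> from below with respect to the first \<open>K\<close> basic integrals. It is
  defined for all real sequences \<open>x\<close>, not only for those that come from a point measure, and cut off at
  \<open>B\<close> to be bounded.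
\<close>

definition lower_envelope :: "(real measure \<Rightarrow> real) \<Rightarrow> real \<Rightarrow> nat \<Rightarrow> (nat \<Rightarrow> real) \<Rightarrow> real" where
  "lower_envelope F B K x = (INF m\<in>Mp. min B (F m + K * (\<Sum>k<K. \<bar>x k - basic_integral k m\<bar>)))"

context
  fixes F :: "real measure \<Rightarrow> real" and B :: real
  assumes F_cont: "continuous_map vague euclideanreal F" and F_bound: "\<And>m. m \<in> Mp \<Longrightarrow> \<bar>F m\<bar> \<le> B"
begin

lemma envelope_term_ge: "m \<in> Mp \<Longrightarrow> - B \<le> min B (F m + real K * (\<Sum>k<K. \<bar>x k - basic_integral k m\<bar>))"
proof -
  assume "m \<in> Mp"
  then have "\<bar>F m\<bar> \<le> B" by (rule F_bound)
  moreover have "0 \<le> real K * (\<Sum>k<K. \<bar>x k - basic_integral k m\<bar>)"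
    by (intro mult_nonneg_nonneg sum_nonneg) auto
  ultimately show ?thesis by linarith
qed

lemma envelope_bdd: "bdd_below ((\<lambda>m. min B (F m + real K * (\<Sum>k<K. \<bar>x k - basic_integral k m\<bar>))) ` Mp)"
  by (rule bdd_belowI2[where m = "- B"]) (rule envelope_term_ge)

lemma Mp_nonempty: "Mp \<noteq> {}"
  using null_measure_in_Mp by auto

lemma lower_envelope_bound: "\<bar>lower_envelope F B K x\<bar> \<le> B"
proof -
  have "- B \<le> lower_envelope F B K x"
    unfolding lower_envelope_def by (rule cINF_greatest[OF Mp_nonempty envelope_term_ge])
  moreover have "lower_envelope F B K x \<le> B"
    unfolding lower_envelope_def by (rule cINF_lower2[OF envelope_bdd null_measure_in_Mp]) simp
  ultimately show ?thesis by linarith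
qed

lemma lower_envelope_lipschitz:
  "\<bar>lower_envelope F B K x - lower_envelope F B K y\<bar> \<le> real K * (\<Sum>k<K. \<bar>x k - y k\<bar>)"
proof -
  have *: "lower_envelope F B K x \<le> lower_envelope F B K y + real K * (\<Sum>k<K. \<bar>x k - y k\<bar>)" for x y
  proof -
    have "lower_envelope F B K x - real K * (\<Sum>k<K. \<bar>x k - y k\<bar>) \<le> lower_envelope F B K y"
      unfolding lower_envelope_def[of F B K y]
    proof (rule cINF_greatest[OF Mp_nonempty])
      fix m assume m: "m \<in> Mp"
      have "lower_envelope F B K x \<le> min B (F m + real K * (\<Sum>k<K. \<bar>x k - basic_integral k m\<bar>))"
        unfolding lower_envelope_def by (rule cINF_lower[OF envelope_bdd m])
      moreover have "real K * (\<Sum>k<K. \<bar>x k - basic_integral k m\<bar>)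
          \<le> real K * (\<Sum>k<K. \<bar>y k - basic_integral k m\<bar>) + real K * (\<Sum>k<K. \<bar>x k - y k\<bar>)"
      proof -
        have "(\<Sum>k<K. \<bar>x k - basic_integral k m\<bar>) \<le> (\<Sum>k<K. \<bar>y k - basic_integral k m\<bar> + \<bar>x k - y k\<bar>)"
          by (intro sum_mono) linarith
        then show ?thesis by (simp add: sum.distrib distrib_left[symmetric] mult_left_mono)
      qed
      moreover have "0 \<le> real K * (\<Sum>k<K. \<bar>x k - y k\<bar>)"
        by (intro mult_nonneg_nonneg sum_nonneg) auto
      ultimately show "lower_envelope F B K x - real K * (\<Sum>k<K. \<bar>x k - y k\<bar>)
          \<le> min B (F m + real K * (\<Sum>k<K. \<bar>y k - basic_integral k m\<bar>))"
        by linarith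
    qed
    then show ?thesis by simp
  qed
  have sym: "(\<Sum>k<K. \<bar>y k - x k\<bar>) = (\<Sum>k<K. \<bar>x k - y k\<bar>)" by (simp add: abs_minus_commute)
  show ?thesis using *[of x y] *[of y x] unfolding sym by linarith
qed

lemma lower_envelope_le:
  assumes "m \<in> Mp"
  shows "lower_envelope F B K (\<lambda>k. basic_integral k m) \<le> F m"
  unfolding lower_envelope_def by (rule cINF_lower2[OF envelope_bdd assms]) simp

text \<open>
  Measures in a neighbourhood of \<open>m\<close> have values of \<open>F\<close> close to \<open>F m\<close>; for the others one of the basic
  integrals differs by \<open>\<delta>\<close>, and the penalty \<open>K * \<delta> \<ge> 2 * B\<close> prevents them from lowering the infimum.
\<close>

lemma lower_envelope_tendsto:
  assumes m: "m \<in> Mp"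
  shows "(\<lambda>K. lower_envelope F B K (\<lambda>k. basic_integral k m)) \<longlonglongrightarrow> F m"
proof (rule LIMSEQ_I)
  fix \<eta> :: real assume \<eta>: "\<eta> > 0"
  define O' where "O' = {m' \<in> topspace vague. F m' \<in> {F m - \<eta> / 2<..}}"
  have "openin euclideanreal {F m - \<eta> / 2<..}" by (simp add: open_openin[symmetric])
  then have "openin vague O'"
    using F_cont unfolding O'_def continuous_map_def by blast
  moreover have "m \<in> O'" using m \<eta> by (simp add: O'_def topspace_vague)
  ultimately obtain J \<delta> where \<delta>: "\<delta> > 0"
    and J: "\<And>m'. m' \<in> Mp \<Longrightarrow> (\<And>k. k < J \<Longrightarrow> \<bar>basic_integral k m' - basic_integral k m\<bar> < \<delta>) \<Longrightarrow> m' \<in> O'"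
    using vague_open_box by metis
  obtain K0 :: nat where K0: "2 * B / \<delta> \<le> real K0" using real_arch_simple by blast
  have "norm (lower_envelope F B K (\<lambda>k. basic_integral k m) - F m) < \<eta>" if K: "K \<ge> max J K0" for K
  proof -
    have "F m - \<eta> / 2 \<le> lower_envelope F B K (\<lambda>k. basic_integral k m)"
      unfolding lower_envelope_def
    proof (rule cINF_greatest[OF Mp_nonempty])
      fix m' assume m': "m' \<in> Mp"
      let ?s = "\<Sum>k<K. \<bar>basic_integral k m - basic_integral k m'\<bar>"
      have s0: "0 \<le> ?s" by (intro sum_nonneg) auto
      have "F m - \<eta> / 2 \<le> F m' + real K * ?s"
      proof (cases "m' \<in> O'")
        case True
        then have "F m - \<eta> / 2 < F m'" by (simp add: O'_def)
        moreover have "0 \<le> real K * ?s" using s0 by simp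
        ultimately show ?thesis by linarith
      next
        case False
        then obtain k where k: "k < J" "\<delta> \<le> \<bar>basic_integral k m' - basic_integral k m\<bar>"
          using J[OF m'] by (meson not_le)
        have "\<bar>basic_integral k m - basic_integral k m'\<bar> \<le> ?s"
          using k K by (intro member_le_sum) auto
        then have "\<delta> \<le> ?s" using k by (simp add: abs_minus_commute)
        have "2 * B \<le> real K0 * \<delta>" using K0 \<delta> by (simp add: field_simps)
        also have "\<dots> \<le> real K * ?s" using K \<open>\<delta> \<le> ?s\<close> \<delta> by (intro mult_mono) auto
        finally show ?thesis using F_bound[OF m] F_bound[OF m'] \<eta> by linarith
      qed
      then show "F m - \<eta> / 2 \<le> min B (F m' + real K * ?s)"
        using F_bound[OF m] \<eta> by auto
    qed
    then show ?thesis using lower_envelope_le[OF m, of K] \<eta> by simp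
  qed
  then show "\<exists>no. \<forall>n\<ge>no. norm (lower_envelope F B n (\<lambda>k. basic_integral k m) - F m) < \<eta>" by blast
qed

end

context renewal_cluster_setting begin

lemma measurable_renewal_Mp_version:
  "(\<lambda>\<omega>. Mp_version (renewal_at t \<omega>)) \<in> M \<rightarrow>\<^sub>M borel_of_topology vague"
  unfolding renewal_cluster_def theta_shift_cluster_process renewal_time_def
  by (rule Mp_version_cluster_measurable) auto

lemma measurable_stationary_Mp_version:
  "(\<lambda>\<omega>. Mp_version (stationary_cluster W U \<omega>)) \<in> N \<rightarrow>\<^sub>M borel_of_topology vague"
  unfolding stationary_cluster_def by (rule Mp_version_cluster_measurable) auto

lemma AE_renewal_Mp: "AE \<omega> in M. renewal_at t \<omega> \<in> Mp"
  using AE_renewal_locally_finite[of t]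
  by eventually_elim (simp add: renewal_cluster_def theta_shift_cluster_process cluster_process_in_Mp_iff)

lemma AE_stationary_Mp: "AE \<omega> in N. stationary_cluster W U \<omega> \<in> Mp"
  using N.AE_locally_finite
  by eventually_elim (simp add: stationary_cluster_def cluster_process_in_Mp_iff)

text \<open>
  The lower half of the convergence: a lower envelope with mean above \<open>c\<close> under the stationary law keeps
  its mean above \<open>c\<close> in the limit, and it is dominated by \<open>F\<close>.
\<close>

lemma eventually_expectation_greater:
  assumes cont: "continuous_map vague euclideanreal F" and B: "\<And>m. m \<in> Mp \<Longrightarrow> \<bar>F m\<bar> \<le> B" and "c < N.expectation (\<lambda>\<omega>. F (Mp_version (stationary_cluster W U \<omega>)))"
  shows "\<forall>\<^sub>F t in at_top. c < M.expectation (\<lambda>\<omega>. F (Mp_version (renewal_at t \<omega>)))"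
proof -
  define G where "G = (\<lambda>K m. lower_envelope F B K (\<lambda>k. basic_integral k m))"
  note Fm [measurable] = continuous_map_borel_measurable[OF cont]
  have lip: "\<exists>a C L. lipschitz_functional K basic_test (lower_envelope F B K) a C L B (real K)" for K
    by (intro basic_lipschitz_functional lower_envelope_bound[OF cont B] lower_envelope_lipschitz[OF cont B]) auto
  have H: "lipschitz_functional.H basic_test (lower_envelope F B K) = G K" for K
  proof -
    obtain a C L where "lipschitz_functional K basic_test (lower_envelope F B K) a C L B (real K)" using lip by blast
    then interpret lipschitz_functional K basic_test "lower_envelope F B K" a C L B "real K" .
    show ?thesis by (simp add: H_def[abs_def] G_def basic_integral_def)
  qed
  have conv: "((\<lambda>t. M.expectation (\<lambda>\<omega>. G K (renewal_at t \<omega>)))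
      \<longlongrightarrow> N.expectation (\<lambda>\<omega>. G K (stationary_cluster W U \<omega>))) at_top" for K
    using lipschitz_functional_convergence lip[of K] unfolding H[symmetric] by blast
  have wf: "\<exists>a. window_functional_in_setting M W' N W U (G K) a B" for K
  proof -
    obtain a C L where "lipschitz_functional K basic_test (lower_envelope F B K) a C L B (real K)" using lip by blast
    then interpret lipschitz_functional K basic_test "lower_envelope F B K" a C L B "real K" .
    interpret window_functional_in_setting M W' N W U H a B by unfold_locales
    show ?thesis using window_functional_in_setting_axioms unfolding H by blast
  qed
  have "(\<lambda>K. N.expectation (\<lambda>\<omega>. G K (stationary_cluster W U \<omega>))) \<longlonglongrightarrow> N.expectation (\<lambda>\<omega>. F (Mp_version (stationary_cluster W U \<omega>)))"
  proof (rule integral_dominated_convergence[where w = "\<lambda>_. B"])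
    show "(\<lambda>\<omega>. F (Mp_version (stationary_cluster W U \<omega>))) \<in> borel_measurable N"
      by (rule measurable_compose[OF measurable_stationary_Mp_version Fm])
    show "(\<lambda>\<omega>. G K (stationary_cluster W U \<omega>)) \<in> borel_measurable N" for K
      using wf[of K] window_functional_in_setting.measurable_H_stationary by blast
    show "AE \<omega> in N. (\<lambda>K. G K (stationary_cluster W U \<omega>)) \<longlonglongrightarrow> F (Mp_version (stationary_cluster W U \<omega>))"
      using AE_stationary_Mp
      by eventually_elim (simp add: G_def Mp_version_def lower_envelope_tendsto[OF cont B])
    show "AE \<omega> in N. norm (G K (stationary_cluster W U \<omega>)) \<le> B" for K
      by (simp add: G_def lower_envelope_bound[OF cont B])
  qed simp
  from order_tendstoD(1)[OF this assms(3)]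
  obtain K where K: "c < N.expectation (\<lambda>\<omega>. G K (stationary_cluster W U \<omega>))"
    unfolding eventually_sequentially by blast
  show ?thesis
    using order_tendstoD(1)[OF conv K]
  proof eventually_elim
    case (elim t)
    obtain a where "window_functional_in_setting M W' N W U (G K) a B" using wf by blast
    then interpret window_functional_in_setting M W' N W U "G K" a B .
    have "M.expectation (\<lambda>\<omega>. G K (renewal_at t \<omega>))
        \<le> M.expectation (\<lambda>\<omega>. F (Mp_version (renewal_at t \<omega>)))"
    proof (rule integral_mono_AE)
      show "integrable M (\<lambda>\<omega>. G K (renewal_at t \<omega>))" by (rule integrable_renewal_value)
      show "integrable M (\<lambda>\<omega>. F (Mp_version (renewal_at t \<omega>)))"
        by (rule M.integrable_const_bound[of _ B])
          (auto intro!: B Mp_version_in_Mp measurable_compose[OF measurable_renewal_Mp_version Fm])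
      show "AE \<omega> in M. G K (renewal_at t \<omega>) \<le> F (Mp_version (renewal_at t \<omega>))"
        using AE_renewal_Mp[of t]
        by eventually_elim (simp add: G_def Mp_version_def lower_envelope_le[OF cont B])
    qed
    with elim show ?case by simp
  qed
qed

theorem converges_in_distribution_stationary:
  "converges_in_distribution vague
    M (\<lambda>t \<omega>. Mp_version (renewal_at t \<omega>))
    N (\<lambda>\<omega>. Mp_version (stationary_cluster W U \<omega>)) at_top"
  unfolding converges_in_distribution_def
proof (intro conjI allI impI)
  fix F :: "real measure \<Rightarrow> real"
  assume F: "continuous_map vague euclideanreal F \<and> bounded (F ` topspace vague)"
  then obtain B where B: "\<And>m. m \<in> Mp \<Longrightarrow> \<bar>F m\<bar> \<le> B"
    unfolding bounded_iff topspace_vague by auto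
  let ?l = "N.expectation (\<lambda>\<omega>. F (Mp_version (stationary_cluster W U \<omega>)))"
  show "((\<lambda>t. M.expectation (\<lambda>\<omega>. F (Mp_version (renewal_at t \<omega>)))) \<longlongrightarrow> ?l) at_top"
  proof (rule order_tendstoI)
    fix c assume "c < ?l"
    then show "\<forall>\<^sub>F t in at_top. c < M.expectation (\<lambda>\<omega>. F (Mp_version (renewal_at t \<omega>)))"
      using F by (intro eventually_expectation_greater[OF _ B]) auto
  next
    fix c assume "?l < c"
    then have "\<forall>\<^sub>F t in at_top. - c < M.expectation (\<lambda>\<omega>. - F (Mp_version (renewal_at t \<omega>)))"
      using F B by (intro eventually_expectation_greater[of "\<lambda>m. - F m" B]) (auto intro: continuous_map_minus)
    then show "\<forall>\<^sub>F t in at_top. M.expectation (\<lambda>\<omega>. F (Mp_version (renewal_at t \<omega>))) < c"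
      by simp
  qed
qed (rule measurable_renewal_Mp_version measurable_stationary_Mp_version)+

end

theorem theorem3p3:
  fixes M :: "'a measure" and W' :: "nat \<Rightarrow> 'a \<Rightarrow> mark"
    and N :: "'b measure" and W :: "int \<Rightarrow> 'b \<Rightarrow> mark" and U :: "'b \<Rightarrow> real"
  assumes "renewal_cluster_process M W'"
    and "stationary_version M W' N W U"
    and "integrable M (\<lambda>\<omega>. radius (W' 1 \<omega>))"
  shows "converges_in_distribution vague
           M (\<lambda>t \<omega>. Mp_version (theta_shift t (renewal_cluster W' \<omega>)))
           N (\<lambda>\<omega>. Mp_version (stationary_cluster W U \<omega>))
           at_top"
proof -
  interpret renewal_cluster_setting M W' N W U
    using assms by (simp add: renewal_cluster_setting_def renewal_cluster_setting_axioms_def)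
  show ?thesis by (rule converges_in_distribution_stationary)
qed

end
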